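(* Let $q\in(-1,1)\setminus\{0\}$, let $\mathcal{A}$ be the Hopf $*$-algebra of $SU_q(2)$, and let $(\mathcal{E},d)$ be either of the two bicovariant first order differential calculi $4D_+$ and $4D_-$ on $\mathcal{A}$. Let ${}_0\sigma:{}_0\mathcal{E}\otimes_{\mathbb{C}}{}_0\mathcal{E}\to{}_0\mathcal{E}\otimes_{\mathbb{C}}{}_0\mathcal{E}$ be the restriction of Woronowicz's braiding map $\sigma$ to left-invariant elements. Then the linear map ${}_0\sigma$ is diagonalisable and has the minimal polynomial equation $$({}_0\sigma-1)({}_0\sigma+q^2)({}_0\sigma+q^{-2})=0.$$
   Context: **Quantum group.** $\mathcal{A}$ is the unital Hopf $*$-algebra over $\mathbb{C}$ generated by $\alpha,\gamma$ and their adjoints with relations $\alpha^*\alpha+\gamma^*\gamma=1$, $\alpha\alpha^*+q^2\gamma\gamma^*=1$, $\gamma^*\gamma=\gamma\gamma^*$, $\alpha\gamma=q\gamma\alpha$, $\alpha\gamma^*=q\gamma^*\alpha$, and comultiplication $\Delta(\alpha)=\alpha\otimes\alpha-q\gamma^*\otimes\gamma$, $\Delta(\gamma)=\gamma\otimes\alpha+\alpha^*\otimes\gamma$. Its counit is $\epsilon$ and its antipode is $S$. Sweedler notation: $\Delta(a)=\sum a_{(1)}\otimes a_{(2)}$. **Bicovariant bimodules and calculi.** A bicovariant $\mathcal{A}$-bimodule is an $\mathcal{A}$-bimodule $\mathcal{E}$ with a left coaction $\Delta_{\mathcal{E}}:\mathcal{E}\to\mathcal{A}\otimes\mathcal{E}$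 and a right coaction ${}_{\mathcal{E}}\Delta:\mathcal{E}\to\mathcal{E}\otimes\mathcal{A}$ making it a bicomodule (the two coactions commute), both compatible with the bimodule structure: $\Delta_{\mathcal{E}}(a\rho b)=\Delta(a)\Delta_{\mathcal{E}}(\rho)\Delta(b)$ and ${}_{\mathcal{E}}\Delta(a\rho b)=\Delta(a)\,{}_{\mathcal{E}}\Delta(\rho)\Delta(b)$. An element $e$ is left-invariant if $\Delta_{\mathcal{E}}(e)=1\otimes e$ and right-invariant if ${}_{\mathcal{E}}\Delta(e)=e\otimes 1$; ${}_0\mathcal{E}$ denotes the vector space of left-invariant elements. A first order differential calculus $(\mathcal{E},d)$ (an $\mathcal{A}$-bimodule $\mathcal{E}$ with a derivation $d:\mathcal{A}\to\mathcal{E}$ such that $\mathcal{E}$ is spanned by the elements $a\,db$) is bicovariant if $\sum_k a_kdb_k=0$ implies $\sum_k\Delta(a_k)(\mathrm{id}\otimes d)\Delta(b_k)=0$ and $\sum_k\Delta(a_k)(d\otimes\mathrm{id})\Delta(b_k)=0$. Then $\mathcal{E}$ is canonically a bicovariant bimodule and $d$ is bicovariant. A bicovariant calculus is determined up to isomorphism by the right ideal $\{a\in\ker\epsilon:\sum S(a_{(1)})\,d a_{(2)}=0\}$. **The calculi $4D_\pm$.** For $q\in(-1,1)\setminus\{0\}$ there are, up to isomorphism, exactly two bicovariant first order differential calculi on $\mathcal{A}$ with $\dim{}_0\mathcal{E}=4$; these are the $4D_+$ and $4D_-$ calculi. Explicitly, $4D_\pm$ is the bicovariant calculus whose associated right ideal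 is generated by the nine elements $\gamma^2,\ \gamma^{*2},\ \gamma(\alpha-\alpha^* ),\ \gamma^*(\alpha-\alpha^* ),\ \alpha^2+q^2\alpha^{*2}-(1+q^2)(\alpha\alpha^*-\gamma\gamma^* ),\ z_\pm\gamma,\ z_\pm\gamma^*,\ z_\pm(\alpha-\alpha^* ),\ z_\pm(q^2\alpha+\alpha^*-(1+q^2))$, where $z_\pm=q^2\alpha+\alpha^*\mp(q^3+q^{-1})$. **Braiding.** For a bicovariant bimodule $\mathcal{E}$ there is a unique $\mathcal{A}$-bimodule map $\sigma:\mathcal{E}\otimes_{\mathcal{A}}\mathcal{E}\to\mathcal{E}\otimes_{\mathcal{A}}\mathcal{E}$ with $\sigma(\omega\otimes_{\mathcal{A}}\eta)=\eta\otimes_{\mathcal{A}}\omega$ for $\omega$ left-invariant and $\eta$ right-invariant; it is invertible and bicovariant. The map $\omega\otimes_{\mathbb{C}}\omega'\mapsto\omega\otimes_{\mathcal{A}}\omega'$ identifies ${}_0\mathcal{E}\otimes_{\mathbb{C}}{}_0\mathcal{E}$ with the space of left-invariant elements of $\mathcal{E}\otimes_{\mathcal{A}}\mathcal{E}$, which is preserved by $\sigma$; ${}_0\sigma$ is the restriction of $\sigma$ to it. *)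

theory Defs
  imports
    Complex_Main
    "HOL-Library.Poly_Mapping"
    "HOL-Computational_Algebra.Polynomial"
begin

section \<open>Complex vector spaces and algebras\<close>

class complex_vector = ab_group_add +
  fixes scaleC :: "complex \<Rightarrow> 'a \<Rightarrow> 'a" (infixr \<open>*\<^sub>C\<close> 75)
  assumes scaleC_add_right: "c *\<^sub>C (x + y) = c *\<^sub>C x + c *\<^sub>C y"
    and scaleC_add_left: "(c + c') *\<^sub>C x = c *\<^sub>C x + c' *\<^sub>C x"
    and scaleC_scaleC: "c *\<^sub>C c' *\<^sub>C x = (c * c') *\<^sub>C x"
    and scaleC_one: "1 *\<^sub>C x = x"

global_interpretation cvs: vector_space "scaleC :: complex \<Rightarrow> 'a \<Rightarrow> 'a::complex_vector"
  by unfold_locales (simp_all add: scaleC_add_right scaleC_add_left scaleC_scaleC scaleC_one)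

abbreviation clinear :: "('a::complex_vector \<Rightarrow> 'b::complex_vector) \<Rightarrow> bool"
  where "clinear \<equiv> Vector_Spaces.linear scaleC scaleC"

lemma clinear_iff:
  "clinear f \<longleftrightarrow> (\<forall>x y. f (x + y) = f x + f y) \<and> (\<forall>c x. f (c *\<^sub>C x) = c *\<^sub>C f x)"
  by (auto simp: module_hom_iff_linear[symmetric] module_hom_iff intro: cvs.module_axioms)

definition cbilinear :: "('a::complex_vector \<Rightarrow> 'b::complex_vector \<Rightarrow> 'c::complex_vector) \<Rightarrow> bool"
  where "cbilinear f \<longleftrightarrow> (\<forall>x. clinear (f x)) \<and> (\<forall>y. clinear (\<lambda>x. f x y))"

class complex_algebra_1 = complex_vector + ring_1 +
  assumes mult_scaleC_left: "(c *\<^sub>C x) * y = c *\<^sub>C (x * y)"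
    and mult_scaleC_right: "x * (c *\<^sub>C y) = c *\<^sub>C (x * y)"

instantiation complex :: complex_vector
begin
definition scaleC_complex :: "complex \<Rightarrow> complex \<Rightarrow> complex"
  where "scaleC_complex c x = c * x"
instance
  by standard (simp_all add: scaleC_complex_def algebra_simps)
end

instantiation poly_mapping :: (type, complex_vector) complex_vector
begin
lift_definition scaleC_poly_mapping :: "complex \<Rightarrow> ('a \<Rightarrow>\<^sub>0 'b) \<Rightarrow> ('a \<Rightarrow>\<^sub>0 'b)"
  is "\<lambda>c f k. c *\<^sub>C f k"
proof -
  fix c :: complex and f :: "'a \<Rightarrow> 'b"
  assume "finite {k. f k \<noteq> 0}"
  moreover have "{k. c *\<^sub>C f k \<noteq> 0} \<subseteq> {k. f k \<noteq> 0}" by auto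
  ultimately show "finite {k. c *\<^sub>C f k \<noteq> 0}" by (rule rev_finite_subset)
qed
instance
  by (standard; transfer)
    (simp_all add: fun_eq_iff scaleC_add_right scaleC_add_left scaleC_scaleC scaleC_one)
end

section \<open>Tensor products over the complex numbers\<close>

text \<open>The tensor product is the free vector space on pairs modulo the bilinearity relators.\<close>

definition tensor_relators ::
    "(('a::complex_vector \<times> 'b::complex_vector) \<Rightarrow>\<^sub>0 complex) set"
  where "tensor_relators =
      {Poly_Mapping.single (x + x', y) 1 - Poly_Mapping.single (x, y) 1
        - Poly_Mapping.single (x', y) 1 | x x' y. True}
    \<union> {Poly_Mapping.single (x, y + y') 1 - Poly_Mapping.single (x, y) 1
        - Poly_Mapping.single (x, y') 1 | x y y'. True}
    \<union> {Poly_Mapping.single (c *\<^sub>C x, y) 1 - c *\<^sub>C Poly_Mapping.single (x, y) 1 | c x y. True}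
    \<union> {Poly_Mapping.single (x, c *\<^sub>C y) 1 - c *\<^sub>C Poly_Mapping.single (x, y) 1 | c x y. True}"

definition tensor_equiv ::
    "(('a::complex_vector \<times> 'b::complex_vector) \<Rightarrow>\<^sub>0 complex)
      \<Rightarrow> (('a \<times> 'b) \<Rightarrow>\<^sub>0 complex) \<Rightarrow> bool"
  where "tensor_equiv f g \<longleftrightarrow> f - g \<in> cvs.span tensor_relators"

lemma equivp_tensor_equiv:
  "equivp (tensor_equiv :: (('a::complex_vector \<times> 'b::complex_vector) \<Rightarrow>\<^sub>0 complex) \<Rightarrow> _)"
proof (rule equivpI)
  let ?R = "tensor_equiv :: (('a \<times> 'b) \<Rightarrow>\<^sub>0 complex) \<Rightarrow> _"
  show "reflp ?R"
    by (simp add: reflp_def tensor_equiv_def cvs.span_zero)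
  show "symp ?R"
    unfolding symp_def tensor_equiv_def by (metis cvs.span_neg minus_diff_eq)
  show "transp ?R"
    unfolding transp_def tensor_equiv_def
  proof (intro allI impI)
    fix f g h :: "('a \<times> 'b) \<Rightarrow>\<^sub>0 complex"
    assume "f - g \<in> cvs.span tensor_relators" "g - h \<in> cvs.span tensor_relators"
    then have "(f - g) + (g - h) \<in> cvs.span tensor_relators" by (rule cvs.span_add)
    then show "f - h \<in> cvs.span tensor_relators" by simp
  qed
qed

quotient_type (overloaded) ('a, 'b) tensor =
    "('a::complex_vector \<times> 'b::complex_vector) \<Rightarrow>\<^sub>0 complex" / tensor_equiv
  by (rule equivp_tensor_equiv)

instantiation tensor :: (complex_vector, complex_vector) complex_vector
begin

lift_definition zero_tensor :: "('a, 'b) tensor" is 0 .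

lift_definition plus_tensor :: "('a, 'b) tensor \<Rightarrow> ('a, 'b) tensor \<Rightarrow> ('a, 'b) tensor" is "(+)"
  unfolding tensor_equiv_def by (simp only: add_diff_add cvs.span_add)

lift_definition minus_tensor :: "('a, 'b) tensor \<Rightarrow> ('a, 'b) tensor \<Rightarrow> ('a, 'b) tensor" is "(-)"
  unfolding tensor_equiv_def
proof -
  fix f f' g g' :: "('a \<times> 'b) \<Rightarrow>\<^sub>0 complex"
  assume "f - f' \<in> cvs.span tensor_relators" "g - g' \<in> cvs.span tensor_relators"
  then have "(f - f') - (g - g') \<in> cvs.span tensor_relators" by (rule cvs.span_diff)
  then show "(f - g) - (f' - g') \<in> cvs.span tensor_relators" by (simp add: algebra_simps)
qed

lift_definition uminus_tensor :: "('a, 'b) tensor \<Rightarrow> ('a, 'b) tensor" is uminus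
  unfolding tensor_equiv_def
proof -
  fix f g :: "('a \<times> 'b) \<Rightarrow>\<^sub>0 complex"
  assume "f - g \<in> cvs.span tensor_relators"
  then have "- (f - g) \<in> cvs.span tensor_relators" by (rule cvs.span_neg)
  then show "- f - - g \<in> cvs.span tensor_relators" by simp
qed

lift_definition scaleC_tensor :: "complex \<Rightarrow> ('a, 'b) tensor \<Rightarrow> ('a, 'b) tensor" is scaleC
  unfolding tensor_equiv_def by (simp only: cvs.scale_right_diff_distrib[symmetric] cvs.span_scale)

instance
  by (standard; transfer)
    (simp_all add: tensor_equiv_def cvs.span_zero scaleC_add_right scaleC_add_left
      scaleC_scaleC scaleC_one algebra_simps)

end

lift_definition tensor_pure ::
    "'a::complex_vector \<Rightarrow> 'b::complex_vector \<Rightarrow> ('a, 'b) tensor" (infixl \<open>\<otimes>\<^sub>C\<close> 70)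
  is "\<lambda>x y. Poly_Mapping.single (x, y) 1" .

text \<open>The linear map on the tensor product induced by a bilinear map.\<close>

definition tensor_lift ::
    "('a::complex_vector \<Rightarrow> 'b::complex_vector \<Rightarrow> 'c::complex_vector) \<Rightarrow> ('a, 'b) tensor \<Rightarrow> 'c"
  where "tensor_lift f = (THE h. clinear h \<and> (\<forall>x y. h (x \<otimes>\<^sub>C y) = f x y))"

lemma cbilinearD:
  assumes "cbilinear f"
  shows "f (x + x') y = f x y + f x' y" "f x (y + y') = f x y + f x y'"
    "f (c *\<^sub>C x) y = c *\<^sub>C f x y" "f x (c *\<^sub>C y) = c *\<^sub>C f x y"
  using assms by (simp_all add: cbilinear_def clinear_iff)

lemma tensor_eqI:
  fixes f g :: "('a::complex_vector \<times> 'b::complex_vector) \<Rightarrow>\<^sub>0 complex"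
  assumes "f - g \<in> tensor_relators"
  shows "abs_tensor f = abs_tensor g"
  using assms by (simp add: tensor.abs_eq_iff tensor_equiv_def cvs.span_base)

lemma cbilinear_tensor_pure: "cbilinear (\<otimes>\<^sub>C)"
proof -
  have "(x + x') \<otimes>\<^sub>C y = x \<otimes>\<^sub>C y + x' \<otimes>\<^sub>C y" for x x' :: 'a and y :: 'b
    unfolding tensor_pure.abs_eq plus_tensor.abs_eq
    by (rule tensor_eqI, unfold tensor_relators_def diff_diff_eq[symmetric]) blast
  moreover have "x \<otimes>\<^sub>C (y + y') = x \<otimes>\<^sub>C y + x \<otimes>\<^sub>C y'" for x :: 'a and y y' :: 'b
    unfolding tensor_pure.abs_eq plus_tensor.abs_eq
    by (rule tensor_eqI, unfold tensor_relators_def diff_diff_eq[symmetric]) blast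
  moreover have "(c *\<^sub>C x) \<otimes>\<^sub>C y = c *\<^sub>C (x \<otimes>\<^sub>C y)" for c and x :: 'a and y :: 'b
    unfolding tensor_pure.abs_eq scaleC_tensor.abs_eq
    by (rule tensor_eqI, unfold tensor_relators_def) blast
  moreover have "x \<otimes>\<^sub>C (c *\<^sub>C y) = c *\<^sub>C (x \<otimes>\<^sub>C y)" for c and x :: 'a and y :: 'b
    unfolding tensor_pure.abs_eq scaleC_tensor.abs_eq
    by (rule tensor_eqI, unfold tensor_relators_def) blast
  ultimately show ?thesis
    by (simp add: cbilinear_def clinear_iff)
qed

lemma clinear_eq_tensor:
  assumes "clinear h" "clinear h'" "\<And>x y. h (x \<otimes>\<^sub>C y) = h' (x \<otimes>\<^sub>C y)"
  shows "h = h'"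
proof
  fix t
  interpret h: Vector_Spaces.linear scaleC scaleC h by fact
  interpret h': Vector_Spaces.linear scaleC scaleC h' by fact
  have single: "h (abs_tensor (Poly_Mapping.single k c)) = h' (abs_tensor (Poly_Mapping.single k c))"
    for k c
  proof -
    obtain x y where k: "k = (x, y)" by force
    have "Poly_Mapping.single k c = c *\<^sub>C Poly_Mapping.single k 1"
      by transfer (auto simp: fun_eq_iff scaleC_complex_def when_def)
    then have "abs_tensor (Poly_Mapping.single k c) = c *\<^sub>C (x \<otimes>\<^sub>C y)"
      by (simp add: k tensor_pure.abs_eq scaleC_tensor.abs_eq)
    then show ?thesis by (simp add: h.scale h'.scale assms(3))
  qed
  have "h (abs_tensor (\<Sum>k\<in>K. Poly_Mapping.single k (c k)))
      = h' (abs_tensor (\<Sum>k\<in>K. Poly_Mapping.single k (c k)))" if "finite K" for K c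
    using that
  proof (induction K)
    case empty
    then show ?case
      by (simp add: zero_tensor_def[symmetric] h.zero h'.zero)
  next
    case (insert k K)
    then show ?case
      by (simp add: plus_tensor.abs_eq[symmetric] h.add h'.add single)
  qed
  moreover have "(\<Sum>k\<in>Poly_Mapping.keys f. Poly_Mapping.single k (Poly_Mapping.lookup f k)) = f"
    for f :: "('a \<times> 'b) \<Rightarrow>\<^sub>0 complex"
    by (rule poly_mapping_eqI)
      (auto simp: lookup_sum lookup_single when_def in_keys_iff cong: if_cong)
  ultimately have "h (abs_tensor f) = h' (abs_tensor f)" for f
    by (metis finite_keys)
  then show "h t = h' t" by (induction t rule: tensor.abs_induct)
qed

lemma tensor_lift_unique:
  assumes "clinear h" "\<And>x y. h (x \<otimes>\<^sub>C y) = f x y"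
  shows "tensor_lift f = h"
  unfolding tensor_lift_def
  by (rule the_equality) (use assms in \<open>auto intro: clinear_eq_tensor\<close>)

lemma
  assumes "cbilinear f"
  shows clinear_tensor_lift: "clinear (tensor_lift f)"
    and tensor_lift_pure: "tensor_lift f (x \<otimes>\<^sub>C y) = f x y"
proof -
  define F where "F p = (\<Sum>k\<in>Poly_Mapping.keys p. Poly_Mapping.lookup p k *\<^sub>C f (fst k) (snd k))"
    for p :: "('a \<times> 'b) \<Rightarrow>\<^sub>0 complex"
  have F_superset: "F p = (\<Sum>k\<in>K. Poly_Mapping.lookup p k *\<^sub>C f (fst k) (snd k))"
    if "finite K" "Poly_Mapping.keys p \<subseteq> K" for p K
    unfolding F_def using that
    by (intro sum.mono_neutral_left) (auto simp: in_keys_iff)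
  have F_add: "F (p + p') = F p + F p'" for p p'
  proof -
    let ?K = "Poly_Mapping.keys p \<union> Poly_Mapping.keys p'"
    have "Poly_Mapping.keys (p + p') \<subseteq> ?K" by (rule Poly_Mapping.keys_add)
    then show ?thesis
      by (simp add: F_superset[of ?K] lookup_add scaleC_add_left sum.distrib)
  qed
  have lookup_scaleC: "Poly_Mapping.lookup (c *\<^sub>C p) k = c * Poly_Mapping.lookup p k"
    for c k and p :: "('a \<times> 'b) \<Rightarrow>\<^sub>0 complex"
    by (simp add: scaleC_poly_mapping.rep_eq scaleC_complex_def)
  have F_scale: "F (c *\<^sub>C p) = c *\<^sub>C F p" for c p
  proof -
    have "Poly_Mapping.keys (c *\<^sub>C p) \<subseteq> Poly_Mapping.keys p"
      by (auto simp: in_keys_iff lookup_scaleC)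
    then show ?thesis
      by (simp add: F_superset[of "Poly_Mapping.keys p"] lookup_scaleC cvs.scale_sum_right
          scaleC_scaleC)
  qed
  have F_lin: "clinear F"
    by (simp add: clinear_iff F_add F_scale)
  interpret F: Vector_Spaces.linear scaleC scaleC F by (rule F_lin)
  have F_single: "F (Poly_Mapping.single (x, y) 1) = f x y" for x y
    by (simp add: F_def scaleC_one)
  have F_relators: "F r = 0" if "r \<in> tensor_relators" for r
    using that unfolding tensor_relators_def
    by (auto simp: F.diff F_scale F_single cbilinearD[OF assms])
  have "F p = 0" if "p \<in> cvs.span tensor_relators" for p
    using that
    by (induction rule: cvs.span_induct_alt) (auto simp: F.zero F_add F_scale F_relators)
  then have F_equiv: "F p = F p'" if "tensor_equiv p p'" for p p'
    using that F.diff[of p p'] by (simp add: tensor_equiv_def)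
  define h where "h t = F (rep_tensor t)" for t
  have h_abs: "h (abs_tensor p) = F p" for p
    unfolding h_def
    by (rule F_equiv) (simp add: Quotient3_rep_abs equivp_tensor_equiv rep_abs_rsp_left
        Quotient3_tensor equivp_reflp[OF equivp_tensor_equiv])
  have h_add: "h (s + t) = h s + h t" for s t
    by (induction s rule: tensor.abs_induct, induction t rule: tensor.abs_induct)
      (simp add: plus_tensor.abs_eq h_abs F_add)
  have h_scale: "h (c *\<^sub>C t) = c *\<^sub>C h t" for c t
    by (induction t rule: tensor.abs_induct) (simp add: scaleC_tensor.abs_eq h_abs F_scale)
  have h_lin: "clinear h"
    by (simp add: clinear_iff h_add h_scale)
  have h_pure: "h (x \<otimes>\<^sub>C y) = f x y" for x y
    by (simp add: tensor_pure.abs_eq h_abs F_single)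
  have "tensor_lift f = h"
    by (rule tensor_lift_unique) (fact h_lin, fact h_pure)
  then show "clinear (tensor_lift f)" "tensor_lift f (x \<otimes>\<^sub>C y) = f x y"
    using h_lin h_pure by simp_all
qed

definition tensor_map ::
    "('a::complex_vector \<Rightarrow> 'c::complex_vector) \<Rightarrow> ('b::complex_vector \<Rightarrow> 'd::complex_vector)
      \<Rightarrow> ('a, 'b) tensor \<Rightarrow> ('c, 'd) tensor"
  where "tensor_map f g = tensor_lift (\<lambda>x y. f x \<otimes>\<^sub>C g y)"

text \<open>Legwise product: \<open>tensor_prod f g (a \<otimes> b) (c \<otimes> d) = f a c \<otimes> g b d\<close>. It provides the
  multiplication of \<open>A \<otimes> A\<close> and the actions of \<open>A \<otimes> A\<close> on \<open>A \<otimes> E\<close> and \<open>E \<otimes> A\<close>.\<close>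

definition tensor_prod ::
    "('a::complex_vector \<Rightarrow> 'c::complex_vector \<Rightarrow> 'e::complex_vector)
      \<Rightarrow> ('b::complex_vector \<Rightarrow> 'd::complex_vector \<Rightarrow> 'f::complex_vector)
      \<Rightarrow> ('a, 'b) tensor \<Rightarrow> ('c, 'd) tensor \<Rightarrow> ('e, 'f) tensor"
  where "tensor_prod f g s t =
    tensor_lift (\<lambda>a b. tensor_lift (\<lambda>c d. f a c \<otimes>\<^sub>C g b d) t) s"

definition tensor_assoc ::
    "(('a::complex_vector, 'b::complex_vector) tensor, 'c::complex_vector) tensor
      \<Rightarrow> ('a, ('b, 'c) tensor) tensor"
  where "tensor_assoc = tensor_lift (\<lambda>t z. tensor_lift (\<lambda>x y. x \<otimes>\<^sub>C (y \<otimes>\<^sub>C z)) t)"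

section \<open>Hopf star-algebras\<close>

locale hopf_star_algebra =
  fixes \<Delta> :: "'a::complex_algebra_1 \<Rightarrow> ('a, 'a) tensor"
    and \<epsilon> :: "'a \<Rightarrow> complex"
    and S :: "'a \<Rightarrow> 'a"
    and star :: "'a \<Rightarrow> 'a"
  assumes comult_linear: "clinear \<Delta>"
    and comult_one: "\<Delta> 1 = 1 \<otimes>\<^sub>C 1"
    and comult_mult: "\<Delta> (a * b) = tensor_prod (*) (*) (\<Delta> a) (\<Delta> b)"
    and coassoc: "tensor_assoc (tensor_map \<Delta> id (\<Delta> a)) = tensor_map id \<Delta> (\<Delta> a)"
    and counit_linear: "clinear \<epsilon>"
    and counit_one: "\<epsilon> 1 = 1"
    and counit_mult: "\<epsilon> (a * b) = \<epsilon> a * \<epsilon> b"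
    and counit_left: "tensor_lift (\<lambda>x y. \<epsilon> x *\<^sub>C y) (\<Delta> a) = a"
    and counit_right: "tensor_lift (\<lambda>x y. \<epsilon> y *\<^sub>C x) (\<Delta> a) = a"
    and antipode_linear: "clinear S"
    and antipode_left: "tensor_lift (\<lambda>x y. S x * y) (\<Delta> a) = \<epsilon> a *\<^sub>C 1"
    and antipode_right: "tensor_lift (\<lambda>x y. x * S y) (\<Delta> a) = \<epsilon> a *\<^sub>C 1"
    and star_add: "star (a + b) = star a + star b"
    and star_scaleC: "star (c *\<^sub>C a) = cnj c *\<^sub>C star a"
    and star_mult: "star (a * b) = star b * star a"
    and star_star: "star (star a) = a"
    \<comment> \<open>\<open>\<Delta> \<circ> star = (star \<otimes> star) \<circ> \<Delta>\<close>, on finite sums because \<open>star \<otimes> star\<close> is antilinear\<close>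
    and comult_star: "\<Delta> a = (\<Sum>k<n. x k \<otimes>\<^sub>C y k)
      \<Longrightarrow> \<Delta> (star a) = (\<Sum>k<(n::nat). star (x k) \<otimes>\<^sub>C star (y k))"

section \<open>Algebras presented by generators and relations\<close>

datatype 'g free_monoid = Word (letters: "'g list")

instantiation free_monoid :: (type) monoid_add
begin
definition zero_free_monoid :: "'a free_monoid" where "0 = Word []"
definition plus_free_monoid :: "'a free_monoid \<Rightarrow> 'a free_monoid \<Rightarrow> 'a free_monoid"
  where "v + w = Word (letters v @ letters w)"
instance by standard (simp_all add: zero_free_monoid_def plus_free_monoid_def)
end

text \<open>The free algebra is the monoid algebra of the free monoid, with the convolution product of
  \<^theory>\<open>HOL-Library.Poly_Mapping\<close>.\<close>

type_synonym 'g free_algebra = "'g free_monoid \<Rightarrow>\<^sub>0 complex"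

definition free_gen :: "'g \<Rightarrow> 'g free_algebra"
  where "free_gen g = Poly_Mapping.single (Word [g]) 1"

definition free_eval :: "('g \<Rightarrow> 'a::complex_algebra_1) \<Rightarrow> 'g free_algebra \<Rightarrow> 'a"
  where "free_eval h f =
    (\<Sum>w\<in>Poly_Mapping.keys f. Poly_Mapping.lookup f w *\<^sub>C prod_list (map h (letters w)))"

definition two_sided_ideal_generated :: "'g free_algebra set \<Rightarrow> 'g free_algebra set"
  where "two_sided_ideal_generated R = cvs.span {u * r * v | u r v. r \<in> R}"

definition presented_by :: "('g \<Rightarrow> 'a::complex_algebra_1) \<Rightarrow> 'g free_algebra set \<Rightarrow> bool"
  where "presented_by h R \<longleftrightarrow>
    surj (free_eval h) \<and> {f. free_eval h f = 0} = two_sided_ideal_generated R"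

section \<open>The Hopf star-algebra of the quantum group SUq(2)\<close>

datatype suq2_gen = Alpha | AlphaStar | Gamma | GammaStar

text \<open>The last two relators are the adjoints of the two preceding ones; the first three are
  self-adjoint. The ideal they generate is thus the star-ideal of the free star-algebra
  on \<open>\<alpha>\<close> and \<open>\<gamma>\<close> given by the defining relations.\<close>

definition suq2_relators :: "real \<Rightarrow> suq2_gen free_algebra set"
  where "suq2_relators q =
    (let a = free_gen Alpha; a' = free_gen AlphaStar;
         c = free_gen Gamma; c' = free_gen GammaStar;
         k = complex_of_real q
     in {a' * a + c' * c - 1,
         a * a' + k\<^sup>2 *\<^sub>C (c * c') - 1,
         c' * c - c * c',
         a * c - k *\<^sub>C (c * a),
         a * c' - k *\<^sub>C (c' * a),
         c' * a' - k *\<^sub>C (a' * c'),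
         c * a' - k *\<^sub>C (a' * c)})"

locale suq2 = hopf_star_algebra \<Delta> \<epsilon> S star
  for \<Delta> :: "'a::complex_algebra_1 \<Rightarrow> ('a, 'a) tensor"
    and \<epsilon> :: "'a \<Rightarrow> complex"
    and S :: "'a \<Rightarrow> 'a"
    and star :: "'a \<Rightarrow> 'a" +
  fixes q :: real
    and \<alpha> \<gamma> :: 'a
  assumes presentation:
      "presented_by (case_suq2_gen \<alpha> (star \<alpha>) \<gamma> (star \<gamma>)) (suq2_relators q)"
    and comult_alpha: "\<Delta> \<alpha> = \<alpha> \<otimes>\<^sub>C \<alpha> - complex_of_real q *\<^sub>C (star \<gamma> \<otimes>\<^sub>C \<gamma>)"
    and comult_gamma: "\<Delta> \<gamma> = \<gamma> \<otimes>\<^sub>C \<alpha> + star \<alpha> \<otimes>\<^sub>C \<gamma>"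

section \<open>Bicovariant first order differential calculi\<close>

locale bimodule =
  fixes lact :: "'a::complex_algebra_1 \<Rightarrow> 'e::complex_vector \<Rightarrow> 'e"
    and ract :: "'e \<Rightarrow> 'a \<Rightarrow> 'e"
  assumes lact_bilinear: "cbilinear lact"
    and ract_bilinear: "cbilinear ract"
    and lact_one: "lact 1 e = e"
    and ract_one: "ract e 1 = e"
    and lact_mult: "lact (a * b) e = lact a (lact b e)"
    and ract_mult: "ract e (a * b) = ract (ract e a) b"
    and lact_ract: "ract (lact a e) b = lact a (ract e b)"

locale first_order_calculus = bimodule lact ract
  for lact :: "'a::complex_algebra_1 \<Rightarrow> 'e::complex_vector \<Rightarrow> 'e"
    and ract :: "'e \<Rightarrow> 'a \<Rightarrow> 'e" +
  fixes d :: "'a \<Rightarrow> 'e"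
  assumes d_linear: "clinear d"
    and d_mult: "d (a * b) = ract (d a) b + lact a (d b)"
    and d_spans: "cvs.span {lact a (d b) | a b. True} = UNIV"

locale bicovariant_calculus = first_order_calculus lact ract d
  for lact :: "'a::complex_algebra_1 \<Rightarrow> 'e::complex_vector \<Rightarrow> 'e"
    and ract :: "'e \<Rightarrow> 'a \<Rightarrow> 'e"
    and d :: "'a \<Rightarrow> 'e" +
  fixes \<Delta> :: "'a \<Rightarrow> ('a, 'a) tensor"
  assumes left_covariant: "(\<Sum>k<n. lact (a k) (d (b k))) = 0
      \<Longrightarrow> (\<Sum>k<(n::nat). tensor_prod (*) lact (\<Delta> (a k)) (tensor_map id d (\<Delta> (b k)))) = 0"
    and right_covariant: "(\<Sum>k<n. lact (a k) (d (b k))) = 0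
      \<Longrightarrow> (\<Sum>k<(n::nat). tensor_prod lact (*) (\<Delta> (a k)) (tensor_map d id (\<Delta> (b k)))) = 0"

text \<open>The canonical coactions of a bicovariant calculus: \<open>a db \<mapsto> \<Delta>(a) (id \<otimes> d)\<Delta>(b)\<close> and
  \<open>a db \<mapsto> \<Delta>(a) (d \<otimes> id)\<Delta>(b)\<close>. Bicovariance is precisely their well-definedness.\<close>

definition left_coaction ::
    "('a::complex_algebra_1 \<Rightarrow> ('a, 'a) tensor) \<Rightarrow> ('a \<Rightarrow> 'e::complex_vector \<Rightarrow> 'e)
      \<Rightarrow> ('a \<Rightarrow> 'e) \<Rightarrow> 'e \<Rightarrow> ('a, 'e) tensor"
  where "left_coaction \<Delta> lact d = (THE h. clinear h \<and>
    (\<forall>a b. h (lact a (d b)) = tensor_prod (*) lact (\<Delta> a) (tensor_map id d (\<Delta> b))))"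

definition right_coaction ::
    "('a::complex_algebra_1 \<Rightarrow> ('a, 'a) tensor) \<Rightarrow> ('a \<Rightarrow> 'e::complex_vector \<Rightarrow> 'e)
      \<Rightarrow> ('a \<Rightarrow> 'e) \<Rightarrow> 'e \<Rightarrow> ('e, 'a) tensor"
  where "right_coaction \<Delta> lact d = (THE h. clinear h \<and>
    (\<forall>a b. h (lact a (d b)) = tensor_prod lact (*) (\<Delta> a) (tensor_map d id (\<Delta> b))))"

definition left_invariant :: "('e::complex_vector \<Rightarrow> ('a::complex_algebra_1, 'e) tensor) \<Rightarrow> 'e set"
  where "left_invariant \<delta> = {e. \<delta> e = 1 \<otimes>\<^sub>C e}"

definition right_invariant :: "('e::complex_vector \<Rightarrow> ('e, 'a::complex_algebra_1) tensor) \<Rightarrow> 'e set"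
  where "right_invariant \<delta> = {e. \<delta> e = e \<otimes>\<^sub>C 1}"

definition calculus_ideal ::
    "('a::complex_algebra_1 \<Rightarrow> ('a, 'a) tensor) \<Rightarrow> ('a \<Rightarrow> complex) \<Rightarrow> ('a \<Rightarrow> 'a)
      \<Rightarrow> ('a \<Rightarrow> 'e::complex_vector \<Rightarrow> 'e) \<Rightarrow> ('a \<Rightarrow> 'e) \<Rightarrow> 'a set"
  where "calculus_ideal \<Delta> \<epsilon> S lact d =
    {a. \<epsilon> a = 0 \<and> tensor_lift (\<lambda>x y. lact (S x) (d y)) (\<Delta> a) = 0}"

definition right_ideal_generated :: "'a::complex_algebra_1 set \<Rightarrow> 'a set"
  where "right_ideal_generated G = cvs.span {g * x | g x. g \<in> G}"

text \<open>The sign \<open>s = 1\<close> belongs to \<open>4D\<^sub>+\<close> and \<open>s = - 1\<close> to \<open>4D\<^sub>-\<close>.\<close>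

definition four_d_generators ::
    "real \<Rightarrow> real \<Rightarrow> ('a \<Rightarrow> 'a) \<Rightarrow> 'a \<Rightarrow> 'a \<Rightarrow> 'a::complex_algebra_1 set"
  where "four_d_generators q s star \<alpha> \<gamma> =
    (let k = complex_of_real q;
         z = k\<^sup>2 *\<^sub>C \<alpha> + star \<alpha> - (complex_of_real s * (k ^ 3 + 1 / k)) *\<^sub>C 1
     in {\<gamma>\<^sup>2,
         (star \<gamma>)\<^sup>2,
         \<gamma> * (\<alpha> - star \<alpha>),
         star \<gamma> * (\<alpha> - star \<alpha>),
         \<alpha>\<^sup>2 + k\<^sup>2 *\<^sub>C (star \<alpha>)\<^sup>2 - (1 + k\<^sup>2) *\<^sub>C (\<alpha> * star \<alpha> - \<gamma> * star \<gamma>),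
         z * \<gamma>,
         z * star \<gamma>,
         z * (\<alpha> - star \<alpha>),
         z * (k\<^sup>2 *\<^sub>C \<alpha> + star \<alpha> - (1 + k\<^sup>2) *\<^sub>C 1)})"

section \<open>The bimodule tensor square and the braiding\<close>

text \<open>\<open>bt\<close> exhibits its codomain as \<open>E \<otimes>\<^sub>A E\<close>, i.e. as the quotient of \<open>E \<otimes>\<^sub>C E\<close> by the
  span of all \<open>\<omega>a \<otimes> \<eta> - \<omega> \<otimes> a\<eta>\<close>.\<close>

definition tensor_over_algebra ::
    "('a::complex_algebra_1 \<Rightarrow> 'e::complex_vector \<Rightarrow> 'e) \<Rightarrow> ('e \<Rightarrow> 'a \<Rightarrow> 'e)
      \<Rightarrow> ('e \<Rightarrow> 'e \<Rightarrow> 't::complex_vector) \<Rightarrow> bool"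
  where "tensor_over_algebra lact ract bt \<longleftrightarrow>
    cbilinear bt \<and> surj (tensor_lift bt) \<and>
    {t. tensor_lift bt t = 0} =
      cvs.span {ract \<omega> a \<otimes>\<^sub>C \<eta> - \<omega> \<otimes>\<^sub>C lact a \<eta> | \<omega> a \<eta>. True}"

definition square_lact ::
    "('a::complex_algebra_1 \<Rightarrow> 'e::complex_vector \<Rightarrow> 'e) \<Rightarrow> ('e \<Rightarrow> 'e \<Rightarrow> 't::complex_vector)
      \<Rightarrow> 'a \<Rightarrow> 't \<Rightarrow> 't"
  where "square_lact lact bt a =
    (THE h. clinear h \<and> (\<forall>\<omega> \<eta>. h (bt \<omega> \<eta>) = bt (lact a \<omega>) \<eta>))"

definition square_ract ::
    "('e::complex_vector \<Rightarrow> 'a::complex_algebra_1 \<Rightarrow> 'e) \<Rightarrow> ('e \<Rightarrow> 'e \<Rightarrow> 't::complex_vector)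
      \<Rightarrow> 't \<Rightarrow> 'a \<Rightarrow> 't"
  where "square_ract ract bt t a =
    (THE h. clinear h \<and> (\<forall>\<omega> \<eta>. h (bt \<omega> \<eta>) = bt \<omega> (ract \<eta> a))) t"

text \<open>The diagonal left coaction: if \<open>\<delta>(\<omega>) = \<Sum> a \<otimes> \<omega>'\<close> and \<open>\<delta>(\<eta>) = \<Sum> b \<otimes> \<eta>'\<close>,
  then \<open>\<omega> \<otimes>\<^sub>A \<eta> \<mapsto> \<Sum> ab \<otimes> (\<omega>' \<otimes>\<^sub>A \<eta>')\<close>.\<close>

definition square_left_coaction ::
    "('e::complex_vector \<Rightarrow> ('a::complex_algebra_1, 'e) tensor)
      \<Rightarrow> ('e \<Rightarrow> 'e \<Rightarrow> 't::complex_vector) \<Rightarrow> 't \<Rightarrow> ('a, 't) tensor"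
  where "square_left_coaction \<delta> bt =
    (THE h. clinear h \<and> (\<forall>\<omega> \<eta>. h (bt \<omega> \<eta>) = tensor_prod (*) bt (\<delta> \<omega>) (\<delta> \<eta>)))"

definition is_braiding ::
    "('a::complex_algebra_1 \<Rightarrow> 'e::complex_vector \<Rightarrow> 'e) \<Rightarrow> ('e \<Rightarrow> 'a \<Rightarrow> 'e)
      \<Rightarrow> ('e \<Rightarrow> ('a, 'e) tensor) \<Rightarrow> ('e \<Rightarrow> ('e, 'a) tensor)
      \<Rightarrow> ('e \<Rightarrow> 'e \<Rightarrow> 't::complex_vector) \<Rightarrow> ('t \<Rightarrow> 't) \<Rightarrow> bool"
  where "is_braiding lact ract \<delta>L \<delta>R bt \<sigma> \<longleftrightarrow>
    clinear \<sigma> \<and>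
    (\<forall>a t. \<sigma> (square_lact lact bt a t) = square_lact lact bt a (\<sigma> t)) \<and>
    (\<forall>a t. \<sigma> (square_ract ract bt t a) = square_ract ract bt (\<sigma> t) a) \<and>
    (\<forall>\<omega>\<in>left_invariant \<delta>L. \<forall>\<eta>\<in>right_invariant \<delta>R. \<sigma> (bt \<omega> \<eta>) = bt \<eta> \<omega>)"

section \<open>Diagonalisability and minimal polynomials of operators on a subspace\<close>

definition diagonalisable_on :: "'v::complex_vector set \<Rightarrow> ('v \<Rightarrow> 'v) \<Rightarrow> bool"
  where "diagonalisable_on V f \<longleftrightarrow>
    (\<exists>B. cvs.independent B \<and> cvs.span B = V \<and> (\<forall>v\<in>B. \<exists>c. f v = c *\<^sub>C v))"

definition poly_operator :: "complex poly \<Rightarrow> ('v::complex_vector \<Rightarrow> 'v) \<Rightarrow> 'v \<Rightarrow> 'v"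
  where "poly_operator p f v = (\<Sum>i\<le>degree p. coeff p i *\<^sub>C (f ^^ i) v)"

definition minimal_polynomial_on :: "'v::complex_vector set \<Rightarrow> ('v \<Rightarrow> 'v) \<Rightarrow> complex poly \<Rightarrow> bool"
  where "minimal_polynomial_on V f m \<longleftrightarrow>
    lead_coeff m = 1 \<and> (\<forall>v\<in>V. poly_operator m f v = 0) \<and>
    (\<forall>p. (\<forall>v\<in>V. poly_operator p f v = 0) \<longrightarrow> m dvd p)"

end

theory Submission
  imports Defs
begin

text \<open>
  Write \<open>\<omega>(a) = S(a\<^sub>1) da\<^sub>2\<close> and let \<open>u\<close> be the fundamental corepresentation. The forms \<open>\<omega>(u\<^sub>i\<^sub>j)\<close> are
  left-invariant and \<open>\<omega>(u\<^sub>i\<^sub>j) = - \<Sum> S(u\<^sub>i\<^sub>m) \<eta>\<^sub>m\<^sub>n u\<^sub>n\<^sub>j\<close> with \<open>\<eta>\<^sub>m\<^sub>n\<close> right-invariant, so the bimodule property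
  of the braiding gives \<open>\<sigma>(x \<otimes> \<omega>(u\<^sub>i\<^sub>j)) = \<Sum> \<omega>(u\<^sub>r\<^sub>p) \<otimes> x\<cdot>(S(u\<^sub>i\<^sub>r) u\<^sub>p\<^sub>j)\<close>, where \<open>\<omega>(a)\<cdot>b = \<omega>(ab)\<close> for
  \<open>\<epsilon>(a) = 0\<close>. The right ideal of \<open>4D\<^sub>\<plusminus>\<close> is the kernel, inside that of \<open>\<epsilon>\<close>, of \<open>a \<mapsto> \<theta>a - \<epsilon>(a)\<theta>\<close> for an explicit
  cyclic right module of dimension four. This identifies the left-invariant forms with that module,
  shows that they are a basis of the calculus over the algebra, and makes \<open>\<sigma>\<close> an explicit matrix of
  size 16, in which the sign cancels. It splits into blocks of size at most four that are annihilated
  by the cubic polynomial, whose roots are distinct.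
\<close>

section \<open>Linear and bilinear maps\<close>

text \<open>The equality of right ideals enters in both directions. That the nine generators lie in
  the ideal of the calculus determines \<omega> on products of two matrix entries, which is all that
  the commutation rule between \<omega>(u_ij) and u_mn involves.

  The obstacle is that \<sigma> is given only on pairs of a left-invariant and a right-invariant
  form, so every other value has to be reached through the commutation rule. The coactions and the
  actions on the square are definite descriptions, so each must first be shown to exist.

  The block structure reflects a grading in which e and f have weights 1 and -1 while \<theta> and n
  have weight 0: the total weights 2, 1, 0, -1, -2 occur with dimensions 1, 4, 6, 4, 1.\<close>

lemma clinearI:
  assumes "\<And>x y. f (x + y) = f x + f y" "\<And>c x. f (c *\<^sub>C x) = c *\<^sub>C f x"
  shows "clinear f"
  using assms by (simp add: clinear_iff)

lemma clinearD:
  assumes "clinear f"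
  shows clinear_add: "f (x + y) = f x + f y" and clinear_scale: "f (c *\<^sub>C x) = c *\<^sub>C f x"
    and clinear_zero: "f 0 = 0" and clinear_minus: "f (- x) = - f x"
    and clinear_diff: "f (x - y) = f x - f y" and clinear_sum: "f (sum g A) = (\<Sum>a\<in>A. f (g a))"
proof -
  interpret Vector_Spaces.linear scaleC scaleC f by fact
  show "f (x + y) = f x + f y" "f (c *\<^sub>C x) = c *\<^sub>C f x" "f 0 = 0" "f (- x) = - f x"
    "f (x - y) = f x - f y" "f (sum g A) = (\<Sum>a\<in>A. f (g a))"
    by (simp_all add: add scale zero neg diff sum)
qed

lemma clinear_id: "clinear (\<lambda>x. x)" "clinear id"
  by (simp_all add: clinear_iff)

lemma clinear_compose: "clinear f \<Longrightarrow> clinear g \<Longrightarrow> clinear (\<lambda>x. f (g x))"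
  by (simp add: clinear_iff)

lemma clinear_plus: "clinear f \<Longrightarrow> clinear g \<Longrightarrow> clinear (\<lambda>x. f x + g x)"
  by (simp add: clinear_iff algebra_simps scaleC_add_right)

lemma clinear_scaleC: "clinear f \<Longrightarrow> clinear (\<lambda>x. c *\<^sub>C f x)"
  by (simp add: clinear_iff algebra_simps scaleC_add_right scaleC_scaleC)

lemma cbilinearI:
  assumes "\<And>x x' y. f (x + x') y = f x y + f x' y" "\<And>x y y'. f x (y + y') = f x y + f x y'"
    "\<And>c x y. f (c *\<^sub>C x) y = c *\<^sub>C f x y" "\<And>c x y. f x (c *\<^sub>C y) = c *\<^sub>C f x y"
  shows "cbilinear f"
  using assms by (simp add: cbilinear_def clinear_iff)

lemma cbilinear_clinear:
  assumes "cbilinear f"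
  shows cbilinear_clinear_right: "clinear (f x)" and cbilinear_clinear_left: "clinear (\<lambda>x. f x y)"
  using assms by (simp_all add: cbilinear_def)

lemma cbilinear_sum:
  assumes "cbilinear f"
  shows cbilinear_sum_left: "f (sum g A) y = (\<Sum>a\<in>A. f (g a) y)"
    and cbilinear_sum_right: "f x (sum h A) = (\<Sum>a\<in>A. f x (h a))"
  using clinear_sum[OF cbilinear_clinear_left[OF assms]]
    clinear_sum[OF cbilinear_clinear_right[OF assms]] by simp_all

lemma cbilinear_diff:
  assumes "cbilinear f"
  shows cbilinear_diff_left: "f (x - x') y = f x y - f x' y"
    and cbilinear_diff_right: "f x (y - y') = f x y - f x y'"
    and cbilinear_minus_left: "f (- x) y = - f x y"
    and cbilinear_minus_right: "f x (- y) = - f x y"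
    and cbilinear_zero_left: "f 0 y = 0"
    and cbilinear_zero_right: "f x 0 = 0"
  using clinearD[OF cbilinear_clinear_left[OF assms]]
    clinearD[OF cbilinear_clinear_right[OF assms]] by simp_all

lemma cbilinear_compose:
  assumes "cbilinear f" "clinear g" "clinear h"
  shows "cbilinear (\<lambda>x y. f (g x) (h y))"
  using assms by (simp add: cbilinear_def clinear_iff)

lemma cbilinear_mult: "cbilinear ((*) :: 'a::complex_algebra_1 \<Rightarrow> _)"
  by (rule cbilinearI) (simp_all add: algebra_simps mult_scaleC_left mult_scaleC_right)

lemma cbilinear_scaleC: "cbilinear ((*\<^sub>C) :: complex \<Rightarrow> 'a::complex_vector \<Rightarrow> _)"
  by (rule cbilinearI)
    (simp_all add: scaleC_add_left scaleC_add_right scaleC_scaleC scaleC_complex_def mult.commute)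

lemma clinear_eq_on_span:
  assumes "clinear f" "clinear g" "\<And>x. x \<in> X \<Longrightarrow> f x = g x" "y \<in> cvs.span X"
  shows "f y = g y"
  using assms(4)
  by (induction rule: cvs.span_induct_alt)
    (use assms(3) in \<open>auto simp: clinearD[OF assms(1)] clinearD[OF assms(2)]\<close>)

lemma clinear_eq_spanning:
  assumes "clinear f" "clinear g" "cvs.span X = UNIV" "\<And>x. x \<in> X \<Longrightarrow> f x = g x"
  shows "f = g"
  using clinear_eq_on_span[OF assms(1,2,4)] assms(3) by auto

text \<open>The universal property behind the induced maps below: the presented algebra, the
  coactions and the structure maps of the square are all surjections with a controlled kernel. The
  kernel condition makes the choice hidden in \<open>inv\<close> irrelevant, which also restores
  linearity.\<close>

lemma factor_through_surjection:
  assumes M: "clinear M" "surj M" and N: "clinear N" and ker: "\<And>t. M t = 0 \<Longrightarrow> N t = 0"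
  obtains h where "clinear h" "\<And>t. h (M t) = N t"
proof -
  define h where "h x = N (inv M x)" for x
  have eq: "h (M t) = N t" for t
  proof -
    have "M (inv M (M t) - t) = 0"
      using M(2) by (simp add: clinear_diff[OF M(1)] surj_f_inv_f)
    then have "N (inv M (M t) - t) = 0" by (rule ker)
    then show ?thesis by (simp add: h_def clinear_diff[OF N])
  qed
  have "clinear h"
  proof (rule clinearI)
    fix x y :: 'b and c :: complex
    obtain s t where st: "x = M s" "y = M t" using M(2) by (meson surjD)
    show "h (x + y) = h x + h y"
      unfolding st using eq[of "s + t"] by (simp add: eq clinear_add[OF M(1)] clinear_add[OF N])
    show "h (c *\<^sub>C x) = c *\<^sub>C h x"
      unfolding st using eq[of "c *\<^sub>C s"] by (simp add: eq clinear_scale[OF M(1)] clinear_scale[OF N])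
  qed
  then show thesis using eq that by blast
qed

section \<open>Tensor products\<close>

lemma span_pure: "cvs.span {x \<otimes>\<^sub>C y | x y. True} = (UNIV :: ('a::complex_vector, 'b::complex_vector) tensor set)"
proof -
  let ?U = "cvs.span {x \<otimes>\<^sub>C y | x y. True} :: ('a, 'b) tensor set"
  have single: "abs_tensor (Poly_Mapping.single k c) \<in> ?U" for k :: "'a \<times> 'b" and c
  proof -
    obtain x y where k: "k = (x, y)" by force
    have "Poly_Mapping.single k c = c *\<^sub>C Poly_Mapping.single k 1"
      by transfer (auto simp: fun_eq_iff scaleC_complex_def when_def)
    then have "abs_tensor (Poly_Mapping.single k c) = c *\<^sub>C (x \<otimes>\<^sub>C y)"
      by (simp add: k tensor_pure.abs_eq scaleC_tensor.abs_eq)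
    then show ?thesis by (simp only:) (intro cvs.span_scale cvs.span_base, blast)
  qed
  have sums: "abs_tensor (\<Sum>k\<in>K. Poly_Mapping.single k (c k)) \<in> ?U" if "finite K" for K c
    using that
  proof (induction K)
    case empty
    then show ?case by (simp add: zero_tensor_def[symmetric] cvs.span_zero)
  next
    case (insert k K)
    then have "abs_tensor (Poly_Mapping.single k (c k))
        + abs_tensor (\<Sum>k\<in>K. Poly_Mapping.single k (c k)) \<in> ?U"
      by (intro cvs.span_add single)
    with insert.hyps show ?case by (simp add: plus_tensor.abs_eq)
  qed
  have decomp: "(\<Sum>k\<in>Poly_Mapping.keys f. Poly_Mapping.single k (Poly_Mapping.lookup f k)) = f"
    for f :: "('a \<times> 'b) \<Rightarrow>\<^sub>0 complex"
    by (rule poly_mapping_eqI)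
      (auto simp: lookup_sum lookup_single when_def in_keys_iff cong: if_cong)
  have "abs_tensor f \<in> ?U" for f
    using sums[of "Poly_Mapping.keys f" "Poly_Mapping.lookup f"] decomp[of f] by simp
  then have "t \<in> ?U" for t :: "('a, 'b) tensor"
    using Quotient3_abs_rep[OF Quotient3_tensor, of t] by metis
  then show ?thesis by auto
qed

lemmas pure_simps =
  cbilinearD[OF cbilinear_tensor_pure] cbilinear_diff[OF cbilinear_tensor_pure]
  cbilinear_sum[OF cbilinear_tensor_pure]

text \<open>Scalars and zero need no case of their own: a multiple of a pure tensor is pure, and
  zero is a pure tensor.\<close>

lemma tensor_induct [case_names pure add]:
  fixes t :: "('a::complex_vector, 'b::complex_vector) tensor"
  assumes pure: "\<And>x y. P (x \<otimes>\<^sub>C y)" and add: "\<And>s t. P s \<Longrightarrow> P t \<Longrightarrow> P (s + t)"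
  shows "P t"
proof -
  have "t \<in> cvs.span {x \<otimes>\<^sub>C y | x y. True}" unfolding span_pure by (rule UNIV_I)
  then show ?thesis
  proof (induction rule: cvs.span_induct_alt)
    case base
    show ?case using pure[of 0 0] by (simp add: pure_simps)
  next
    case (step c x y)
    then obtain a b where "x = a \<otimes>\<^sub>C b" by auto
    then have "c *\<^sub>C x = (c *\<^sub>C a) \<otimes>\<^sub>C b" by (simp add: pure_simps)
    then show ?case using add[OF pure step(2)] by simp
  qed
qed

text \<open>Connects tensors with the covariance axioms, which are phrased for sums over an initial
  segment of the naturals.\<close>

lemma tensor_finite_sum:
  fixes t :: "('a::complex_vector, 'b::complex_vector) tensor"
  obtains n :: nat and x y where "t = (\<Sum>k<n. x k \<otimes>\<^sub>C y k)"
proof -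
  have "\<exists>(n::nat) x y. t = (\<Sum>k<n. x k \<otimes>\<^sub>C y k)"
  proof (induction t rule: tensor_induct)
    case (pure x y)
    have "x \<otimes>\<^sub>C y = (\<Sum>k<Suc 0. (\<lambda>_. x) k \<otimes>\<^sub>C (\<lambda>_. y) k)" by simp
    then show ?case by (intro exI[of _ "Suc 0"] exI[of _ "\<lambda>_. x"] exI[of _ "\<lambda>_. y"])
  next
    case (add s t)
    then obtain m n :: nat and x y x' y' where
      "s = (\<Sum>k<m. x k \<otimes>\<^sub>C y k)" "t = (\<Sum>k<n. x' k \<otimes>\<^sub>C y' k)" by blast
    moreover have "(\<Sum>k<m + n. f k) = (\<Sum>k<m. f k) + (\<Sum>k<n. f (m + k))"
      for f :: "nat \<Rightarrow> ('a, 'b) tensor"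
      by (induction n) (simp_all add: algebra_simps)
    ultimately have "s + t = (\<Sum>k<m + n. (if k < m then x k else x' (k - m)) \<otimes>\<^sub>C
        (if k < m then y k else y' (k - m)))"
      by simp
    then show ?case
      by (intro exI[of _ "m + n"] exI[of _ "\<lambda>k. if k < m then x k else x' (k - m)"]
          exI[of _ "\<lambda>k. if k < m then y k else y' (k - m)"])
  qed
  then show thesis using that by blast
qed

lemma tensor_lift_add:
  "cbilinear f \<Longrightarrow> tensor_lift f (s + t) = tensor_lift f s + tensor_lift f t"
  and tensor_lift_scale: "cbilinear f \<Longrightarrow> tensor_lift f (c *\<^sub>C t) = c *\<^sub>C tensor_lift f t"
  and tensor_lift_diff: "cbilinear f \<Longrightarrow> tensor_lift f (s - t) = tensor_lift f s - tensor_lift f t"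
  and tensor_lift_zero: "cbilinear f \<Longrightarrow> tensor_lift f 0 = 0"
  and tensor_lift_sum: "cbilinear f \<Longrightarrow> tensor_lift f (sum g A) = (\<Sum>a\<in>A. tensor_lift f (g a))"
  by (simp_all add: clinearD[OF clinear_tensor_lift])

lemmas tensor_lift_simps = tensor_lift_pure tensor_lift_add tensor_lift_scale tensor_lift_diff
  tensor_lift_zero tensor_lift_sum

text \<open>Needed for the iterated lift in \<open>tensor_prod\<close>, where the inner bilinear map
  depends linearly on each leg of the outer tensor.\<close>

lemma cbilinear_tensor_lift_param:
  assumes "\<And>x. cbilinear (f x)" "\<And>a b. clinear (\<lambda>x. f x a b)"
  shows "cbilinear (\<lambda>x. tensor_lift (f x))"
proof (rule cbilinearI)
  fix x x' :: 'a and t t' :: "('b, 'c) tensor" and c :: complex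
  show "tensor_lift (f x) (t + t') = tensor_lift (f x) t + tensor_lift (f x) t'"
    "tensor_lift (f x) (c *\<^sub>C t) = c *\<^sub>C tensor_lift (f x) t"
    by (simp_all add: tensor_lift_simps assms)
  have add: "f (x + x') = (\<lambda>a b. f x a b + f x' a b)" and scale: "f (c *\<^sub>C x) = (\<lambda>a b. c *\<^sub>C f x a b)"
    by (simp_all add: fun_eq_iff clinear_add[OF assms(2)] clinear_scale[OF assms(2)])
  have cbilinear_add: "cbilinear (\<lambda>a b. f x a b + f x' a b)" and
    cbilinear_scale: "cbilinear (\<lambda>a b. c *\<^sub>C f x a b)"
    using assms(1)[of "x + x'"] assms(1)[of "c *\<^sub>C x"] by (simp_all only: add scale)
  show "tensor_lift (f (x + x')) t = tensor_lift (f x) t + tensor_lift (f x') t"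
    by (induction t rule: tensor_induct)
      (simp_all add: tensor_lift_simps assms add cbilinear_add)
  show "tensor_lift (f (c *\<^sub>C x)) t = c *\<^sub>C tensor_lift (f x) t"
    by (induction t rule: tensor_induct)
      (simp_all add: tensor_lift_simps assms scale cbilinear_scale scaleC_add_right)
qed

lemma tensor_map_pure:
  assumes "clinear f" "clinear g"
  shows "tensor_map f g (x \<otimes>\<^sub>C y) = f x \<otimes>\<^sub>C g y"
  unfolding tensor_map_def
  by (rule tensor_lift_pure) (rule cbilinear_compose[OF cbilinear_tensor_pure assms])

lemma clinear_tensor_map:
  assumes "clinear f" "clinear g"
  shows "clinear (tensor_map f g)"
  unfolding tensor_map_def
  by (rule clinear_tensor_lift) (rule cbilinear_compose[OF cbilinear_tensor_pure assms])

lemma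
  assumes f: "cbilinear f" and g: "cbilinear g"
  shows cbilinear_tensor_prod: "cbilinear (tensor_prod f g)"
    and tensor_prod_pure: "tensor_prod f g (a \<otimes>\<^sub>C b) (c \<otimes>\<^sub>C d) = f a c \<otimes>\<^sub>C g b d"
proof -
  have inner: "cbilinear (\<lambda>c d. f a c \<otimes>\<^sub>C g b d)" for a b
    by (rule cbilinear_compose[OF cbilinear_tensor_pure]) (use f g in \<open>simp_all add: cbilinear_def\<close>)
  have outer: "cbilinear (\<lambda>a b. tensor_lift (\<lambda>c d. f a c \<otimes>\<^sub>C g b d) t)" for t
  proof -
    have "cbilinear (\<lambda>a. tensor_lift (\<lambda>c d. f a c \<otimes>\<^sub>C g b d))" for b
      by (rule cbilinear_tensor_lift_param[OF inner])
        (use f in \<open>simp add: clinear_iff pure_simps cbilinearD\<close>)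
    moreover have "cbilinear (\<lambda>b. tensor_lift (\<lambda>c d. f a c \<otimes>\<^sub>C g b d))" for a
      by (rule cbilinear_tensor_lift_param[OF inner])
        (use g in \<open>simp add: clinear_iff pure_simps cbilinearD\<close>)
    ultimately show ?thesis by (simp add: cbilinear_def)
  qed
  show pure: "tensor_prod f g (a \<otimes>\<^sub>C b) (c \<otimes>\<^sub>C d) = f a c \<otimes>\<^sub>C g b d"
    by (simp add: tensor_prod_def tensor_lift_pure[OF outer[of "c \<otimes>\<^sub>C d"]] tensor_lift_pure[OF inner[of a b]])
  show "cbilinear (tensor_prod f g)"
  proof (rule cbilinearI)
    fix x x' :: "('a, 'd) tensor" and y y' :: "('b, 'e) tensor" and c :: complex
    show "tensor_prod f g (x + x') y = tensor_prod f g x y + tensor_prod f g x' y"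
      "tensor_prod f g (c *\<^sub>C x) y = c *\<^sub>C tensor_prod f g x y"
      by (simp_all add: tensor_prod_def tensor_lift_simps outer)
    have inner_add: "tensor_lift (\<lambda>c d. f a c \<otimes>\<^sub>C g b d) (y + y')
        = tensor_lift (\<lambda>c d. f a c \<otimes>\<^sub>C g b d) y + tensor_lift (\<lambda>c d. f a c \<otimes>\<^sub>C g b d) y'" for a b
      by (simp add: tensor_lift_simps inner)
    have inner_scale: "tensor_lift (\<lambda>c d. f a c \<otimes>\<^sub>C g b d) (c *\<^sub>C y)
        = c *\<^sub>C tensor_lift (\<lambda>c d. f a c \<otimes>\<^sub>C g b d) y" for a b
      by (simp add: tensor_lift_simps inner)
    show "tensor_prod f g x (y + y') = tensor_prod f g x y + tensor_prod f g x y'"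
      by (induction x rule: tensor_induct)
        (simp_all add: tensor_prod_def tensor_lift_add[OF outer] tensor_lift_pure[OF outer] inner_add[symmetric])
    show "tensor_prod f g x (c *\<^sub>C y) = c *\<^sub>C tensor_prod f g x y"
      by (induction x rule: tensor_induct)
        (simp_all add: tensor_prod_def tensor_lift_add[OF outer] tensor_lift_pure[OF outer] inner_scale[symmetric] scaleC_add_right)
  qed
qed

text \<open>One rule for all mixed associativity laws: compatibility of the left coaction with both
  multiplications and the balancing of the diagonal coaction differ only in the maps on the
  legs.\<close>

lemma tensor_prod_assoc:
  assumes bil: "cbilinear f1" "cbilinear f2" "cbilinear f3" "cbilinear f4"
    "cbilinear g1" "cbilinear g2" "cbilinear g3" "cbilinear g4"
    and "\<And>a b c. f1 (f2 a b) c = f3 a (f4 b c)" "\<And>a b c. g1 (g2 a b) c = g3 a (g4 b c)"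
  shows "tensor_prod f1 g1 (tensor_prod f2 g2 s t) u = tensor_prod f3 g3 s (tensor_prod f4 g4 t u)"
proof (induction s rule: tensor_induct)
  case (pure a a')
  show ?case
  proof (induction t rule: tensor_induct)
    case (pure b b')
    show ?case
      by (induction u rule: tensor_induct)
        (simp_all add: tensor_prod_pure bil assms cbilinearD[OF cbilinear_tensor_prod])
  qed (simp add: bil cbilinearD[OF cbilinear_tensor_prod])
qed (simp add: bil cbilinearD[OF cbilinear_tensor_prod])

section \<open>Modules over presented algebras\<close>

lemmas scaleC_distribs = cvs.scale_left_distrib cvs.scale_right_distrib
  cvs.scale_left_diff_distrib cvs.scale_right_diff_distrib scaleC_scaleC

lemma scaleC_single: "c *\<^sub>C Poly_Mapping.single w a = Poly_Mapping.single w (c * a)"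
  by transfer (auto simp: fun_eq_iff scaleC_complex_def when_def)

lemma span_poly_mapping_single:
  "cvs.span (range (\<lambda>w. Poly_Mapping.single w 1)) = (UNIV :: ('g \<Rightarrow>\<^sub>0 complex) set)"
proof -
  have "f \<in> cvs.span (range (\<lambda>w. Poly_Mapping.single w 1))" for f :: "'g \<Rightarrow>\<^sub>0 complex"
  proof -
    have "(\<Sum>k\<in>Poly_Mapping.keys f. Poly_Mapping.lookup f k *\<^sub>C Poly_Mapping.single k 1) = f"
      by (rule poly_mapping_eqI)
        (auto simp: scaleC_single lookup_sum lookup_single when_def in_keys_iff cong: if_cong)
    moreover have "(\<Sum>k\<in>Poly_Mapping.keys f. Poly_Mapping.lookup f k *\<^sub>C Poly_Mapping.single k 1)
        \<in> cvs.span (range (\<lambda>w. Poly_Mapping.single w (1::complex)))"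
      by (intro cvs.span_sum cvs.span_scale cvs.span_base rangeI)
    ultimately show ?thesis by simp
  qed
  then show ?thesis by blast
qed

definition linear_extension :: "('w \<Rightarrow> 'v::complex_vector) \<Rightarrow> ('w \<Rightarrow>\<^sub>0 complex) \<Rightarrow> 'v"
  where "linear_extension F f = (\<Sum>w\<in>Poly_Mapping.keys f. Poly_Mapping.lookup f w *\<^sub>C F w)"

lemma linear_extension_superset:
  assumes "finite K" "Poly_Mapping.keys f \<subseteq> K"
  shows "linear_extension F f = (\<Sum>w\<in>K. Poly_Mapping.lookup f w *\<^sub>C F w)"
  unfolding linear_extension_def using assms
  by (intro sum.mono_neutral_left) (auto simp: in_keys_iff)

lemma clinear_linear_extension: "clinear (linear_extension F)"
proof (rule clinearI)
  fix f g :: "'a \<Rightarrow>\<^sub>0 complex" and c :: complex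
  show "linear_extension F (f + g) = linear_extension F f + linear_extension F g"
    by (simp add: linear_extension_superset[of "Poly_Mapping.keys f \<union> Poly_Mapping.keys g"]
        Poly_Mapping.keys_add lookup_add scaleC_add_left sum.distrib)
  have "Poly_Mapping.keys (c *\<^sub>C f) \<subseteq> Poly_Mapping.keys f"
    by (auto simp: in_keys_iff scaleC_poly_mapping.rep_eq)
  then show "linear_extension F (c *\<^sub>C f) = c *\<^sub>C linear_extension F f"
    by (simp add: linear_extension_superset[of "Poly_Mapping.keys f"] scaleC_poly_mapping.rep_eq
        scaleC_complex_def cvs.scale_sum_right scaleC_scaleC)
qed

lemma linear_extension_single: "linear_extension F (Poly_Mapping.single w a) = a *\<^sub>C F w"
  by (simp add: linear_extension_def)

lemma poly_mapping_additive_induct [case_names single add]: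
  fixes f :: "'w \<Rightarrow>\<^sub>0 complex"
  assumes single: "\<And>w a. P (Poly_Mapping.single w a)" and add: "\<And>f g. P f \<Longrightarrow> P g \<Longrightarrow> P (f + g)"
  shows "P f"
proof -
  have "f \<in> cvs.span (range (\<lambda>w. Poly_Mapping.single w 1))"
    unfolding span_poly_mapping_single by (rule UNIV_I)
  then show ?thesis
  proof (induction rule: cvs.span_induct_alt)
    case base
    show ?case using single[of undefined 0] by simp
  next
    case (step c x y)
    then have "P (c *\<^sub>C x)" by (auto simp: scaleC_single single)
    then show ?case using add step(2) by blast
  qed
qed

lemma monoid_algebra_mult_scaleC:
  fixes f g :: "'w::monoid_add \<Rightarrow>\<^sub>0 complex"
  shows "(c *\<^sub>C f) * g = c *\<^sub>C (f * g)" and "f * (c *\<^sub>C g) = c *\<^sub>C (f * g)"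
proof -
  have "(c *\<^sub>C f) * g = c *\<^sub>C (f * g) \<and> f * (c *\<^sub>C g) = c *\<^sub>C (f * g)"
  proof (induction f rule: poly_mapping_additive_induct)
    case (single v a)
    show ?case
      by (induction g rule: poly_mapping_additive_induct)
        (simp_all add: scaleC_single mult_single scaleC_add_right distrib_left mult_ac)
  qed (simp add: scaleC_add_right distrib_right)
  then show "(c *\<^sub>C f) * g = c *\<^sub>C (f * g)" "f * (c *\<^sub>C g) = c *\<^sub>C (f * g)"
    by simp_all
qed

lemma linear_extension_mult:
  fixes F :: "'w::monoid_add \<Rightarrow> 'v::complex_vector"
  assumes "cbilinear m" "\<And>v w. F (v + w) = m (G v) (H w)"
  shows "linear_extension F (f * g) = m (linear_extension G f) (linear_extension H g)"
proof (induction f rule: poly_mapping_additive_induct)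
  case (single v a)
  show ?case
    by (induction g rule: poly_mapping_additive_induct)
      (simp_all add: mult_single linear_extension_single assms cbilinearD[OF assms(1)] scaleC_scaleC
        distrib_left clinear_add[OF clinear_linear_extension] mult.commute)
qed (simp add: distrib_right clinear_add[OF clinear_linear_extension] cbilinearD[OF assms(1)])

lemma free_eval_linear_extension:
  "free_eval h = linear_extension (\<lambda>w. prod_list (map h (letters w)))"
  by (simp add: fun_eq_iff free_eval_def linear_extension_def)

lemma clinear_free_eval: "clinear (free_eval h)"
  unfolding free_eval_linear_extension by (rule clinear_linear_extension)

lemma free_eval_mult: "free_eval h (f * g) = free_eval h f * free_eval h g"
  unfolding free_eval_linear_extension
  by (rule linear_extension_mult[OF cbilinear_mult]) (simp add: plus_free_monoid_def)

lemma one_free_algebra: "(1 :: 'g free_algebra) = Poly_Mapping.single (Word []) 1"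
  by (simp add: zero_free_monoid_def flip: single_one)

lemma free_eval_one: "free_eval h 1 = 1"
  by (simp add: free_eval_linear_extension one_free_algebra linear_extension_single scaleC_one)

lemma free_eval_gen: "free_eval h (free_gen g) = h g"
  by (simp add: free_eval_linear_extension free_gen_def linear_extension_single scaleC_one)

text \<open>\<open>fold\<close> applies the first letter first, so that concatenation of words gives
  a right module, as a calculus described by a right ideal requires.\<close>

definition free_act :: "('g \<Rightarrow> 'v \<Rightarrow> 'v) \<Rightarrow> 'v::complex_vector \<Rightarrow> 'g free_algebra \<Rightarrow> 'v"
  where "free_act \<rho> v = linear_extension (\<lambda>w. fold \<rho> (letters w) v)"

lemma clinear_fold:
  assumes "\<And>g. clinear (\<rho> g)"
  shows "clinear (fold \<rho> ws)"
proof (induction ws)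
  case (Cons g ws)
  show ?case using clinear_compose[OF Cons assms[of g]] by (simp add: comp_def)
qed (simp add: clinear_id)

lemma cbilinear_free_act:
  assumes "\<And>g. clinear (\<rho> g)"
  shows "cbilinear (free_act \<rho>)"
proof -
  note fold = clinearD[OF clinear_fold[of \<rho>, OF assms]]
  have "clinear (\<lambda>v. free_act \<rho> v f)" for f
    by (rule clinearI)
      (simp_all add: free_act_def linear_extension_def fold scaleC_add_right sum.distrib
        cvs.scale_sum_right scaleC_scaleC mult.commute)
  then show ?thesis
    unfolding cbilinear_def by (simp add: free_act_def clinear_linear_extension)
qed

lemma free_act_mult:
  assumes "\<And>g. clinear (\<rho> g)"
  shows "free_act \<rho> v (f * g) = free_act \<rho> (free_act \<rho> v f) g"
proof -
  note bil = cbilinearD[OF cbilinear_free_act[of \<rho>, OF assms]]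
  have act_single: "free_act \<rho> v (Poly_Mapping.single w a) = a *\<^sub>C fold \<rho> (letters w) v" for v w a
    by (simp add: free_act_def linear_extension_single)
  show ?thesis
  proof (induction f rule: poly_mapping_additive_induct)
    case (single w a)
    show ?case
      by (induction g rule: poly_mapping_additive_induct)
        (simp_all add: mult_single act_single clinear_scale[OF clinear_fold[of \<rho>, OF assms]] scaleC_scaleC
          plus_free_monoid_def distrib_left bil mult.commute)
  qed (simp add: distrib_right bil)
qed

lemma free_act_one: "free_act \<rho> v 1 = v"
  by (simp add: one_free_algebra free_act_def linear_extension_single scaleC_one)

lemma free_act_gen: "free_act \<rho> v (free_gen g) = \<rho> g v"
  by (simp add: free_gen_def free_act_def linear_extension_single scaleC_one)

text \<open>The kernel of evaluation is spanned by elements u r w with r a relator. Acting by u only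
  replaces the vector, so it suffices that every relator kills every vector. This turns four
  operators satisfying the relations into a module over the quantum group.\<close>

lemma presented_module:
  fixes \<rho> :: "'g \<Rightarrow> 'v::complex_vector \<Rightarrow> 'v" and h :: "'g \<Rightarrow> 'a::complex_algebra_1"
  assumes pres: "presented_by h R" and \<rho>: "\<And>g. clinear (\<rho> g)"
    and relators: "\<And>r v. r \<in> R \<Longrightarrow> free_act \<rho> v r = 0"
  obtains act where "cbilinear act" "\<And>v. act v 1 = v" "\<And>v a b. act v (a * b) = act (act v a) b"
    "\<And>v g. act v (h g) = \<rho> g v"
proof -
  have surj: "surj (free_eval h)" and ker: "{f. free_eval h f = 0} = two_sided_ideal_generated R"
    using pres by (simp_all add: presented_by_def)
  note bil = cbilinear_clinear[OF cbilinear_free_act[of \<rho>, OF \<rho>]]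
  have zero: "free_act \<rho> 0 v = 0" for v
    using clinear_zero[OF bil(2)] .
  have "free_act \<rho> v f = 0" if "free_eval h f = 0" for v f
  proof -
    have "f \<in> cvs.span {u * r * v |u r v. r \<in> R}"
      using that ker by (auto simp: two_sided_ideal_generated_def)
    then show ?thesis
    proof (rule clinear_eq_on_span[OF bil(1) _ _, rotated 2])
      show "clinear (\<lambda>f. 0)" by (simp add: clinear_iff)
    qed (auto simp: free_act_mult \<rho> relators zero)
  qed
  then have "\<exists>k. clinear k \<and> (\<forall>f. k (free_eval h f) = free_act \<rho> v f)" for v
    using factor_through_surjection[OF clinear_free_eval surj bil(1)] by metis
  then obtain act where act: "\<And>v. clinear (act v)" "\<And>v f. act v (free_eval h f) = free_act \<rho> v f"
    by metis
  have "clinear (\<lambda>v. act v a)" for a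
  proof -
    obtain f where "a = free_eval h f" using surj by (meson surjD)
    then show ?thesis by (simp add: act bil(2))
  qed
  then have "cbilinear act" by (simp add: cbilinear_def act(1))
  moreover have "act v 1 = v" for v
    using act(2)[of v 1] by (simp only: free_eval_one free_act_one)
  moreover have "act v (a * b) = act (act v a) b" for v a b
  proof -
    obtain f g where "a = free_eval h f" "b = free_eval h g" using surj by (meson surjD)
    then show ?thesis using act(2)[of v "f * g"] by (simp add: free_eval_mult act(2) free_act_mult \<rho>)
  qed
  moreover have "act v (h g) = \<rho> g v" for v g
    using act(2)[of v "free_gen g"] by (simp only: free_eval_gen free_act_gen)
  ultimately show thesis using that by blast
qed

lemma presented_by_span:
  assumes "presented_by h R"
  shows "cvs.span (range (\<lambda>ws. prod_list (map h ws))) = UNIV"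
proof -
  have "free_eval h f \<in> cvs.span (range (\<lambda>ws. prod_list (map h ws)))" for f
    unfolding free_eval_def by (intro cvs.span_sum cvs.span_scale cvs.span_base) auto
  moreover have "surj (free_eval h)" using assms by (simp add: presented_by_def)
  ultimately show ?thesis by (metis UNIV_eq_I surjD)
qed

section \<open>Diagonalisation\<close>

text \<open>Lagrange interpolation: \<open>W b c\<close> is (f - b)(f - c) v, an eigenvector for a,
  and v is a combination of the three vectors obtained in this way. The cubic relation is assumed
  only at v, so it can be checked block by block.\<close>

lemma cubic_span_eigenvectors:
  fixes f :: "'v::complex_vector \<Rightarrow> 'v"
  assumes f: "clinear f" and V: "cvs.subspace V" "\<And>v. v \<in> V \<Longrightarrow> f v \<in> V" and v: "v \<in> V"
    and distinct: "a \<noteq> b" "a \<noteq> c" "b \<noteq> c"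
    and cubic: "f (f (f v)) = (a + b + c) *\<^sub>C f (f v) - (a * b + a * c + b * c) *\<^sub>C f v + (a * b * c) *\<^sub>C v"
  shows "v \<in> cvs.span {w \<in> V. \<exists>t\<in>{a, b, c}. f w = t *\<^sub>C w}"
proof -
  define W where "W x y = f (f v) - (x + y) *\<^sub>C f v + (x * y) *\<^sub>C v" for x y
  have W: "W x y \<in> V" for x y
    unfolding W_def using V v by (intro cvs.subspace_add cvs.subspace_diff cvs.subspace_scale) auto
  have fW: "f (W x y) = f (f (f v)) - (x + y) *\<^sub>C f (f v) + (x * y) *\<^sub>C f v" for x y
    by (simp add: W_def clinearD[OF f])
  have eig: "f (W b c) = a *\<^sub>C W b c" "f (W a c) = b *\<^sub>C W a c" "f (W a b) = c *\<^sub>C W a b"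
    unfolding fW cubic by (simp_all add: W_def scaleC_distribs algebra_simps scaleC_scaleC mult.commute mult.left_commute)
  define D where "D = (a - b) * (a - c) * (b - c)"
  have "x *\<^sub>C W b c + y *\<^sub>C W a c + z *\<^sub>C W a b = (x + y + z) *\<^sub>C f (f v)
      - (x * (b + c) + y * (a + c) + z * (a + b)) *\<^sub>C f v
      + (x * (b * c) + y * (a * c) + z * (a * b)) *\<^sub>C v" for x y z
    by (simp add: W_def scaleC_distribs algebra_simps)
  \<comment> \<open>These are the interpolation weights multiplied by the Vandermonde product
    \<open>D\<close>: they cancel the coefficients of f (f v) and f v and leave D v.\<close>
  from this[of "b - c" "c - a" "a - b"]
  have "(b - c) *\<^sub>C W b c + (c - a) *\<^sub>C W a c + (a - b) *\<^sub>C W a b = D *\<^sub>C v"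
    by (simp add: D_def algebra_simps)
  moreover have "(b - c) *\<^sub>C W b c + (c - a) *\<^sub>C W a c + (a - b) *\<^sub>C W a b
      \<in> cvs.span {w \<in> V. \<exists>t\<in>{a, b, c}. f w = t *\<^sub>C w}"
    by (intro cvs.span_add cvs.span_scale cvs.span_base) (use W eig in auto)
  ultimately have "D *\<^sub>C v \<in> cvs.span {w \<in> V. \<exists>t\<in>{a, b, c}. f w = t *\<^sub>C w}"
    by (simp only:)
  from cvs.span_scale[OF this, of "1 / D"] show ?thesis using distinct by (simp add: D_def scaleC_scaleC scaleC_one)
qed

lemma diagonalisable_onI:
  assumes "V = cvs.span {v \<in> V. \<exists>t\<in>C. f v = t *\<^sub>C v}"
  shows "diagonalisable_on V f"
proof -
  obtain B where B: "B \<subseteq> {v \<in> V. \<exists>t\<in>C. f v = t *\<^sub>C v}" "cvs.independent B"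
    "{v \<in> V. \<exists>t\<in>C. f v = t *\<^sub>C v} \<subseteq> cvs.span B"
    by (rule cvs.maximal_independent_subset)
  have "cvs.span B = cvs.span {v \<in> V. \<exists>t\<in>C. f v = t *\<^sub>C v}"
  proof (rule antisym)
    show "cvs.span B \<subseteq> cvs.span {v \<in> V. \<exists>t\<in>C. f v = t *\<^sub>C v}" by (rule cvs.span_mono[OF B(1)])
    show "cvs.span {v \<in> V. \<exists>t\<in>C. f v = t *\<^sub>C v} \<subseteq> cvs.span B"
      by (rule cvs.span_minimal[OF B(3) cvs.subspace_span])
  qed
  then have "cvs.span B = V" by (rule trans[OF _ assms[symmetric]])
  then show ?thesis
    unfolding diagonalisable_on_def using B(1,2) by blast
qed

lemma funpow_eigenvector:
  assumes "clinear f" "f v = t *\<^sub>C v"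
  shows "(f ^^ i) v = t ^ i *\<^sub>C v"
  by (induction i) (simp_all add: scaleC_one clinear_scale[OF assms(1)] assms(2) scaleC_scaleC mult.commute)

lemma poly_operator_eigenvector:
  assumes "clinear f" "f v = t *\<^sub>C v"
  shows "poly_operator p f v = poly p t *\<^sub>C v"
  by (simp add: poly_operator_def funpow_eigenvector[OF assms] scaleC_scaleC poly_altdef cvs.scale_sum_left)

lemma clinear_poly_operator:
  assumes "clinear f"
  shows "clinear (poly_operator p f)"
proof -
  have "clinear (f ^^ i)" for i
  proof (induction i)
    case (Suc i)
    show ?case using clinear_compose[OF assms Suc] by (simp add: comp_def)
  qed (simp add: clinear_id)
  then show ?thesis
    by (intro clinearI)
      (simp_all add: poly_operator_def clinear_iff scaleC_add_right sum.distrib cvs.scale_sum_right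
        scaleC_scaleC mult.commute)
qed

text \<open>A nonzero eigenvector makes its eigenvalue a root of every annihilating polynomial, and
  distinctness allows the linear factors to be split off one after the other. The parameters are the
  negatives of the eigenvalues so that the factors are monic.\<close>

lemma minimal_polynomial_on_three_eigenvalues:
  fixes f :: "'v::complex_vector \<Rightarrow> 'v"
  assumes f: "clinear f" and V: "V = cvs.span {v \<in> V. \<exists>t\<in>{- a, - b, - c}. f v = t *\<^sub>C v}"
    and distinct: "a \<noteq> b" "a \<noteq> c" "b \<noteq> c"
    and eig: "\<And>t. t \<in> {- a, - b, - c} \<Longrightarrow> \<exists>v\<in>V. v \<noteq> 0 \<and> f v = t *\<^sub>C v"
  shows "minimal_polynomial_on V f ([:a, 1:] * [:b, 1:] * [:c, 1:])"
  unfolding minimal_polynomial_on_def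
proof (intro conjI ballI allI impI)
  let ?m = "[:a, 1:] * [:b, 1:] * [:c, 1:]"
  show "lead_coeff ?m = 1" by (simp only: lead_coeff_mult) simp
  show "poly_operator ?m f v = 0" if "v \<in> V" for v
  proof (rule clinear_eq_on_span[OF clinear_poly_operator[OF f]])
    show "clinear (\<lambda>_::'v. 0 :: 'v)" by (simp add: clinear_iff)
    show "v \<in> cvs.span {v \<in> V. \<exists>t\<in>{- a, - b, - c}. f v = t *\<^sub>C v}" using that by (subst (asm) V)
    fix w assume "w \<in> {v \<in> V. \<exists>t\<in>{- a, - b, - c}. f v = t *\<^sub>C v}"
    then obtain t where t: "t \<in> {- a, - b, - c}" "f w = t *\<^sub>C w" by blast
    have "poly [:a, 1:] t * poly [:b, 1:] t * poly [:c, 1:] t = 0" using t(1) by auto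
    then have "poly ?m t = 0" by (simp only: poly_mult)
    then show "poly_operator ?m f w = 0" by (simp only: poly_operator_eigenvector[OF f t(2)]) simp
  qed
  fix p assume p: "\<forall>v\<in>V. poly_operator p f v = 0"
  have root: "poly p t = 0" if t: "t \<in> {- a, - b, - c}" for t
  proof -
    obtain v where v: "v \<in> V" "v \<noteq> 0" "f v = t *\<^sub>C v" using eig[OF t] by blast
    have "poly p t *\<^sub>C v = poly_operator p f v" by (simp only: poly_operator_eigenvector[OF f v(3)])
    also have "\<dots> = 0" using p v(1) by blast
    finally show ?thesis using v(2) by simp
  qed
  obtain p1 where p1: "p = [:a, 1:] * p1"
    using root[of "- a"] poly_eq_0_iff_dvd[of p "- a"] by (auto elim: dvdE)
  have "poly p1 (- b) = 0" using root[of "- b"] distinct(1) by (simp add: p1)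
  then obtain p2 where p2: "p1 = [:b, 1:] * p2"
    using poly_eq_0_iff_dvd[of p1 "- b"] by (auto elim: dvdE)
  have "poly p2 (- c) = 0" using root[of "- c"] distinct(2,3) by (simp add: p1 p2)
  then obtain p3 where p3: "p2 = [:c, 1:] * p3"
    using poly_eq_0_iff_dvd[of p2 "- c"] by (auto elim: dvdE)
  have "p = ?m * p3" by (simp only: p1 p2 p3 mult.assoc)
  then show "?m dvd p" by (rule dvdI)
qed

section \<open>Coactions of a bicovariant calculus\<close>

lemma span_bilinear_iff_surj:
  assumes "cbilinear F"
  shows "cvs.span {F a b | a b. True} = UNIV \<longleftrightarrow> surj (tensor_lift F)"
proof -
  have "range (tensor_lift F) = cvs.span (tensor_lift F ` {a \<otimes>\<^sub>C b | a b. True})"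
  proof -
    interpret Vector_Spaces.linear scaleC scaleC "tensor_lift F"
      by (rule clinear_tensor_lift[OF assms])
    show ?thesis unfolding span_image span_pure ..
  qed
  also have "tensor_lift F ` {a \<otimes>\<^sub>C b | a b. True} = {F a b | a b. True}"
  proof
    show "tensor_lift F ` {a \<otimes>\<^sub>C b | a b. True} \<subseteq> {F a b | a b. True}"
      by (clarsimp simp: tensor_lift_pure[OF assms]) blast
    have "F a b \<in> tensor_lift F ` {a \<otimes>\<^sub>C b | a b. True}" for a b
      by (rule image_eqI[where x = "a \<otimes>\<^sub>C b"]) (auto simp: tensor_lift_pure[OF assms])
    then show "{F a b | a b. True} \<subseteq> tensor_lift F ` {a \<otimes>\<^sub>C b | a b. True}" by blast
  qed
  finally show ?thesis by auto
qed

text \<open>Existence comes from the kernel condition, uniqueness from spanning. Every structure map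
  introduced by \<open>THE\<close> on the calculus or on its square is an instance.\<close>

lemma clinear_the_induced:
  assumes F: "cbilinear F" and G: "cbilinear G" and span: "cvs.span {F a b | a b. True} = UNIV"
    and ker: "\<And>t. tensor_lift F t = 0 \<Longrightarrow> tensor_lift G t = 0"
  defines "h \<equiv> THE h. clinear h \<and> (\<forall>a b. h (F a b) = G a b)"
  shows "clinear h" and "h (F a b) = G a b"
proof -
  have "surj (tensor_lift F)" using span span_bilinear_iff_surj[OF F] by blast
  then obtain k where k: "clinear k" "\<And>t. k (tensor_lift F t) = tensor_lift G t"
    using factor_through_surjection[OF clinear_tensor_lift[OF F] _ clinear_tensor_lift[OF G] ker]
    by metis
  have pure: "k (F a b) = G a b" for a b
    using k(2)[of "a \<otimes>\<^sub>C b"] by (simp add: tensor_lift_pure F G)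
  have "h = k"
    unfolding h_def
  proof (rule the_equality)
    show "clinear k \<and> (\<forall>a b. k (F a b) = G a b)" using k(1) pure by blast
    fix g assume g: "clinear g \<and> (\<forall>a b. g (F a b) = G a b)"
    then have "clinear g" by blast
    from this k(1) span show "g = k" by (rule clinear_eq_spanning) (use g pure in auto)
  qed
  then show "clinear h" "h (F a b) = G a b" using k(1) pure by simp_all
qed

locale hopf_calculus =
  hopf_star_algebra \<Delta> \<epsilon> S star + bicovariant_calculus lact ract d \<Delta>
  for \<Delta> :: "'a::complex_algebra_1 \<Rightarrow> ('a, 'a) tensor"
    and \<epsilon> :: "'a \<Rightarrow> complex"
    and S star :: "'a \<Rightarrow> 'a"
    and lact :: "'a \<Rightarrow> 'e::complex_vector \<Rightarrow> 'e"
    and ract :: "'e \<Rightarrow> 'a \<Rightarrow> 'e"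
    and d :: "'a \<Rightarrow> 'e"
begin

abbreviation "\<delta>L \<equiv> left_coaction \<Delta> lact d"
abbreviation "\<delta>R \<equiv> right_coaction \<Delta> lact d"

lemmas lact_simps = cbilinearD[OF lact_bilinear] cbilinear_diff[OF lact_bilinear]
  cbilinear_sum[OF lact_bilinear]
lemmas ract_simps = cbilinearD[OF ract_bilinear] cbilinear_diff[OF ract_bilinear]
  cbilinear_sum[OF ract_bilinear]
lemmas mult_simps = cbilinearD[OF cbilinear_mult] cbilinear_diff[OF cbilinear_mult]
  cbilinear_sum[OF cbilinear_mult]
lemmas d_simps = clinearD[OF d_linear]
lemmas comult_simps = clinearD[OF comult_linear]
lemmas counit_simps = clinearD[OF counit_linear]

lemma cbilinear_lact_d: "cbilinear (\<lambda>a b. lact a (d b))"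
  by (rule cbilinear_compose[OF lact_bilinear clinear_id(1) d_linear])

lemma calculus_eqI:
  assumes "clinear f" "clinear g" "\<And>a b. f (lact a (d b)) = g (lact a (d b))"
  shows "f = g"
  by (rule clinear_eq_spanning[OF assms(1,2) d_spans]) (use assms(3) in auto)

lemmas left_prod_bilinear = cbilinear_tensor_prod[OF cbilinear_mult lact_bilinear]
lemmas right_prod_bilinear = cbilinear_tensor_prod[OF lact_bilinear cbilinear_mult]
lemmas left_prod_right_bilinear = cbilinear_tensor_prod[OF cbilinear_mult ract_bilinear]
lemmas mult_prod_bilinear = cbilinear_tensor_prod[OF cbilinear_mult cbilinear_mult]
lemmas mult_prod_pure = tensor_prod_pure[OF cbilinear_mult cbilinear_mult]
lemmas left_prod_pure = tensor_prod_pure[OF cbilinear_mult lact_bilinear]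
lemmas right_prod_pure = tensor_prod_pure[OF lact_bilinear cbilinear_mult]
lemmas left_prod_right_pure = tensor_prod_pure[OF cbilinear_mult ract_bilinear]

lemma clinear_left_coaction: "clinear \<delta>L"
  and left_coaction_lact_d:
    "\<delta>L (lact a (d b)) = tensor_prod (*) lact (\<Delta> a) (tensor_map id d (\<Delta> b))"
proof -
  let ?G = "\<lambda>a b. tensor_prod (*) lact (\<Delta> a) (tensor_map id d (\<Delta> b))"
  have G: "cbilinear ?G"
    by (rule cbilinear_compose[OF left_prod_bilinear comult_linear
          clinear_compose[OF clinear_tensor_map[OF clinear_id(2) d_linear] comult_linear]])
  \<comment> \<open>Left covariance is exactly this kernel condition, once the tensor is written as
    a finite sum.\<close>
  have ker: "tensor_lift ?G t = 0" if "tensor_lift (\<lambda>a b. lact a (d b)) t = 0" for t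
  proof -
    obtain n :: nat and x y where t: "t = (\<Sum>k<n. x k \<otimes>\<^sub>C y k)" by (rule tensor_finite_sum)
    have "(\<Sum>k<n. lact (x k) (d (y k))) = 0"
      using that by (simp add: t tensor_lift_sum tensor_lift_pure cbilinear_lact_d)
    then show ?thesis by (simp add: t tensor_lift_sum tensor_lift_pure G left_covariant)
  qed
  show "clinear \<delta>L" "\<delta>L (lact a (d b)) = ?G a b"
    unfolding left_coaction_def
    by (rule clinear_the_induced[OF cbilinear_lact_d G d_spans ker], assumption)+
qed

lemma clinear_right_coaction: "clinear \<delta>R"
  and right_coaction_lact_d:
    "\<delta>R (lact a (d b)) = tensor_prod lact (*) (\<Delta> a) (tensor_map d id (\<Delta> b))"
proof -
  let ?G = "\<lambda>a b. tensor_prod lact (*) (\<Delta> a) (tensor_map d id (\<Delta> b))"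
  have G: "cbilinear ?G"
    by (rule cbilinear_compose[OF right_prod_bilinear comult_linear
          clinear_compose[OF clinear_tensor_map[OF d_linear clinear_id(2)] comult_linear]])
  have ker: "tensor_lift ?G t = 0" if "tensor_lift (\<lambda>a b. lact a (d b)) t = 0" for t
  proof -
    obtain n :: nat and x y where t: "t = (\<Sum>k<n. x k \<otimes>\<^sub>C y k)" by (rule tensor_finite_sum)
    have "(\<Sum>k<n. lact (x k) (d (y k))) = 0"
      using that by (simp add: t tensor_lift_sum tensor_lift_pure cbilinear_lact_d)
    then show ?thesis by (simp add: t tensor_lift_sum tensor_lift_pure G right_covariant)
  qed
  show "clinear \<delta>R" "\<delta>R (lact a (d b)) = ?G a b"
    unfolding right_coaction_def
    by (rule clinear_the_induced[OF cbilinear_lact_d G d_spans ker], assumption)+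
qed

lemma left_coaction_lact: "\<delta>L (lact a e) = tensor_prod (*) lact (\<Delta> a) (\<delta>L e)"
proof -
  have "(\<lambda>e. \<delta>L (lact a e)) = (\<lambda>e. tensor_prod (*) lact (\<Delta> a) (\<delta>L e))"
  proof (rule calculus_eqI)
    show "clinear (\<lambda>e. \<delta>L (lact a e))"
      by (rule clinear_compose[OF clinear_left_coaction cbilinear_clinear_right[OF lact_bilinear]])
    show "clinear (\<lambda>e. tensor_prod (*) lact (\<Delta> a) (\<delta>L e))"
      by (rule clinear_compose[OF cbilinear_clinear_right[OF left_prod_bilinear] clinear_left_coaction])
    show "\<delta>L (lact a (lact b (d c))) = tensor_prod (*) lact (\<Delta> a) (\<delta>L (lact b (d c)))" for b c
      unfolding lact_mult[symmetric] left_coaction_lact_d comult_mult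
      by (rule tensor_prod_assoc)
        (simp_all add: cbilinear_mult lact_bilinear mult.assoc lact_mult)
  qed
  then show ?thesis by (rule fun_cong)
qed

text \<open>Since (b dc) a = b d(ca) - (bc) da, the claim follows from the Leibniz rule, lifted to
  the map id \<otimes> d. It is what makes the diagonal coaction well defined on balanced
  tensors.\<close>

lemma left_coaction_ract: "\<delta>L (ract e a) = tensor_prod (*) ract (\<delta>L e) (\<Delta> a)"
proof -
  define D where "D = tensor_map (id :: 'a \<Rightarrow> 'a) d"
  have D: "D (a \<otimes>\<^sub>C b) = a \<otimes>\<^sub>C d b" "clinear D" for a b
    unfolding D_def using tensor_map_pure[OF clinear_id(2) d_linear]
      clinear_tensor_map[OF clinear_id(2) d_linear] by simp_all
  have leibniz: "D (tensor_prod (*) (*) s t)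
      = tensor_prod (*) ract (D s) t + tensor_prod (*) lact s (D t)" for s t :: "('a, 'a) tensor"
  proof (induction s rule: tensor_induct)
    case (pure a b)
    show ?case
      by (induction t rule: tensor_induct)
        (simp_all add: mult_prod_pure left_prod_pure left_prod_right_pure D(1)
          d_mult pure_simps cbilinearD[OF mult_prod_bilinear] cbilinearD[OF left_prod_bilinear]
          cbilinearD[OF left_prod_right_bilinear] clinearD[OF D(2)])
  qed (simp add: cbilinearD[OF mult_prod_bilinear] cbilinearD[OF left_prod_bilinear]
          cbilinearD[OF left_prod_right_bilinear] clinearD[OF D(2)])
  have "(\<lambda>e. \<delta>L (ract e a)) = (\<lambda>e. tensor_prod (*) ract (\<delta>L e) (\<Delta> a))"
  proof (rule calculus_eqI)
    show "clinear (\<lambda>e. \<delta>L (ract e a))"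
      by (rule clinear_compose[OF clinear_left_coaction cbilinear_clinear_left[OF ract_bilinear]])
    show "clinear (\<lambda>e. tensor_prod (*) ract (\<delta>L e) (\<Delta> a))"
      by (rule clinear_compose[OF cbilinear_clinear_left[OF left_prod_right_bilinear] clinear_left_coaction])
    fix b c
    have "ract (lact b (d c)) a = lact b (d (c * a)) - lact (b * c) (d a)"
      by (simp add: lact_ract d_mult lact_simps lact_mult)
    then have "\<delta>L (ract (lact b (d c)) a) = tensor_prod (*) lact (\<Delta> b) (D (\<Delta> (c * a)))
        - tensor_prod (*) lact (\<Delta> (b * c)) (D (\<Delta> a))"
      by (simp add: clinear_diff[OF clinear_left_coaction] left_coaction_lact_d D_def)
    also have "tensor_prod (*) lact (\<Delta> (b * c)) (D (\<Delta> a))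
        = tensor_prod (*) lact (\<Delta> b) (tensor_prod (*) lact (\<Delta> c) (D (\<Delta> a)))"
      unfolding comult_mult by (rule tensor_prod_assoc)
        (simp_all add: cbilinear_mult lact_bilinear mult.assoc lact_mult)
    also have "tensor_prod (*) lact (\<Delta> b) (D (\<Delta> (c * a))) - \<dots>
        = tensor_prod (*) lact (\<Delta> b) (tensor_prod (*) ract (D (\<Delta> c)) (\<Delta> a))"
      by (simp add: comult_mult leibniz cbilinearD[OF left_prod_bilinear])
    also have "\<dots> = tensor_prod (*) ract (tensor_prod (*) lact (\<Delta> b) (D (\<Delta> c))) (\<Delta> a)"
      by (rule tensor_prod_assoc[symmetric])
        (simp_all add: cbilinear_mult lact_bilinear ract_bilinear mult.assoc lact_ract)
    finally show "\<delta>L (ract (lact b (d c)) a) = tensor_prod (*) ract (\<delta>L (lact b (d c))) (\<Delta> a)"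
      by (simp add: left_coaction_lact_d D_def)
  qed
  then show ?thesis by (rule fun_cong)
qed

lemma d_one: "d 1 = 0"
  using d_mult[of 1 1] by (simp add: lact_one ract_one)

lemma antipode_one: "S 1 = 1"
  using antipode_left[of 1]
  by (simp add: comult_one tensor_lift_pure counit_one scaleC_one
      cbilinear_compose[OF cbilinear_mult antipode_linear clinear_id(1)])

lemma cbilinear_antipode_mult: "cbilinear (\<lambda>x y. S x * y)" "cbilinear (\<lambda>x y. x * S y)"
  by (rule cbilinear_compose[OF cbilinear_mult antipode_linear clinear_id(1)]
      cbilinear_compose[OF cbilinear_mult clinear_id(1) antipode_linear])+

lemma cbilinear_antipode_lact: "cbilinear (\<lambda>x y. lact (S x) y)" "cbilinear (\<lambda>x y. lact (S x) (d y))"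
  by (rule cbilinear_compose[OF lact_bilinear antipode_linear clinear_id(1)]
      cbilinear_compose[OF lact_bilinear antipode_linear d_linear])+

text \<open>By the antipode axiom S(U) is a left inverse of the matrix U, so it agrees with any
  right inverse. This evaluates the antipode on matrix entries without appeal to its general
  properties.\<close>

lemma antipode_corepresentation:
  fixes U W :: "'i::finite \<Rightarrow> 'i \<Rightarrow> 'a"
  assumes comult: "\<And>i j. \<Delta> (U i j) = (\<Sum>k\<in>UNIV. U i k \<otimes>\<^sub>C U k j)"
    and counit: "\<And>i j. \<epsilon> (U i j) = (if i = j then 1 else 0)"
    and inverse: "\<And>i j. (\<Sum>k\<in>UNIV. U i k * W k j) = (if i = j then 1 else 0)"
  shows "S (U i j) = W i j"
proof -
  have left: "(\<Sum>k\<in>UNIV. S (U i k) * U k l) = (if i = l then 1 else 0)" for l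
    using antipode_left[of "U i l"]
    by (simp add: comult counit tensor_lift_sum tensor_lift_pure cbilinear_antipode_mult scaleC_one
        split: if_splits)
  have "S (U i j) = (\<Sum>k\<in>UNIV. S (U i k) * (\<Sum>l\<in>UNIV. U k l * W l j))"
    by (simp add: inverse if_distrib[of "(*) _"] cong: if_cong)
  also have "\<dots> = (\<Sum>k\<in>UNIV. \<Sum>l\<in>UNIV. (S (U i k) * U k l) * W l j)"
    by (simp add: sum_distrib_left mult.assoc)
  also have "\<dots> = (\<Sum>l\<in>UNIV. (\<Sum>k\<in>UNIV. S (U i k) * U k l) * W l j)"
    by (subst sum.swap) (simp add: sum_distrib_right)
  also have "\<dots> = W i j"
    by (simp add: left if_distrib[of "\<lambda>x. x * _"] cong: if_cong)
  finally show ?thesis .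
qed

end

section \<open>The fundamental corepresentation\<close>

lemma sum_UNIV_bool: "(\<Sum>b\<in>UNIV. f b) = f False + f True"
  by (simp add: UNIV_bool)

locale suq2_calculus =
  suq2 \<Delta> \<epsilon> S star q \<alpha> \<gamma> + hopf_calculus \<Delta> \<epsilon> S star lact ract d
  for \<Delta> :: "'a::complex_algebra_1 \<Rightarrow> ('a, 'a) tensor"
    and \<epsilon> :: "'a \<Rightarrow> complex"
    and S star :: "'a \<Rightarrow> 'a"
    and q :: real
    and \<alpha> \<gamma> :: 'a
    and lact :: "'a \<Rightarrow> 'e::complex_vector \<Rightarrow> 'e"
    and ract :: "'e \<Rightarrow> 'a \<Rightarrow> 'e"
    and d :: "'a \<Rightarrow> 'e" +
  assumes q_range: "- 1 < q" "q < 1" "q \<noteq> 0"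
begin

abbreviation "k \<equiv> complex_of_real q"

abbreviation "gen \<equiv> case_suq2_gen \<alpha> (star \<alpha>) \<gamma> (star \<gamma>)"

lemma k_nonzero: "k \<noteq> 0" "1 - k\<^sup>2 \<noteq> 0" "1 + k\<^sup>2 \<noteq> 0"
proof -
  have "q\<^sup>2 < 1" using q_range by (simp add: abs_square_less_1)
  moreover have "1 + q\<^sup>2 > 0" by (simp add: add_pos_nonneg)
  ultimately have "1 - q\<^sup>2 \<noteq> 0" "1 + q\<^sup>2 \<noteq> 0" by auto
  moreover have "1 - k\<^sup>2 = complex_of_real (1 - q\<^sup>2)" "1 + k\<^sup>2 = complex_of_real (1 + q\<^sup>2)" by simp_all
  ultimately show "k \<noteq> 0" "1 - k\<^sup>2 \<noteq> 0" "1 + k\<^sup>2 \<noteq> 0" using q_range by (simp_all only: of_real_eq_0_iff) auto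
qed

lemma free_eval_relator:
  assumes "r \<in> suq2_relators q"
  shows "free_eval gen r = 0"
proof -
  have "1 * r * 1 \<in> two_sided_ideal_generated (suq2_relators q)"
    unfolding two_sided_ideal_generated_def using assms by (intro cvs.span_base) blast
  then show ?thesis using presentation by (auto simp: presented_by_def)
qed

lemma relations:
  shows "star \<alpha> * \<alpha> = 1 - \<gamma> * star \<gamma>"
    and "\<alpha> * star \<alpha> = 1 - k\<^sup>2 *\<^sub>C (\<gamma> * star \<gamma>)"
    and "star \<gamma> * \<gamma> = \<gamma> * star \<gamma>"
    and "\<alpha> * \<gamma> = k *\<^sub>C (\<gamma> * \<alpha>)"
    and "\<alpha> * star \<gamma> = k *\<^sub>C (star \<gamma> * \<alpha>)"
    and "star \<gamma> * star \<alpha> = k *\<^sub>C (star \<alpha> * star \<gamma>)"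
    and "\<gamma> * star \<alpha> = k *\<^sub>C (star \<alpha> * \<gamma>)"
proof -
  note eval = clinearD[OF clinear_free_eval] free_eval_mult free_eval_gen free_eval_one
  have "\<forall>r\<in>suq2_relators q. free_eval gen r = 0"
    using free_eval_relator by blast
  then have rel: "star \<alpha> * \<alpha> + star \<gamma> * \<gamma> - 1 = 0" "\<alpha> * star \<alpha> + k\<^sup>2 *\<^sub>C (\<gamma> * star \<gamma>) - 1 = 0"
    "star \<gamma> * \<gamma> - \<gamma> * star \<gamma> = 0" "\<alpha> * \<gamma> - k *\<^sub>C (\<gamma> * \<alpha>) = 0"
    "\<alpha> * star \<gamma> - k *\<^sub>C (star \<gamma> * \<alpha>) = 0" "star \<gamma> * star \<alpha> - k *\<^sub>C (star \<alpha> * star \<gamma>) = 0"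
    "\<gamma> * star \<alpha> - k *\<^sub>C (star \<alpha> * \<gamma>) = 0"
    by (auto simp: suq2_relators_def Let_def eval)
  show "star \<gamma> * \<gamma> = \<gamma> * star \<gamma>" using rel(3) by simp
  then show "star \<alpha> * \<alpha> = 1 - \<gamma> * star \<gamma>" using rel(1) by (simp add: algebra_simps)
  show "\<alpha> * star \<alpha> = 1 - k\<^sup>2 *\<^sub>C (\<gamma> * star \<gamma>)" using rel(2) by (simp add: algebra_simps)
  show "\<alpha> * \<gamma> = k *\<^sub>C (\<gamma> * \<alpha>)" "\<alpha> * star \<gamma> = k *\<^sub>C (star \<gamma> * \<alpha>)"
    "star \<gamma> * star \<alpha> = k *\<^sub>C (star \<alpha> * star \<gamma>)" "\<gamma> * star \<alpha> = k *\<^sub>C (star \<alpha> * \<gamma>)"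
    using rel(4-7) by simp_all
qed

text \<open>These values are forced. The two relations for \<alpha> and \<open>star \<alpha>\<close>
  give (1 - q^2) \<epsilon>(\<gamma>) \<epsilon>(\<open>star \<gamma>\<close>) = 0, so
  \<epsilon>(\<alpha>) is invertible; the q-commutation relations then kill both factors, and the
  counit axiom at \<alpha> fixes \<epsilon>(\<alpha>) = 1.\<close>

lemma counit_generators: "\<epsilon> \<alpha> = 1" "\<epsilon> (star \<alpha>) = 1" "\<epsilon> \<gamma> = 0" "\<epsilon> (star \<gamma>) = 0"
proof -
  have eps: "\<epsilon> (star \<alpha>) * \<epsilon> \<alpha> = 1 - \<epsilon> \<gamma> * \<epsilon> (star \<gamma>)"
    "\<epsilon> \<alpha> * \<epsilon> (star \<alpha>) = 1 - k\<^sup>2 * (\<epsilon> \<gamma> * \<epsilon> (star \<gamma>))"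
    using relations(1,2)[THEN arg_cong, of \<epsilon>]
    by (simp_all add: counit_mult counit_simps counit_one scaleC_complex_def)
  then have "(1 - k\<^sup>2) * (\<epsilon> \<gamma> * \<epsilon> (star \<gamma>)) = 0" by (simp add: algebra_simps)
  then have "\<epsilon> \<gamma> * \<epsilon> (star \<gamma>) = 0" using k_nonzero by simp
  then have inv: "\<epsilon> (star \<alpha>) * \<epsilon> \<alpha> = 1" using eps by simp
  have k1: "1 - k \<noteq> 0" using k_nonzero(2) by auto
  have "\<epsilon> \<alpha> * \<epsilon> \<gamma> = k * (\<epsilon> \<gamma> * \<epsilon> \<alpha>)" "\<epsilon> \<alpha> * \<epsilon> (star \<gamma>) = k * (\<epsilon> (star \<gamma>) * \<epsilon> \<alpha>)"
    using relations(4,5)[THEN arg_cong, of \<epsilon>] by (simp_all add: counit_mult counit_simps scaleC_complex_def)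
  then have "(1 - k) * (\<epsilon> \<alpha> * \<epsilon> \<gamma>) = 0" "(1 - k) * (\<epsilon> \<alpha> * \<epsilon> (star \<gamma>)) = 0" by (simp_all add: algebra_simps)
  then show "\<epsilon> \<gamma> = 0" "\<epsilon> (star \<gamma>) = 0" using k1 inv by auto
  have bil: "cbilinear (\<lambda>x y. \<epsilon> x *\<^sub>C (y :: 'a))"
    by (rule cbilinear_compose[OF cbilinear_scaleC counit_linear clinear_id(1)])
  have "\<epsilon> \<alpha> *\<^sub>C \<alpha> = \<alpha>"
    using counit_left[of \<alpha>] \<open>\<epsilon> (star \<gamma>) = 0\<close> by (simp add: comult_alpha tensor_lift_simps bil)
  then have "(\<epsilon> \<alpha> - 1) *\<^sub>C \<alpha> = 0" by (simp add: scaleC_distribs scaleC_one)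
  moreover have "\<alpha> \<noteq> 0" using inv counit_simps(3) by auto
  ultimately show "\<epsilon> \<alpha> = 1" by simp
  then show "\<epsilon> (star \<alpha>) = 1" using inv by simp
qed

lemma star_simps: "star (- a) = - star a" "star (a - b) = star a - star b"
proof -
  have "star 0 = 0" using star_add[of 0 0] by simp
  then show neg: "star (- a) = - star a" for a using star_add[of a "- a"] by (simp add: eq_neg_iff_add_eq_0 add.commute)
  show "star (a - b) = star a - star b" using star_add[of a "- b"] by (simp add: neg)
qed

lemma comult_star_two:
  assumes "\<Delta> a = x \<otimes>\<^sub>C y + x' \<otimes>\<^sub>C y'"
  shows "\<Delta> (star a) = star x \<otimes>\<^sub>C star y + star x' \<otimes>\<^sub>C star y'"
proof -
  have "\<Delta> a = (\<Sum>i<Suc (Suc 0). (if i = 0 then x else x') \<otimes>\<^sub>C (if i = 0 then y else y'))"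
    using assms by simp
  from comult_star[OF this] show ?thesis by simp
qed

lemma comult_star_generators:
  "\<Delta> (star \<alpha>) = star \<alpha> \<otimes>\<^sub>C star \<alpha> - k *\<^sub>C (\<gamma> \<otimes>\<^sub>C star \<gamma>)"
  "\<Delta> (star \<gamma>) = star \<gamma> \<otimes>\<^sub>C star \<alpha> + \<alpha> \<otimes>\<^sub>C star \<gamma>"
proof -
  have "\<Delta> \<alpha> = \<alpha> \<otimes>\<^sub>C \<alpha> + (- (k *\<^sub>C star \<gamma>)) \<otimes>\<^sub>C \<gamma>" by (simp add: comult_alpha pure_simps)
  from comult_star_two[OF this]
  show "\<Delta> (star \<alpha>) = star \<alpha> \<otimes>\<^sub>C star \<alpha> - k *\<^sub>C (\<gamma> \<otimes>\<^sub>C star \<gamma>)"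
    by (simp add: star_simps star_scaleC star_star pure_simps)
  from comult_star_two[OF comult_gamma]
  show "\<Delta> (star \<gamma>) = star \<gamma> \<otimes>\<^sub>C star \<alpha> + \<alpha> \<otimes>\<^sub>C star \<gamma>" by (simp add: star_star)
qed

text \<open>The index \<open>False\<close> is the first row or column.\<close>

definition u :: "bool \<Rightarrow> bool \<Rightarrow> 'a"
  where "u i j = (if i then if j then star \<alpha> else \<gamma> else if j then - (k *\<^sub>C star \<gamma>) else \<alpha>)"

lemma u_simps: "u False False = \<alpha>" "u False True = - (k *\<^sub>C star \<gamma>)" "u True False = \<gamma>"
  "u True True = star \<alpha>"
  by (simp_all add: u_def)

lemma comult_u: "\<Delta> (u i j) = (\<Sum>m\<in>UNIV. u i m \<otimes>\<^sub>C u m j)"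
  by (cases i; cases j) (simp_all add: sum_UNIV_bool u_simps comult_alpha comult_gamma
      comult_star_generators comult_simps pure_simps scaleC_distribs power2_eq_square algebra_simps)

lemma counit_u: "\<epsilon> (u i j) = (if i = j then 1 else 0)"
  by (cases i; cases j) (simp_all add: u_simps counit_generators counit_simps)

text \<open>The matrix u is unitary, so its inverse is the adjoint matrix with entries
  \<open>star (u j i)\<close>.\<close>

lemma antipode_u: "S (u i j) = (if i then if j then \<alpha> else - (k *\<^sub>C \<gamma>) else if j then star \<gamma> else star \<alpha>)"
  by (rule antipode_corepresentation[where U = u, OF comult_u counit_u])
    (auto simp: sum_UNIV_bool u_def relations mult_simps scaleC_distribs power2_eq_square)

lemma antipode_mult_u: "(\<Sum>m\<in>UNIV. S (u i m) * u m j) = (if i = j then 1 else 0)"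
  and u_mult_antipode: "(\<Sum>m\<in>UNIV. u i m * S (u m j)) = (if i = j then 1 else 0)"
  using antipode_left[of "u i j"] antipode_right[of "u i j"]
  by (simp_all add: comult_u counit_u tensor_lift_sum tensor_lift_pure cbilinear_antipode_mult scaleC_one
      split: if_splits)

lemma comult_antipode_u: "\<Delta> (S (u i j)) = (\<Sum>m\<in>UNIV. S (u m j) \<otimes>\<^sub>C S (u i m))"
  by (cases i; cases j) (simp_all add: sum_UNIV_bool antipode_u comult_alpha comult_gamma
      comult_star_generators comult_simps pure_simps scaleC_distribs)

text \<open>The entries of \<open>u \<otimes> u\<close> form a corepresentation, which yields the only instance of
  antimultiplicativity of the antipode that is needed.\<close>

lemma antipode_u_product: "S (u i j * u m n) = S (u m n) * S (u i j)"
proof -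
  define U where "U p r = u (fst p) (fst r) * u (snd p) (snd r)" for p r :: "bool \<times> bool"
  define W where "W p r = S (u (snd p) (snd r)) * S (u (fst p) (fst r))" for p r :: "bool \<times> bool"
  have UNIV_pairs: "(\<Sum>p\<in>UNIV. f p) = (\<Sum>a\<in>UNIV. \<Sum>b\<in>UNIV. f (a, b))"
    for f :: "bool \<times> bool \<Rightarrow> 'x::comm_monoid_add"
    by (simp add: sum.cartesian_product flip: UNIV_Times_UNIV)
  have "S (U (i, m) (j, n)) = W (i, m) (j, n)"
  proof (rule antipode_corepresentation)
    fix p r
    show "\<Delta> (U p r) = (\<Sum>t\<in>UNIV. U p t \<otimes>\<^sub>C U t r)"
      by (simp add: U_def comult_mult comult_u UNIV_pairs cbilinear_sum[OF mult_prod_bilinear]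
          mult_prod_pure) (rule sum.swap)
    show "\<epsilon> (U p r) = (if p = r then 1 else 0)"
      by (auto simp: U_def counit_mult counit_u prod_eq_iff)
    have "(\<Sum>t\<in>UNIV. U p t * W t r)
        = (\<Sum>a\<in>UNIV. u (fst p) a * (\<Sum>b\<in>UNIV. u (snd p) b * S (u b (snd r))) * S (u a (fst r)))"
      by (simp add: U_def W_def UNIV_pairs sum_distrib_left sum_distrib_right mult.assoc)
    also have "\<dots> = (if p = r then 1 else 0)"
      by (cases "snd p = snd r") (auto simp: u_mult_antipode prod_eq_iff)
    finally show "(\<Sum>t\<in>UNIV. U p t * W t r) = (if p = r then 1 else 0)" .
  qed
  then show ?thesis by (simp add: U_def W_def)
qed

section \<open>Left-invariant forms\<close>

text \<open>The quantum Maurer-Cartan form; its kernel inside that of \<epsilon> is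
  \<open>calculus_ideal\<close>.\<close>

definition \<omega> :: "'a \<Rightarrow> 'e"
  where "\<omega> a = tensor_lift (\<lambda>x y. lact (S x) (d y)) (\<Delta> a)"

lemma clinear_\<omega>: "clinear \<omega>"
  unfolding \<omega>_def by (rule clinear_compose[OF clinear_tensor_lift[OF cbilinear_antipode_lact(2)] comult_linear])

lemmas \<omega>_simps = clinearD[OF clinear_\<omega>]

lemma \<omega>_one: "\<omega> 1 = 0"
  by (simp add: \<omega>_def comult_one tensor_lift_pure cbilinear_antipode_lact d_one lact_simps)

lemma \<omega>_u: "\<omega> (u i j) = (\<Sum>m\<in>UNIV. lact (S (u i m)) (d (u m j)))"
  by (simp add: \<omega>_def comult_u tensor_lift_sum tensor_lift_pure cbilinear_antipode_lact)

lemma d_u: "d (u i j) = (\<Sum>m\<in>UNIV. lact (u i m) (\<omega> (u m j)))"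
proof -
  have "(\<Sum>m\<in>UNIV. lact (u i m) (\<omega> (u m j)))
      = (\<Sum>n\<in>UNIV. lact (\<Sum>m\<in>UNIV. u i m * S (u m n)) (d (u n j)))"
    by (simp add: \<omega>_u lact_simps lact_mult) (rule sum.swap)
  also have "\<dots> = d (u i j)"
    by (cases i) (simp_all add: u_mult_antipode sum_UNIV_bool lact_one lact_simps)
  finally show ?thesis ..
qed

lemma left_coaction_\<omega>_u: "\<delta>L (\<omega> (u i j)) = 1 \<otimes>\<^sub>C \<omega> (u i j)"
proof -
  have tmap: "tensor_map id d (x \<otimes>\<^sub>C y) = x \<otimes>\<^sub>C d y" for x y :: 'a
    by (simp add: tensor_map_pure[OF clinear_id(2) d_linear])
  have "\<delta>L (\<omega> (u i j)) = (\<Sum>m\<in>UNIV. \<Sum>r\<in>UNIV. \<Sum>n\<in>UNIV. (S (u n m) * u m r) \<otimes>\<^sub>C lact (S (u i n)) (d (u r j)))"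
    by (simp add: \<omega>_u clinear_sum[OF clinear_left_coaction] left_coaction_lact_d comult_antipode_u comult_u
        clinear_sum[OF clinear_tensor_map[OF clinear_id(2) d_linear]] tmap
        cbilinear_sum[OF left_prod_bilinear] left_prod_pure)
  also have "\<dots> = (\<Sum>n\<in>UNIV. \<Sum>r\<in>UNIV. (\<Sum>m\<in>UNIV. S (u n m) * u m r) \<otimes>\<^sub>C lact (S (u i n)) (d (u r j)))"
    by (simp add: sum_UNIV_bool pure_simps algebra_simps)
  also have "\<dots> = 1 \<otimes>\<^sub>C \<omega> (u i j)"
    by (simp add: antipode_mult_u \<omega>_u sum_UNIV_bool pure_simps)
  finally show ?thesis .
qed

text \<open>The Leibniz rule splits d of the product. One half is the right adjoint action S(b_1)
  \<omega>(a) b_2; in the other half the factors coming from a contract to \<epsilon>(a).\<close>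

lemma \<omega>_u_product:
  "\<omega> (u i j * u m n) = (\<Sum>r\<in>UNIV. lact (S (u m r)) (ract (\<omega> (u i j)) (u r n)))
    + (if i = j then \<omega> (u m n) else 0)"
proof -
  have "\<omega> (u i j * u m n) = (\<Sum>p\<in>UNIV. \<Sum>r\<in>UNIV. lact (S (u i p * u m r)) (d (u p j * u r n)))"
    by (simp add: \<omega>_def comult_mult comult_u cbilinear_sum[OF mult_prod_bilinear] mult_prod_pure
        tensor_lift_sum tensor_lift_pure cbilinear_antipode_lact) (rule sum.swap)
  also have "\<dots> = (\<Sum>p\<in>UNIV. \<Sum>r\<in>UNIV. lact (S (u m r)) (ract (lact (S (u i p)) (d (u p j))) (u r n))
      + lact (S (u m r)) (lact (S (u i p) * u p j) (d (u r n))))"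
    by (simp add: antipode_u_product d_mult lact_simps lact_mult lact_ract)
  also have "\<dots> = (\<Sum>r\<in>UNIV. lact (S (u m r)) (ract (\<omega> (u i j)) (u r n)))
      + (\<Sum>r\<in>UNIV. lact (S (u m r)) (lact (\<Sum>p\<in>UNIV. S (u i p) * u p j) (d (u r n))))"
    by (simp add: \<omega>_u[of i j] lact_simps ract_simps sum.distrib) (simp add: sum_UNIV_bool algebra_simps)
  also have "(\<Sum>r\<in>UNIV. lact (S (u m r)) (lact (\<Sum>p\<in>UNIV. S (u i p) * u p j) (d (u r n))))
      = (if i = j then \<omega> (u m n) else 0)"
    by (simp add: antipode_mult_u \<omega>_u[of m n] lact_one lact_simps)
  finally show ?thesis .
qed

text \<open>Inverts the adjoint action of \<open>\<omega>_u_product\<close>: this is the commutation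
  rule that moves a matrix entry from the right of an invariant form to its left.\<close>

lemma \<omega>_u_right_mult:
  "ract (\<omega> (u i j)) (u a n)
    = (\<Sum>m\<in>UNIV. lact (u a m) (\<omega> (u i j * u m n) - (if i = j then \<omega> (u m n) else 0)))"
proof -
  have "(\<Sum>m\<in>UNIV. lact (u a m) (\<omega> (u i j * u m n) - (if i = j then \<omega> (u m n) else 0)))
      = (\<Sum>m\<in>UNIV. \<Sum>r\<in>UNIV. lact (u a m * S (u m r)) (ract (\<omega> (u i j)) (u r n)))"
    by (simp add: \<omega>_u_product lact_simps lact_mult)
  also have "\<dots> = (\<Sum>r\<in>UNIV. lact (\<Sum>m\<in>UNIV. u a m * S (u m r)) (ract (\<omega> (u i j)) (u r n)))"
    by (subst sum.swap) (simp add: lact_simps)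
  also have "\<dots> = ract (\<omega> (u i j)) (u a n)"
    by (cases a) (simp_all add: u_mult_antipode sum_UNIV_bool lact_one lact_simps)
  finally show ?thesis ..
qed

section \<open>Right-invariant forms\<close>

text \<open>The right-invariant counterpart a_1 d S(a_2) of \<omega>, on matrix entries.\<close>

definition \<eta> :: "bool \<Rightarrow> bool \<Rightarrow> 'e"
  where "\<eta> i j = (\<Sum>m\<in>UNIV. lact (u i m) (d (S (u m j))))"

lemma right_invariant_\<eta>: "\<eta> i j \<in> right_invariant \<delta>R"
proof -
  have tmap: "tensor_map d id (x \<otimes>\<^sub>C y) = d x \<otimes>\<^sub>C y" for x y :: 'a
    by (simp add: tensor_map_pure[OF d_linear clinear_id(2)])
  have "\<delta>R (\<eta> i j) = (\<Sum>m\<in>UNIV. \<Sum>r\<in>UNIV. \<Sum>n\<in>UNIV. lact (u i n) (d (S (u r j))) \<otimes>\<^sub>C (u n m * S (u m r)))"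
    by (simp add: \<eta>_def clinear_sum[OF clinear_right_coaction] right_coaction_lact_d comult_antipode_u comult_u
        clinear_sum[OF clinear_tensor_map[OF d_linear clinear_id(2)]] tmap
        cbilinear_sum[OF right_prod_bilinear] right_prod_pure)
  also have "\<dots> = (\<Sum>r\<in>UNIV. \<Sum>n\<in>UNIV. lact (u i n) (d (S (u r j))) \<otimes>\<^sub>C (\<Sum>m\<in>UNIV. u n m * S (u m r)))"
    by (simp add: sum_UNIV_bool pure_simps algebra_simps)
  also have "\<dots> = \<eta> i j \<otimes>\<^sub>C 1"
    by (simp add: u_mult_antipode \<eta>_def sum_UNIV_bool pure_simps)
  finally show ?thesis by (simp add: right_invariant_def)
qed

text \<open>Differentiating S(u) u = 1 gives \<omega>(u) = - (d S(u)) u, and d S(u) is recovered as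
  S(u) \<eta>. This is the bridge to the pairs on which the braiding is known.\<close>

lemma \<omega>_u_eq_\<eta>:
  "\<omega> (u i j) = - (\<Sum>m\<in>UNIV. \<Sum>n\<in>UNIV. ract (lact (S (u i m)) (\<eta> m n)) (u n j))"
proof -
  have "(\<Sum>m\<in>UNIV. lact (S (u i m)) (\<eta> m n)) = d (S (u i n))" for n
  proof -
    have "(\<Sum>m\<in>UNIV. lact (S (u i m)) (\<eta> m n))
        = (\<Sum>r\<in>UNIV. lact (\<Sum>m\<in>UNIV. S (u i m) * u m r) (d (S (u r n))))"
      by (simp add: \<eta>_def lact_simps lact_mult) (rule sum.swap)
    also have "\<dots> = d (S (u i n))"
      by (cases i) (simp_all add: antipode_mult_u sum_UNIV_bool lact_one lact_simps)
    finally show ?thesis .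
  qed
  then have "(\<Sum>m\<in>UNIV. \<Sum>n\<in>UNIV. ract (lact (S (u i m)) (\<eta> m n)) (u n j))
      = (\<Sum>n\<in>UNIV. ract (d (S (u i n))) (u n j))"
    by (subst sum.swap) (simp flip: ract_simps)
  also have "\<dots> = d (\<Sum>n\<in>UNIV. S (u i n) * u n j) - \<omega> (u i j)"
    by (simp add: d_simps d_mult \<omega>_u sum.distrib)
  also have "\<dots> = - \<omega> (u i j)"
    by (simp add: antipode_mult_u d_one d_simps)
  finally show ?thesis by simp
qed

end

section \<open>The right module of a four-dimensional calculus\<close>

datatype quad = Quad (coord_\<theta>: complex) (coord_e: complex) (coord_f: complex) (coord_n: complex)

instantiation quad :: complex_vector
begin

definition zero_quad :: quad where "zero_quad = Quad 0 0 0 0"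
definition plus_quad :: "quad \<Rightarrow> quad \<Rightarrow> quad" where
  "plus_quad v w = Quad (coord_\<theta> v + coord_\<theta> w) (coord_e v + coord_e w) (coord_f v + coord_f w) (coord_n v + coord_n w)"
definition minus_quad :: "quad \<Rightarrow> quad \<Rightarrow> quad" where
  "minus_quad v w = Quad (coord_\<theta> v - coord_\<theta> w) (coord_e v - coord_e w) (coord_f v - coord_f w) (coord_n v - coord_n w)"
definition uminus_quad :: "quad \<Rightarrow> quad" where
  "uminus_quad v = Quad (- coord_\<theta> v) (- coord_e v) (- coord_f v) (- coord_n v)"
definition scaleC_quad :: "complex \<Rightarrow> quad \<Rightarrow> quad" where
  "scaleC_quad c v = Quad (c * coord_\<theta> v) (c * coord_e v) (c * coord_f v) (c * coord_n v)"

instance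
  by standard (simp_all add: zero_quad_def plus_quad_def minus_quad_def uminus_quad_def scaleC_quad_def
      algebra_simps quad.expand)

end

lemmas quad_simps = zero_quad_def plus_quad_def minus_quad_def uminus_quad_def scaleC_quad_def

locale four_d = suq2_calculus \<Delta> \<epsilon> S star q \<alpha> \<gamma> lact ract d
  for \<Delta> :: "'a::complex_algebra_1 \<Rightarrow> ('a, 'a) tensor"
    and \<epsilon> :: "'a \<Rightarrow> complex"
    and S star :: "'a \<Rightarrow> 'a"
    and q :: real
    and \<alpha> \<gamma> :: 'a
    and lact :: "'a \<Rightarrow> 'e::complex_vector \<Rightarrow> 'e"
    and ract :: "'e \<Rightarrow> 'a \<Rightarrow> 'e"
    and d :: "'a \<Rightarrow> 'e" +
  fixes s :: real
  assumes sign: "s = 1 \<or> s = - 1"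
    and ideal: "calculus_ideal \<Delta> \<epsilon> S lact d = right_ideal_generated (four_d_generators q s star \<alpha> \<gamma>)"
begin

abbreviation "sg \<equiv> complex_of_real s"

text \<open>This is q^(-1) - q; its square q^2 - 2 + q^(-2) governs the cubic identity in weight
  zero.\<close>

definition \<nu> :: complex where "\<nu> = (1 - k\<^sup>2) / k"

lemma \<nu>_nonzero: "\<nu> \<noteq> 0"
  using k_nonzero by (simp add: \<nu>_def)

lemma sg_square: "sg * sg = 1" "sg * (sg * x) = x"
  using sign by auto

text \<open>The basis of \<open>quad\<close> is \<open>\<theta>, e = \<theta>\<gamma>, f = \<theta>\<gamma>\<^sup>*, n\<close> with \<open>\<theta>\<gamma>\<gamma>\<^sup>* = \<nu>\<^sup>2 n\<close>. This is the quotient of the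
  algebra by the right ideal generated by \<open>\<alpha> - sq, \<gamma>\<^sup>2, \<gamma>\<^sup>*\<^sup>2\<close>, whose cyclic vector is \<open>\<theta> + n\<close>; the vector
  \<open>\<theta>\<close> is singled out by \<open>\<theta>z\<^sub>\<plusminus> = 0\<close> and corresponds to the bi-invariant form.\<close>

fun gen_act :: "suq2_gen \<Rightarrow> quad \<Rightarrow> quad" where
  "gen_act Alpha (Quad a b c g) = Quad (sg * k * a) (sg * b) (sg * c) (sg * (g / k - \<nu> * a))"
| "gen_act AlphaStar (Quad a b c g) = Quad (sg * a / k) (sg * b) (sg * c) (sg * (k * g + k\<^sup>2 * \<nu> * a))"
| "gen_act Gamma (Quad a b c g) = Quad 0 a 0 (\<nu>\<^sup>2 * c)"
| "gen_act GammaStar (Quad a b c g) = Quad 0 0 a (\<nu>\<^sup>2 * b)"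

lemma clinear_gen_act: "clinear (gen_act g)"
proof (rule clinearI)
  fix v w :: quad and c :: complex
  obtain a1 a2 a3 a4 b1 b2 b3 b4 where "v = Quad a1 a2 a3 a4" "w = Quad b1 b2 b3 b4"
    by (meson quad.exhaust)
  then show "gen_act g (v + w) = gen_act g v + gen_act g w" "gen_act g (c *\<^sub>C v) = c *\<^sub>C gen_act g v"
    by (cases g; simp add: quad_simps algebra_simps add_divide_distrib)+
qed

lemma gen_act_relators:
  assumes "r \<in> suq2_relators q"
  shows "free_act gen_act v r = 0"
proof -
  obtain a b c g where v: "v = Quad a b c g" by (meson quad.exhaust)
  note act = cbilinear_diff[OF cbilinear_free_act[of gen_act, OF clinear_gen_act]]
    cbilinearD[OF cbilinear_free_act[of gen_act, OF clinear_gen_act]] free_act_mult[of gen_act, OF clinear_gen_act]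
    free_act_gen free_act_one
  have "\<forall>r\<in>suq2_relators q. free_act gen_act (Quad a b c g) r = 0"
    unfolding suq2_relators_def Let_def 
    by (simp add: act quad_simps sg_square \<nu>_def)
      (use sign k_nonzero(1) in \<open>auto simp: field_simps power2_eq_square\<close>)
  then show ?thesis using assms v by blast
qed

definition qact :: "quad \<Rightarrow> 'a \<Rightarrow> quad"
  where "qact = (SOME act. cbilinear act \<and> (\<forall>v. act v 1 = v) \<and> (\<forall>v a b. act v (a * b) = act (act v a) b)
    \<and> (\<forall>v g. act v (gen g) = gen_act g v))"

lemma cbilinear_qact: "cbilinear qact"
  and qact_one: "qact v 1 = v"
  and qact_mult: "qact v (a * b) = qact (qact v a) b"
  and qact_gen: "qact v \<alpha> = gen_act Alpha v" "qact v (star \<alpha>) = gen_act AlphaStar v"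
    "qact v \<gamma> = gen_act Gamma v" "qact v (star \<gamma>) = gen_act GammaStar v"
proof -
  obtain act where act: "cbilinear act" "\<And>v. act v 1 = v" "\<And>v a b. act v (a * b) = act (act v a) b"
    "\<And>v g. act v (gen g) = gen_act g v"
    using presented_module[where \<rho> = gen_act, OF presentation clinear_gen_act gen_act_relators] by blast
  then have ex: "\<exists>act. cbilinear act \<and> (\<forall>v. act v 1 = v) \<and> (\<forall>v a b. act v (a * b) = act (act v a) b)
    \<and> (\<forall>v g. act v (gen g) = gen_act g v)" by blast
  note * = someI_ex[OF ex, folded qact_def]
  then show "cbilinear qact" "qact v 1 = v" "qact v (a * b) = qact (qact v a) b" by blast+
  have "qact v (gen g) = gen_act g v" for g using * by blast
  from this[of Alpha] this[of AlphaStar] this[of Gamma] this[of GammaStar]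
  show "qact v \<alpha> = gen_act Alpha v" "qact v (star \<alpha>) = gen_act AlphaStar v"
    "qact v \<gamma> = gen_act Gamma v" "qact v (star \<gamma>) = gen_act GammaStar v" by simp_all
qed

lemmas qact_simps = cbilinearD[OF cbilinear_qact] cbilinear_diff[OF cbilinear_qact]
  cbilinear_sum[OF cbilinear_qact]

definition \<chi> :: "'a \<Rightarrow> quad"
  where "\<chi> a = qact (Quad 1 0 0 0) a - \<epsilon> a *\<^sub>C Quad 1 0 0 0"

lemma clinear_\<chi>: "clinear \<chi>"
  by (rule clinearI) (simp_all add: \<chi>_def qact_simps counit_simps scaleC_distribs scaleC_complex_def algebra_simps)

lemmas \<chi>_simps = clinearD[OF clinear_\<chi>]

lemma \<chi>_one: "\<chi> 1 = 0"
  by (simp add: \<chi>_def qact_one counit_one scaleC_one)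

text \<open>A cocycle identity: if \<epsilon> and \<chi> vanish at g, then \<chi> vanishes at every
  g x. Nine generators therefore suffice for the whole right ideal.\<close>

lemma \<chi>_mult: "\<chi> (a * b) = qact (\<chi> a) b + \<epsilon> a *\<^sub>C \<chi> b"
  by (simp add: \<chi>_def qact_mult qact_simps counit_mult scaleC_distribs)

lemma \<chi>_gen: "\<chi> \<alpha> = Quad (sg * k - 1) 0 0 (- sg * \<nu>)" "\<chi> (star \<alpha>) = Quad (sg / k - 1) 0 0 (sg * k\<^sup>2 * \<nu>)"
  "\<chi> \<gamma> = Quad 0 1 0 0" "\<chi> (star \<gamma>) = Quad 0 0 1 0"
  by (simp_all add: \<chi>_def qact_gen counit_generators quad_simps)

text \<open>The eigenvalue of k^2 \<alpha> + \<open>star \<alpha>\<close> on \<theta>, which exists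
  because z acts on \<theta> by zero, minus the counit of that element.\<close>

definition c\<^sub>0 :: complex where "c\<^sub>0 = sg * (k ^ 3 + 1 / k) - (1 + k\<^sup>2)"

text \<open>The factorisation over the reals leaves only the root s q = 1, excluded by |q| < 1.
  Without this \<theta> could not be recovered from the values of \<chi> on the generators.\<close>

lemma c\<^sub>0_nonzero: "c\<^sub>0 \<noteq> 0"
proof -
  have pos: "0 < x\<^sup>2 + x + 1" for x :: real
  proof -
    have "x\<^sup>2 + x + 1 = (x + 1 / 2)\<^sup>2 + 3 / 4" by (simp add: power2_eq_square field_simps)
    then show ?thesis by (simp add: add_nonneg_pos)
  qed
  have fact: "c\<^sub>0 * k = complex_of_real (s * (1 - s * q)\<^sup>2 * ((s * q)\<^sup>2 + s * q + 1))"
    using sign k_nonzero(1) by (auto simp: c\<^sub>0_def field_simps power2_eq_square power3_eq_cube)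
  have "s * q \<noteq> 1" using sign q_range by auto
  then have "s * (1 - s * q)\<^sup>2 * ((s * q)\<^sup>2 + s * q + 1) \<noteq> 0" using pos[of "s * q"] sign by auto
  then have "c\<^sub>0 * k \<noteq> 0" unfolding fact of_real_eq_0_iff .
  then show ?thesis by auto
qed

lemma quad_decomp:
  "Quad 1 0 0 0 = (1 / c\<^sub>0) *\<^sub>C (k\<^sup>2 *\<^sub>C \<chi> \<alpha> + \<chi> (star \<alpha>))"
  "Quad 0 0 0 1 = (sg / \<nu>) *\<^sub>C ((sg * k - 1) *\<^sub>C Quad 1 0 0 0 - \<chi> \<alpha>)"
proof -
  have "k\<^sup>2 *\<^sub>C \<chi> \<alpha> + \<chi> (star \<alpha>) = Quad c\<^sub>0 0 0 0"
    using k_nonzero(1) by (simp add: \<chi>_gen quad_simps c\<^sub>0_def field_simps power2_eq_square power3_eq_cube)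
  then show "Quad 1 0 0 0 = (1 / c\<^sub>0) *\<^sub>C (k\<^sup>2 *\<^sub>C \<chi> \<alpha> + \<chi> (star \<alpha>))"
    using c\<^sub>0_nonzero by (simp add: quad_simps)
  show "Quad 0 0 0 1 = (sg / \<nu>) *\<^sub>C ((sg * k - 1) *\<^sub>C Quad 1 0 0 0 - \<chi> \<alpha>)"
    using \<nu>_nonzero by (simp add: \<chi>_gen quad_simps sg_square)
qed

text \<open>Four entries for four dimensions: linear identities on \<open>quad\<close> may be tested
  at \<open>\<chi> (u i j)\<close>, where the form is \<omega>(u_ij).\<close>

lemma span_\<chi>_u: "cvs.span (range (\<lambda>(i, j). \<chi> (u i j))) = UNIV"
proof -
  let ?U = "cvs.span (range (\<lambda>(i, j). \<chi> (u i j)))"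
  have u: "\<chi> (u i j) \<in> ?U" for i j by (rule cvs.span_base) auto
  have "\<chi> (star \<gamma>) = (- 1 / k) *\<^sub>C \<chi> (u False True)"
    using k_nonzero by (simp add: u_simps \<chi>_simps scaleC_scaleC scaleC_one)
  then have "\<chi> (star \<gamma>) \<in> ?U" using cvs.span_scale[OF u[of False True], of "- 1 / k"] by simp
  then have gens: "\<chi> \<alpha> \<in> ?U" "\<chi> (star \<alpha>) \<in> ?U" "Quad 0 1 0 0 \<in> ?U" "Quad 0 0 1 0 \<in> ?U"
    using u[of False False] u[of True True] u[of True False]
    by (simp_all only: u_simps \<chi>_gen)
  have \<theta>: "Quad 1 0 0 0 \<in> ?U" unfolding quad_decomp by (intro cvs.span_scale cvs.span_add gens)
  have n: "Quad 0 0 0 1 \<in> ?U" unfolding quad_decomp(2) by (intro cvs.span_scale cvs.span_diff gens \<theta>)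
  have "v \<in> ?U" for v
  proof -
    have "v = coord_\<theta> v *\<^sub>C Quad 1 0 0 0 + coord_e v *\<^sub>C Quad 0 1 0 0 + coord_f v *\<^sub>C Quad 0 0 1 0
        + coord_n v *\<^sub>C Quad 0 0 0 1" by (cases v) (simp add: quad_simps)
    also have "\<dots> \<in> ?U" by (intro cvs.span_scale cvs.span_add gens \<theta> n)
    finally show ?thesis .
  qed
  then show ?thesis by blast
qed

lemma \<chi>_generators:
  assumes "g \<in> four_d_generators q s star \<alpha> \<gamma>"
  shows "\<chi> g = 0"
proof -
  note simps = four_d_generators_def Let_def \<chi>_simps \<chi>_mult \<chi>_gen \<chi>_one qact_simps qact_gen qact_mult qact_one
    counit_simps counit_mult counit_one counit_generators quad_simps scaleC_complex_def
  have "\<forall>g\<in>four_d_generators q s star \<alpha> \<gamma>. \<chi> g = 0"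
    by (simp add: simps power2_eq_square power3_eq_cube \<nu>_def mult_simps)
      (use sign k_nonzero(1) in \<open>auto simp: field_simps\<close>)
  then show ?thesis using assms by blast
qed

lemma generators_in_ideal:
  assumes "g \<in> four_d_generators q s star \<alpha> \<gamma>"
  shows "\<epsilon> g = 0" "\<omega> g = 0"
proof -
  have "g * 1 \<in> right_ideal_generated (four_d_generators q s star \<alpha> \<gamma>)"
    unfolding right_ideal_generated_def using assms by (intro cvs.span_base) blast
  then have "g \<in> calculus_ideal \<Delta> \<epsilon> S lact d" by (simp add: ideal)
  then show "\<epsilon> g = 0" "\<omega> g = 0" by (simp_all add: calculus_ideal_def \<omega>_def)
qed

lemma \<chi>_zero_of_\<omega>_zero:
  assumes "\<epsilon> a = 0" "\<omega> a = 0"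
  shows "\<chi> a = 0"
proof -
  have "a \<in> calculus_ideal \<Delta> \<epsilon> S lact d" using assms by (simp add: calculus_ideal_def \<omega>_def)
  then have a: "a \<in> cvs.span {g * x | g x. g \<in> four_d_generators q s star \<alpha> \<gamma>}"
    by (simp add: ideal right_ideal_generated_def)
  show ?thesis
  proof (rule clinear_eq_on_span[OF clinear_\<chi> _ _ a])
    show "clinear (\<lambda>a. 0)" by (simp add: clinear_iff)
  qed (auto simp: \<chi>_mult \<chi>_generators generators_in_ideal qact_simps)
qed

section \<open>Identification of the invariant forms with the module\<close>

definition \<theta>\<^sub>E :: 'e
  where "\<theta>\<^sub>E = (1 / c\<^sub>0) *\<^sub>C (k\<^sup>2 *\<^sub>C \<omega> \<alpha> + \<omega> (star \<alpha>))"

definition n\<^sub>E :: 'e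
  where "n\<^sub>E = (sg / \<nu>) *\<^sub>C ((sg * k - 1) *\<^sub>C \<theta>\<^sub>E - \<omega> \<alpha>)"

text \<open>\<open>L\<close> is determined by \<open>\<omega> = L \<circ> \<chi>\<close>; the coefficients come from \<open>quad_decomp\<close>.\<close>

definition L :: "quad \<Rightarrow> 'e"
  where "L v = coord_\<theta> v *\<^sub>C \<theta>\<^sub>E + coord_e v *\<^sub>C \<omega> \<gamma> + coord_f v *\<^sub>C \<omega> (star \<gamma>) + coord_n v *\<^sub>C n\<^sub>E"

lemma clinear_L: "clinear L"
  by (rule clinearI) (simp_all add: L_def quad_simps scaleC_distribs algebra_simps)

lemmas L_simps = clinearD[OF clinear_L]

lemma L_\<chi>_gen: "\<omega> \<gamma> = L (\<chi> \<gamma>)" "\<omega> (star \<gamma>) = L (\<chi> (star \<gamma>))" "\<omega> \<alpha> = L (\<chi> \<alpha>)" "\<omega> (star \<alpha>) = L (\<chi> (star \<alpha>))"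
proof -
  have star: "\<omega> (star \<alpha>) = c\<^sub>0 *\<^sub>C \<theta>\<^sub>E - k\<^sup>2 *\<^sub>C \<omega> \<alpha>"
    using c\<^sub>0_nonzero by (simp add: \<theta>\<^sub>E_def scaleC_scaleC scaleC_one)
  have L: "L (Quad a 0 0 g) = (a + g * (sg / \<nu>) * (sg * k - 1)) *\<^sub>C \<theta>\<^sub>E - (g * (sg / \<nu>)) *\<^sub>C \<omega> \<alpha>" for a g
    by (simp add: L_def n\<^sub>E_def scaleC_distribs right_diff_distrib diff_divide_distrib mult.assoc)
  show "\<omega> \<gamma> = L (\<chi> \<gamma>)" "\<omega> (star \<gamma>) = L (\<chi> (star \<gamma>))"
    by (simp_all add: \<chi>_gen L_def scaleC_one)
  have 1: "sg * k - 1 + (- sg * \<nu>) * (sg / \<nu>) * (sg * k - 1) = 0" "(- sg * \<nu>) * (sg / \<nu>) = - 1"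
    using \<nu>_nonzero by (simp_all add: sg_square)
  show "\<omega> \<alpha> = L (\<chi> \<alpha>)" unfolding \<chi>_gen L 1 by (simp add: scaleC_one)
  have 2: "sg * k\<^sup>2 * \<nu> * (sg / \<nu>) = k\<^sup>2" using \<nu>_nonzero sg_square(1) by simp
  have 3: "sg / k - 1 + k\<^sup>2 * (sg * k - 1) = c\<^sub>0"
    by (simp add: c\<^sub>0_def algebra_simps power2_eq_square power3_eq_cube)
  show "\<omega> (star \<alpha>) = L (\<chi> (star \<alpha>))" unfolding \<chi>_gen L 2 3 star ..
qed

text \<open>The defect \<open>N\<close> vanishes at 1, at the algebra generators and at the nine
  generators of the ideal. Together with the relations of the algebra these conditions annihilate
  every quadratic monomial.\<close>

lemma \<omega>_eq_L_\<chi>_products: "\<omega> (u i j * u m n) = L (\<chi> (u i j * u m n))"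
proof -
  define N where "N a = \<omega> a - L (\<chi> a)" for a
  have N: "clinear N"
    by (rule clinearI) (simp_all add: N_def \<omega>_simps L_simps \<chi>_simps scaleC_distribs)
  have N_one: "N 1 = 0" and N_gen: "N \<alpha> = 0" "N (star \<alpha>) = 0" "N \<gamma> = 0" "N (star \<gamma>) = 0"
    by (simp_all add: N_def \<omega>_one \<chi>_one L_\<chi>_gen L_simps)
  have N_generators: "\<forall>g\<in>four_d_generators q s star \<alpha> \<gamma>. N g = 0"
    by (simp add: N_def generators_in_ideal \<chi>_generators L_simps)
  let ?\<kappa> = "sg * (k ^ 3 + 1 / k)"
  have rel_star: "star \<alpha> * \<gamma> = (1 / k) *\<^sub>C (\<gamma> * star \<alpha>)" "star \<alpha> * star \<gamma> = (1 / k) *\<^sub>C (star \<gamma> * star \<alpha>)"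
    using k_nonzero(1) by (simp_all add: relations scaleC_scaleC scaleC_one)
  have N1: "N (\<gamma> * \<gamma>) = 0" "N (star \<gamma> * star \<gamma>) = 0"
    using N_generators by (simp_all add: four_d_generators_def Let_def power2_eq_square)
  have "N (\<gamma> * (\<alpha> - star \<alpha>)) = 0" "N (star \<gamma> * (\<alpha> - star \<alpha>)) = 0"
    using N_generators by (simp_all add: four_d_generators_def Let_def)
  then have N2: "N (\<gamma> * star \<alpha>) = N (\<gamma> * \<alpha>)" "N (star \<gamma> * star \<alpha>) = N (star \<gamma> * \<alpha>)"
    by (simp_all add: right_diff_distrib clinearD[OF N])
  \<comment> \<open>Moving \<alpha> and \<open>star \<alpha>\<close> to the right contributes
    factors k and 1/k, and \<open>N2\<close> identifies the two resulting values. The remaining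
    scalar k^3 + 1/k is nonzero because q^4 + 1 > 0.\<close>
  have "N ((k\<^sup>2 *\<^sub>C \<alpha> + star \<alpha> - ?\<kappa> *\<^sub>C 1) * \<gamma>) = 0" "N ((k\<^sup>2 *\<^sub>C \<alpha> + star \<alpha> - ?\<kappa> *\<^sub>C 1) * star \<gamma>) = 0"
    using N_generators by (simp_all add: four_d_generators_def Let_def)
  then have "(k\<^sup>2 * k + 1 / k) *\<^sub>C N (\<gamma> * \<alpha>) = 0" "(k\<^sup>2 * k + 1 / k) *\<^sub>C N (star \<gamma> * \<alpha>) = 0"
    by (simp_all add: mult_simps clinearD[OF N] N_gen rel_star N2 relations(4,5) scaleC_distribs)
  moreover have "k\<^sup>2 * k + 1 / k \<noteq> 0"
  proof -
    have "(k\<^sup>2 * k + 1 / k) * k = complex_of_real (q ^ 4 + 1)"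
      using k_nonzero(1) by (simp add: field_simps power2_eq_square power4_eq_xxxx)
    moreover have "q ^ 4 + 1 > 0" by (simp add: add_nonneg_pos)
    ultimately show ?thesis by (metis less_irrefl mult_zero_left of_real_eq_0_iff)
  qed
  ultimately have N3: "N (\<gamma> * \<alpha>) = 0" "N (star \<gamma> * \<alpha>) = 0" by simp_all
  then have N4: "N (\<gamma> * star \<alpha>) = 0" "N (star \<gamma> * star \<alpha>) = 0" by (simp_all add: N2)
  text \<open>Modulo the kernel of \<open>N\<close>, the remaining generators are three linear equations in three products.\<close>
  define X Y G where "X = N (\<alpha> * \<alpha>)" "Y = N (star \<alpha> * star \<alpha>)" "G = N (\<gamma> * star \<gamma>)"
  note XYG = X_Y_G_def[symmetric]
  have "N (\<alpha>\<^sup>2 + k\<^sup>2 *\<^sub>C (star \<alpha>)\<^sup>2 - (1 + k\<^sup>2) *\<^sub>C (\<alpha> * star \<alpha> - \<gamma> * star \<gamma>)) = 0"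
    using N_generators by (simp add: four_d_generators_def Let_def)
  then have eq5: "X + k\<^sup>2 *\<^sub>C Y + ((1 + k\<^sup>2) * (1 + k\<^sup>2)) *\<^sub>C G = 0"
    by (simp add: power2_eq_square[of \<alpha>] power2_eq_square[of "star \<alpha>"] mult_simps clinearD[OF N] N_one
        relations(2) XYG scaleC_distribs scaleC_one)
      (simp add: algebra_simps, simp flip: scaleC_add_left)
  have "N ((k\<^sup>2 *\<^sub>C \<alpha> + star \<alpha> - ?\<kappa> *\<^sub>C 1) * (\<alpha> - star \<alpha>)) = 0"
    using N_generators by (simp add: four_d_generators_def Let_def)
  then have eq8: "k\<^sup>2 *\<^sub>C X - Y + (k\<^sup>2 * k\<^sup>2 - 1) *\<^sub>C G = 0"
    by (simp add: mult_simps clinearD[OF N] N_one N_gen relations(1,2) XYG scaleC_distribs scaleC_one)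
      (simp add: algebra_simps)
  have "N ((k\<^sup>2 *\<^sub>C \<alpha> + star \<alpha> - ?\<kappa> *\<^sub>C 1) * (k\<^sup>2 *\<^sub>C \<alpha> + star \<alpha> - (1 + k\<^sup>2) *\<^sub>C 1)) = 0"
    using N_generators by (simp add: four_d_generators_def Let_def)
  then have eq9: "(k\<^sup>2 * k\<^sup>2) *\<^sub>C X + Y - (k\<^sup>2 * (1 + k\<^sup>2)) *\<^sub>C G = 0"
    by (simp add: mult_simps clinearD[OF N] N_one N_gen relations(1,2) XYG scaleC_distribs scaleC_one)
      (simp add: algebra_simps)
  \<comment> \<open>Adding \<open>eq8\<close> and \<open>eq9\<close> eliminates \<open>Y\<close>,
    and the common factor 1 + k^2 can be cancelled.\<close>
  have "(1 + k\<^sup>2) *\<^sub>C (k\<^sup>2 *\<^sub>C X - G) = (k\<^sup>2 *\<^sub>C X - Y + (k\<^sup>2 * k\<^sup>2 - 1) *\<^sub>C G)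
      + ((k\<^sup>2 * k\<^sup>2) *\<^sub>C X + Y - (k\<^sup>2 * (1 + k\<^sup>2)) *\<^sub>C G)"
    by (simp add: scaleC_distribs scaleC_one algebra_simps)
  also have "\<dots> = 0" unfolding eq8 eq9 by simp
  finally have G: "G = k\<^sup>2 *\<^sub>C X" using k_nonzero(3) by simp
  have Y: "Y = (k\<^sup>2 * k\<^sup>2 * k\<^sup>2) *\<^sub>C X"
    using eq8 unfolding G by (simp add: scaleC_distribs scaleC_one algebra_simps)
  \<comment> \<open>The coefficient is 1 plus nonnegative terms in the real number q, so it cannot
    vanish.\<close>
  have "(1 + k\<^sup>2 * (k\<^sup>2 * k\<^sup>2 * k\<^sup>2) + (1 + k\<^sup>2) * (1 + k\<^sup>2) * k\<^sup>2) *\<^sub>C X = 0"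
    using eq5 unfolding G Y by (simp add: scaleC_distribs scaleC_one algebra_simps)
  moreover have "1 + k\<^sup>2 * (k\<^sup>2 * k\<^sup>2 * k\<^sup>2) + (1 + k\<^sup>2) * (1 + k\<^sup>2) * k\<^sup>2
      = complex_of_real (1 + (q\<^sup>2 * (q\<^sup>2 * q\<^sup>2 * q\<^sup>2) + (1 + q\<^sup>2) * (1 + q\<^sup>2) * q\<^sup>2))"
    by simp
  moreover have "1 + (q\<^sup>2 * (q\<^sup>2 * q\<^sup>2 * q\<^sup>2) + (1 + q\<^sup>2) * (1 + q\<^sup>2) * q\<^sup>2) > 0"
    by (intro add_pos_nonneg add_nonneg_nonneg mult_nonneg_nonneg) simp_all
  ultimately have X: "X = 0" by (metis less_irrefl of_real_eq_0_iff cvs.scale_eq_0_iff)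
  have N5: "N (\<alpha> * \<alpha>) = 0" "N (star \<alpha> * star \<alpha>) = 0" "N (\<gamma> * star \<gamma>) = 0"
    using X G Y by (simp_all add: X_Y_G_def)
  have "N (u i j * u m n) = 0"
    by (cases i; cases j; cases m; cases n)
      (simp_all add: u_simps mult_simps clinearD[OF N] N_one N1 N3 N4 N5 relations(1-5) rel_star)
  then show ?thesis by (simp add: N_def)
qed

section \<open>Left-invariant forms as a basis\<close>

lemma clinear_eq_\<chi>_u:
  assumes "clinear f" "clinear g" "\<And>i j. f (\<chi> (u i j)) = g (\<chi> (u i j))"
  shows "f v = g v"
  by (rule fun_cong[OF clinear_eq_spanning[OF assms(1,2) span_\<chi>_u]]) (auto simp: assms(3))

lemma \<omega>_u_eq: "\<omega> (u i j) = L (\<chi> (u i j))"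
  by (cases i; cases j) (simp_all add: u_simps \<omega>_simps \<chi>_simps L_simps L_\<chi>_gen)

lemma left_coaction_L: "\<delta>L (L v) = 1 \<otimes>\<^sub>C L v"
  by (rule clinear_eq_\<chi>_u[where f = "\<lambda>v. \<delta>L (L v)" and g = "\<lambda>v. 1 \<otimes>\<^sub>C L v"])
    (simp_all add: clinear_compose[OF clinear_left_coaction clinear_L]
      clinear_compose[OF cbilinear_clinear_right[OF cbilinear_tensor_pure] clinear_L]
      left_coaction_\<omega>_u flip: \<omega>_u_eq)

text \<open>The commutation rule, extended by linearity to all invariant forms; the abstract right
  action on forms has become the explicit action \<open>qact\<close>.\<close>

lemma L_right_mult_u: "ract (L v) (u a n) = (\<Sum>m\<in>UNIV. lact (u a m) (L (qact v (u m n))))"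
proof (rule clinear_eq_\<chi>_u[where f = "\<lambda>v. ract (L v) (u a n)"])
  show "clinear (\<lambda>v. ract (L v) (u a n))" "clinear (\<lambda>v. \<Sum>m\<in>UNIV. lact (u a m) (L (qact v (u m n))))"
    by (rule clinearI;
      simp add: L_simps ract_simps lact_simps qact_simps sum.distrib cvs.scale_sum_right)+
  show "ract (L (\<chi> (u i j))) (u a n) = (\<Sum>m\<in>UNIV. lact (u a m) (L (qact (\<chi> (u i j)) (u m n))))" for i j
    unfolding \<omega>_u_eq[of i j, symmetric] \<omega>_u_right_mult
    by (simp add: \<omega>_eq_L_\<chi>_products \<omega>_u_eq \<chi>_mult counit_u L_simps scaleC_one)
qed

text \<open>The entries of S(u) are multiples of entries of u, so this is
  \<open>L_right_mult_u\<close> again; the indices run the other way because the antipode reverses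
  coproducts.\<close>

lemma L_right_mult_antipode:
  "ract (L v) (S (u i j)) = (\<Sum>m\<in>UNIV. lact (S (u m j)) (L (qact v (S (u i m)))))"
proof -
  note mult = L_right_mult_u[of v False False] L_right_mult_u[of v False True]
    L_right_mult_u[of v True False] L_right_mult_u[of v True True]
  have "ract (L v) (star \<gamma>) = lact (star \<gamma>) (L (qact v (star \<alpha>))) + lact \<alpha> (L (qact v (star \<gamma>)))"
  proof -
    have "star \<gamma> = (- 1 / k) *\<^sub>C u False True"
      using k_nonzero by (simp add: u_simps scaleC_scaleC scaleC_one)
    then have "ract (L v) (star \<gamma>) = (- 1 / k) *\<^sub>C ract (L v) (u False True)"
      by (simp add: ract_simps)
    also have "\<dots> = (- 1 / k) *\<^sub>C (- (k *\<^sub>C lact (star \<gamma>) (L (qact v (star \<alpha>))))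
        - k *\<^sub>C lact \<alpha> (L (qact v (star \<gamma>))))"
      unfolding L_right_mult_u by (simp add: sum_UNIV_bool u_simps lact_simps qact_simps L_simps)
    also have "\<dots> = lact (star \<gamma>) (L (qact v (star \<alpha>))) + lact \<alpha> (L (qact v (star \<gamma>)))"
      using k_nonzero by (simp add: scaleC_distribs scaleC_one)
    finally show ?thesis .
  qed
  with mult show ?thesis
    unfolding antipode_u
    by (cases i; cases j) (simp_all add: sum_UNIV_bool u_simps ract_simps lact_simps
        qact_simps L_simps scaleC_distribs scaleC_scaleC mult.commute)
qed

text \<open>The span is a left submodule, and the commutation rule makes it stable under right
  multiplication by generators. Leibniz induction on words, removing the last letter, then places
  every differential in it.\<close>

lemma span_lact_L: "cvs.span {lact a (L v) | a v. True} = UNIV"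
proof -
  let ?U = "cvs.span {lact a (L v) | a v. True}"
  have lact: "lact b x \<in> ?U" if "x \<in> ?U" for b x
    using that
  proof (induction rule: cvs.span_induct_alt)
    case (step c x y)
    then obtain a v where "x = lact a (L v)" by blast
    then have "lact b (c *\<^sub>C x + y) = c *\<^sub>C lact (b * a) (L v) + lact b y"
      by (simp add: lact_simps lact_mult)
    also have "\<dots> \<in> ?U" using step(2) by (intro cvs.span_add cvs.span_scale) (auto intro: cvs.span_base)
    finally show ?case .
  qed (simp add: lact_simps cvs.span_zero)
  have L: "L v \<in> ?U" for v
  proof -
    have "lact 1 (L v) \<in> ?U" by (rule cvs.span_base) blast
    then show ?thesis by (simp only: lact_one)
  qed
  have ract_u: "ract x (u i j) \<in> ?U" if "x \<in> ?U" for x i j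
    using that
  proof (induction rule: cvs.span_induct_alt)
    case (step c x y)
    then obtain a v where "x = lact a (L v)" by blast
    then have "ract (c *\<^sub>C x + y) (u i j) = c *\<^sub>C lact a (ract (L v) (u i j)) + ract y (u i j)"
      by (simp add: ract_simps lact_ract)
    also have "\<dots> \<in> ?U"
      unfolding L_right_mult_u by (intro cvs.span_add cvs.span_scale lact cvs.span_sum L step(2))
    finally show ?case .
  qed (simp add: ract_simps cvs.span_zero)
  have gen_u: "\<exists>c i j. gen g = c *\<^sub>C u i j" for g
  proof (cases g)
    case Alpha
    then show ?thesis by (intro exI[of _ 1] exI[of _ False]) (simp add: u_simps scaleC_one)
  next
    case AlphaStar
    then show ?thesis by (intro exI[of _ 1] exI[of _ True]) (simp add: u_simps scaleC_one)
  next
    case Gamma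
    then show ?thesis
      by (intro exI[of _ 1] exI[of _ True] exI[of _ False]) (simp add: u_simps scaleC_one)
  next
    case GammaStar
    then show ?thesis using k_nonzero
      by (intro exI[of _ "- 1 / k"] exI[of _ False] exI[of _ True]) (simp add: u_simps scaleC_scaleC scaleC_one)
  qed
  have d_gen: "d (gen g) \<in> ?U" for g
  proof -
    obtain c i j where g: "gen g = c *\<^sub>C u i j" using gen_u by blast
    show ?thesis
      unfolding g d_simps d_u \<omega>_u_eq by (intro cvs.span_scale cvs.span_sum lact L)
  qed
  have ract_gen: "ract x (gen g) \<in> ?U" if "x \<in> ?U" for x g
  proof -
    obtain c i j where g: "gen g = c *\<^sub>C u i j" using gen_u by blast
    show ?thesis unfolding g ract_simps by (intro cvs.span_scale ract_u that)
  qed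
  have d_word: "d (prod_list (map gen ws)) \<in> ?U" for ws
  proof (induction ws rule: rev_induct)
    case (snoc g ws)
    have "d (prod_list (map gen (ws @ [g])))
        = ract (d (prod_list (map gen ws))) (gen g) + lact (prod_list (map gen ws)) (d (gen g))"
      by (simp add: d_mult)
    also have "\<dots> \<in> ?U" by (intro cvs.span_add ract_gen snoc lact d_gen)
    finally show ?case .
  qed (simp add: d_one cvs.span_zero)
  have d: "d a \<in> ?U" for a
  proof -
    have "a \<in> cvs.span (range (\<lambda>ws. prod_list (map gen ws)))"
      unfolding presented_by_span[OF presentation] by (rule UNIV_I)
    then show ?thesis
    proof (induction rule: cvs.span_induct_alt)
      case (step c x y)
      then obtain ws where "x = prod_list (map gen ws)" by blast
      then show ?case unfolding d_simps using d_word step(2) by (auto intro: cvs.span_add cvs.span_scale)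
    qed (simp add: d_simps cvs.span_zero)
  qed
  have "{lact a (d b) | a b. True} \<subseteq> ?U" using lact[OF d] by blast
  then have "cvs.span {lact a (d b) | a b. True} \<subseteq> ?U"
    by (rule cvs.span_minimal[OF _ cvs.subspace_span])
  then show ?thesis unfolding d_spans by blast
qed

text \<open>Injectivity of \<open>L\<close> uses that the ideal of the calculus is no larger than
  the given one: v is \<chi>(a) for some a in the span of the matrix entries, and L v = 0 means
  \<omega>(a) = 0.\<close>

lemma L_inverse:
  obtains G where "clinear G" "\<And>v. G (L v) = v"
proof -
  interpret pair: vector_space_pair "scaleC :: complex \<Rightarrow> quad \<Rightarrow> quad" "scaleC :: complex \<Rightarrow> 'e \<Rightarrow> 'e"
    by unfold_locales
  have "v = 0" if "L v = 0" for v
  proof -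
    have *: "\<omega> a = L (\<chi> a)" if "a \<in> cvs.span (range (\<lambda>(i, j). u i j))" for a
      by (rule clinear_eq_on_span[OF clinear_\<omega> clinear_compose[OF clinear_L clinear_\<chi>] _ that])
        (auto simp: \<omega>_u_eq)
    have "v \<in> cvs.span (range (\<lambda>(i, j). \<chi> (u i j)))" unfolding span_\<chi>_u by (rule UNIV_I)
    then have "\<exists>a\<in>cvs.span (range (\<lambda>(i, j). u i j)). v = \<chi> a"
    proof (induction rule: cvs.span_induct_alt)
      case base
      show ?case using \<chi>_simps(3) cvs.span_zero by (intro bexI[of _ 0]) auto
    next
      case (step c x y)
      then obtain a i j where "a \<in> cvs.span (range (\<lambda>(i, j). u i j))" "y = \<chi> a" "x = \<chi> (u i j)" by auto
      moreover have "u i j \<in> cvs.span (range (\<lambda>(i, j). u i j))" by (rule cvs.span_base) force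
      ultimately show ?case
        by (intro bexI[of _ "c *\<^sub>C u i j + a"] cvs.span_add cvs.span_scale)
          (simp_all only: \<chi>_simps)
    qed
    then obtain a where a: "a \<in> cvs.span (range (\<lambda>(i, j). u i j))" "v = \<chi> a" by blast
    \<comment> \<open>Subtracting \<epsilon>(a) 1 moves a into the kernel of \<epsilon> and changes
      neither \<omega> nor \<chi>.\<close>
    have "\<omega> (a - \<epsilon> a *\<^sub>C 1) = 0" using *[OF a(1)] that by (simp add: \<omega>_simps \<omega>_one a(2))
    moreover have "\<epsilon> (a - \<epsilon> a *\<^sub>C 1) = 0" by (simp add: counit_simps counit_one scaleC_complex_def)
    ultimately have "\<chi> (a - \<epsilon> a *\<^sub>C 1) = 0" using \<chi>_zero_of_\<omega>_zero by blast
    then show ?thesis by (simp add: \<chi>_simps \<chi>_one a(2))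
  qed
  then have "inj L"
    by (intro injI) (metis L_simps(5) right_minus_eq)
  then obtain G where "clinear G" "G \<circ> L = id"
    using pair.linear_injective_left_inverse[OF clinear_L] by blast
  then show thesis using that by (metis comp_apply id_apply)
qed

text \<open>The projection onto the left-invariant forms.\<close>

definition P :: "'e \<Rightarrow> 'e"
  where "P e = tensor_lift (\<lambda>x y. lact (S x) y) (\<delta>L e)"

lemma clinear_P: "clinear P"
  unfolding P_def by (rule clinear_compose[OF clinear_tensor_lift[OF cbilinear_antipode_lact(1)] clinear_left_coaction])

lemma P_lact_L: "P (lact a (L v)) = \<epsilon> a *\<^sub>C L v"
proof -
  have "tensor_lift (\<lambda>x y. lact (S x) y) (tensor_prod (*) lact t (1 \<otimes>\<^sub>C L v))
      = lact (tensor_lift (\<lambda>x y. S x * y) t) (L v)" for t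
    by (induction t rule: tensor_induct)
      (simp_all add: left_prod_pure tensor_lift_simps cbilinear_antipode_lact cbilinear_antipode_mult
        lact_mult lact_simps cbilinearD[OF left_prod_bilinear])
  then show ?thesis
    by (simp add: P_def left_coaction_lact left_coaction_L antipode_left lact_simps lact_one)
qed

text \<open>Freeness of the calculus as a left module. The coaction sends a L(v) to a_1 \<otimes>
  a_2 L(v); projecting the second leg to its invariant part turns a_2 into \<epsilon>(a_2), and the
  counit axiom returns a \<otimes> v.\<close>

lemma coordinates:
  obtains C G where "clinear C" "\<And>a v. C (lact a (L v)) = a \<otimes>\<^sub>C v"
    "clinear G" "\<And>v. G (L v) = v"
proof -
  obtain G where G: "clinear G" "\<And>v. G (L v) = v" by (rule L_inverse) blast
  let ?T = "tensor_map (\<lambda>x. x) (\<lambda>e. G (P e)) :: ('a, 'e) tensor \<Rightarrow> ('a, quad) tensor"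
  note GP = clinear_compose[OF G(1) clinear_P]
  have bil: "cbilinear (\<lambda>x y. \<epsilon> y *\<^sub>C (x :: 'a))"
    using cbilinear_compose[OF cbilinear_scaleC counit_linear clinear_id(1)] by (simp add: cbilinear_def)
  have "?T (tensor_prod (*) lact t (1 \<otimes>\<^sub>C L v)) = tensor_lift (\<lambda>x y. \<epsilon> y *\<^sub>C x) t \<otimes>\<^sub>C v" for t v
    by (induction t rule: tensor_induct)
      (simp_all add: left_prod_pure tensor_map_pure[OF clinear_id(1) GP] P_lact_L clinearD[OF G(1)] G(2)
        clinearD[OF clinear_tensor_map[OF clinear_id(1) GP]] tensor_lift_simps bil pure_simps
        cbilinearD[OF left_prod_bilinear])
  then have "?T (\<delta>L (lact a (L v))) = a \<otimes>\<^sub>C v" for a v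
    by (simp add: left_coaction_lact left_coaction_L counit_right)
  then show thesis
    using that[of "\<lambda>e. ?T (\<delta>L e)" G] G
      clinear_compose[OF clinear_tensor_map[OF clinear_id(1) GP] clinear_left_coaction] by blast
qed

end

section \<open>The bimodule tensor square\<close>

locale four_d_braided = four_d \<Delta> \<epsilon> S star q \<alpha> \<gamma> lact ract d s
  for \<Delta> :: "'a::complex_algebra_1 \<Rightarrow> ('a, 'a) tensor"
    and \<epsilon> :: "'a \<Rightarrow> complex"
    and S star :: "'a \<Rightarrow> 'a"
    and q :: real
    and \<alpha> \<gamma> :: 'a
    and lact :: "'a \<Rightarrow> 'e::complex_vector \<Rightarrow> 'e"
    and ract :: "'e \<Rightarrow> 'a \<Rightarrow> 'e"
    and d :: "'a \<Rightarrow> 'e"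
    and s :: real +
  fixes bt :: "'e \<Rightarrow> 'e \<Rightarrow> 't::complex_vector" and \<sigma> :: "'t \<Rightarrow> 't"
  assumes square: "tensor_over_algebra lact ract bt"
    and braiding: "is_braiding lact ract (left_coaction \<Delta> lact d) (right_coaction \<Delta> lact d) bt \<sigma>"
begin

lemma bt_bilinear: "cbilinear bt" and span_bt: "cvs.span {bt x y | x y. True} = UNIV"
  using square span_bilinear_iff_surj by (auto simp: tensor_over_algebra_def)

lemma bt_kernel:
  "tensor_lift bt t = 0 \<longleftrightarrow> t \<in> cvs.span {ract x a \<otimes>\<^sub>C y - x \<otimes>\<^sub>C lact a y | x a y. True}"
  using square by (auto simp: tensor_over_algebra_def)

lemmas bt_simps = cbilinearD[OF bt_bilinear] cbilinear_diff[OF bt_bilinear] cbilinear_sum[OF bt_bilinear]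

lemma bt_balanced: "bt (ract x a) y = bt x (lact a y)"
proof -
  have "tensor_lift bt (ract x a \<otimes>\<^sub>C y - x \<otimes>\<^sub>C lact a y) = 0"
    unfolding bt_kernel by (rule cvs.span_base) blast
  then show ?thesis by (simp add: tensor_lift_simps bt_bilinear)
qed

lemma balanced_kernel:
  assumes G: "cbilinear G" "\<And>x a y. G (ract x a) y = G x (lact a y)" and t: "tensor_lift bt t = 0"
  shows "tensor_lift G t = 0"
proof (rule clinear_eq_on_span[OF clinear_tensor_lift[OF G(1)] _ _ t[unfolded bt_kernel]])
  show "clinear (\<lambda>t. 0)" by (simp add: clinear_iff)
qed (auto simp: tensor_lift_simps G)

lemmas clinear_the_balanced = clinear_the_induced[OF bt_bilinear _ span_bt balanced_kernel]

lemma square_eqI: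
  assumes "clinear f" "clinear g" "\<And>x y. f (bt x y) = g (bt x y)"
  shows "f t = g t"
  by (rule fun_cong[OF clinear_eq_spanning[OF assms(1,2) span_bt]]) (use assms(3) in auto)

abbreviation "sqL \<equiv> square_lact lact bt"
abbreviation "sqR \<equiv> square_ract ract bt"
abbreviation "\<delta>\<^sub>2 \<equiv> square_left_coaction \<delta>L bt"

lemma clinear_square_lact: "clinear (sqL a)" and square_lact_bt: "sqL a (bt x y) = bt (lact a x) y"
proof -
  let ?G = "\<lambda>x y. bt (lact a x) y"
  have G: "cbilinear ?G"
    by (rule cbilinear_compose[OF bt_bilinear cbilinear_clinear_right[OF lact_bilinear] clinear_id(1)])
  have bal: "?G (ract x b) y = ?G x (lact b y)" for x b y
    by (simp add: bt_balanced flip: lact_ract)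
  show "clinear (sqL a)" "sqL a (bt x y) = bt (lact a x) y"
    unfolding square_lact_def by (rule clinear_the_balanced[OF G G bal], assumption)+
qed

lemma clinear_square_ract: "clinear (\<lambda>t. sqR t a)" and square_ract_bt: "sqR (bt x y) a = bt x (ract y a)"
proof -
  let ?G = "\<lambda>x y. bt x (ract y a)"
  have G: "cbilinear ?G"
    by (rule cbilinear_compose[OF bt_bilinear clinear_id(1) cbilinear_clinear_left[OF ract_bilinear]])
  have bal: "?G (ract x b) y = ?G x (lact b y)" for x b y
    by (simp add: bt_balanced lact_ract)
  show "clinear (\<lambda>t. sqR t a)" "sqR (bt x y) a = bt x (ract y a)"
    unfolding square_ract_def by (rule clinear_the_balanced[OF G G bal], assumption)+
qed

lemmas left_prod_bt_bilinear = cbilinear_tensor_prod[OF cbilinear_mult bt_bilinear]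
lemmas left_prod_bt_pure = tensor_prod_pure[OF cbilinear_mult bt_bilinear]

lemma clinear_square_left_coaction: "clinear \<delta>\<^sub>2"
  and square_left_coaction_bt: "\<delta>\<^sub>2 (bt x y) = tensor_prod (*) bt (\<delta>L x) (\<delta>L y)"
proof -
  let ?G = "\<lambda>x y. tensor_prod (*) bt (\<delta>L x) (\<delta>L y)"
  have G: "cbilinear ?G"
    by (rule cbilinear_compose[OF left_prod_bt_bilinear clinear_left_coaction clinear_left_coaction])
  have bal: "?G (ract x b) y = ?G x (lact b y)" for x b y
    unfolding left_coaction_ract left_coaction_lact
    by (rule tensor_prod_assoc)
      (simp_all add: cbilinear_mult bt_bilinear lact_bilinear ract_bilinear mult.assoc bt_balanced)
  show "clinear \<delta>\<^sub>2" "\<delta>\<^sub>2 (bt x y) = tensor_prod (*) bt (\<delta>L x) (\<delta>L y)"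
    unfolding square_left_coaction_def by (rule clinear_the_balanced[OF G G bal], assumption)+
qed

lemma cbilinear_square_lact: "cbilinear sqL"
proof (rule cbilinearI)
  fix a b :: 'a and t t' :: 't and c :: complex
  show "sqL a (t + t') = sqL a t + sqL a t'" "sqL a (c *\<^sub>C t) = c *\<^sub>C sqL a t"
    by (simp_all add: clinearD[OF clinear_square_lact])
  show "sqL (a + b) t = sqL a t + sqL b t"
    by (rule square_eqI[OF clinear_square_lact clinear_plus[OF clinear_square_lact clinear_square_lact]])
      (simp add: square_lact_bt lact_simps bt_simps)
  show "sqL (c *\<^sub>C a) t = c *\<^sub>C sqL a t"
    by (rule square_eqI[OF clinear_square_lact clinear_scaleC[OF clinear_square_lact]])
      (simp add: square_lact_bt lact_simps bt_simps)
qed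

section \<open>Left-invariant elements of the square\<close>

definition B :: "quad \<Rightarrow> quad \<Rightarrow> 't"
  where "B v w = bt (L v) (L w)"

lemma B_bilinear: "cbilinear B"
  unfolding B_def by (rule cbilinear_compose[OF bt_bilinear clinear_L clinear_L])

lemmas B_simps = cbilinearD[OF B_bilinear] cbilinear_diff[OF B_bilinear]

text \<open>The coefficient of the second factor is balanced across into the first, which is then
  expanded again.\<close>

lemma span_square: "cvs.span {sqL a (B v w) | a v w. True} = UNIV"
proof -
  let ?U = "cvs.span {sqL a (B v w) | a v w. True}"
  have 1: "bt x (L w) \<in> ?U" for x w
  proof -
    have "x \<in> cvs.span {lact a (L v) | a v. True}" unfolding span_lact_L by (rule UNIV_I)
    then show ?thesis
    proof (induction rule: cvs.span_induct_alt)
      case (step c x y)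
      then obtain a v where "x = lact a (L v)" by blast
      then have "bt (c *\<^sub>C x + y) (L w) = c *\<^sub>C sqL a (B v w) + bt y (L w)"
        by (simp add: bt_simps B_def square_lact_bt)
      also have "\<dots> \<in> ?U" by (intro cvs.span_add cvs.span_scale step(2) cvs.span_base) blast
      finally show ?case .
    qed (simp add: bt_simps cvs.span_zero)
  qed
  have 2: "bt x y \<in> ?U" for x y
  proof -
    have "y \<in> cvs.span {lact a (L v) | a v. True}" unfolding span_lact_L by (rule UNIV_I)
    then show ?thesis
    proof (induction rule: cvs.span_induct_alt)
      case (step c y z)
      then obtain a v where "y = lact a (L v)" by blast
      then have "bt x (c *\<^sub>C y + z) = c *\<^sub>C bt (ract x a) (L v) + bt x z"
        by (simp add: bt_simps bt_balanced)
      also have "\<dots> \<in> ?U" by (intro cvs.span_add cvs.span_scale step(2) 1)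
      finally show ?case .
    qed (simp add: bt_simps cvs.span_zero)
  qed
  then have "{bt x y | x y. True} \<subseteq> ?U" by blast
  then have "cvs.span {bt x y | x y. True} \<subseteq> ?U" by (rule cvs.span_minimal[OF _ cvs.subspace_span])
  then show ?thesis unfolding span_bt by blast
qed

abbreviation "V \<equiv> left_invariant \<delta>\<^sub>2"

text \<open>The map \<open>R\<close> contracts the coaction with the antipode. It fixes every
  left-invariant element and sends a B(v, w) to \<epsilon>(a) B(v, w), so its range lies in the
  span.\<close>

lemma left_invariant_square: "V = cvs.span {B v w | v w. True}"
proof
  have B: "\<delta>\<^sub>2 (B v w) = 1 \<otimes>\<^sub>C B v w" for v w
    by (simp add: B_def square_left_coaction_bt left_coaction_L left_prod_bt_pure)
  show "cvs.span {B v w | v w. True} \<subseteq> V"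
  proof
    fix t assume "t \<in> cvs.span {B v w | v w. True}"
    then have "\<delta>\<^sub>2 t = 1 \<otimes>\<^sub>C t"
      by (rule clinear_eq_on_span[OF clinear_square_left_coaction
            cbilinear_clinear_right[OF cbilinear_tensor_pure], rotated]) (auto simp: B)
    then show "t \<in> V" by (simp add: left_invariant_def)
  qed
  have SsqL: "cbilinear (\<lambda>x t. sqL (S x) t)"
    by (rule cbilinear_compose[OF cbilinear_square_lact antipode_linear clinear_id(1)])
  define R where "R t = tensor_lift (\<lambda>x t. sqL (S x) t) (\<delta>\<^sub>2 t)" for t
  have R: "clinear R"
    unfolding R_def by (rule clinear_compose[OF clinear_tensor_lift[OF SsqL] clinear_square_left_coaction])
  have "tensor_lift (\<lambda>x t. sqL (S x) t) (tensor_prod (*) bt (tensor_prod (*) lact t (1 \<otimes>\<^sub>C L v)) (1 \<otimes>\<^sub>C L w))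
      = bt (lact (tensor_lift (\<lambda>x y. S x * y) t) (L v)) (L w)" for t v w
    by (induction t rule: tensor_induct)
      (simp_all add: left_prod_pure left_prod_bt_pure tensor_lift_simps SsqL cbilinear_antipode_mult
        lact_mult lact_simps bt_simps square_lact_bt cbilinearD[OF left_prod_bilinear]
        cbilinearD[OF left_prod_bt_bilinear])
  then have R_sqL: "R (sqL a (B v w)) = \<epsilon> a *\<^sub>C B v w" for a v w
    by (simp add: R_def B_def square_lact_bt square_left_coaction_bt left_coaction_lact left_coaction_L
        antipode_left lact_simps lact_one bt_simps)
  have R_span: "R t \<in> cvs.span {B v w | v w. True}" for t
  proof -
    have "t \<in> cvs.span {sqL a (B v w) | a v w. True}" unfolding span_square by (rule UNIV_I)
    then show ?thesis
    proof (induction rule: cvs.span_induct_alt)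
      case (step c x y)
      then obtain a v w where x: "x = sqL a (B v w)" by blast
      have "B v w \<in> cvs.span {B v w | v w. True}" by (rule cvs.span_base) blast
      then show ?case
        unfolding clinearD[OF R] x R_sqL by (intro cvs.span_add cvs.span_scale step(2))
    qed (simp add: clinear_zero[OF R] cvs.span_zero)
  qed
  show "V \<subseteq> cvs.span {B v w | v w. True}"
  proof
    fix t assume "t \<in> V"
    then have "R t = sqL 1 t"
      by (simp add: R_def left_invariant_def tensor_lift_pure SsqL antipode_one)
    also have "\<dots> = t"
      by (rule square_eqI[OF clinear_square_lact clinear_id(1)]) (simp add: square_lact_bt lact_one)
    finally show "t \<in> cvs.span {B v w | v w. True}" using R_span[of t] by simp
  qed
qed

text \<open>\<Phi> is induced by x \<otimes> a L(w) \<mapsto> G(P(x a)) \<otimes> w, which is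
  balanced because a is absorbed by x and defined because a L(w) determines a \<otimes> w. It serves
  to show that eigenvectors are nonzero.\<close>

lemma B_independent:
  obtains \<Phi> where "clinear \<Phi>" "\<And>v w. \<Phi> (B v w) = v \<otimes>\<^sub>C w"
proof -
  obtain C G where C: "clinear C" "\<And>a v. C (lact a (L v)) = a \<otimes>\<^sub>C v"
    and G: "clinear G" "\<And>v. G (L v) = v" by (rule coordinates) blast
  define H where "H x = tensor_map (\<lambda>a. G (P (ract x a))) (\<lambda>w::quad. w)" for x
  have lin: "clinear (\<lambda>a. G (P (ract x a)))" for x
    by (intro clinear_compose[OF G(1)] clinear_compose[OF clinear_P] cbilinear_clinear_right[OF ract_bilinear])
  have H_pure: "H x (a \<otimes>\<^sub>C w) = G (P (ract x a)) \<otimes>\<^sub>C w" for x a w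
    unfolding H_def by (rule tensor_map_pure[OF lin clinear_id(1)])
  have H_linear: "clinear (H x)" for x
    unfolding H_def by (rule clinear_tensor_map[OF lin clinear_id(1)])
  have H: "cbilinear H"
  proof (rule cbilinearI)
    fix x x' :: 'e and t t' :: "('a, quad) tensor" and c :: complex
    show "H x (t + t') = H x t + H x t'" "H x (c *\<^sub>C t) = c *\<^sub>C H x t"
      by (simp_all add: clinearD[OF H_linear])
    show "H (x + x') t = H x t + H x' t" "H (c *\<^sub>C x) t = c *\<^sub>C H x t"
      by (induction t rule: tensor_induct)
        (simp_all add: H_pure ract_simps clinearD[OF clinear_P] clinearD[OF G(1)] pure_simps
          clinearD[OF H_linear] scaleC_add_right)
  qed
  let ?G = "\<lambda>x y. H x (C y)"
  have bil: "cbilinear ?G" by (rule cbilinear_compose[OF H clinear_id(1) C(1)])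
  have bal: "?G (ract x a) y = ?G x (lact a y)" for x a y
  proof -
    have "(\<lambda>y. ?G (ract x a) y) = (\<lambda>y. ?G x (lact a y))"
    proof (rule clinear_eq_spanning[OF _ _ span_lact_L])
      show "clinear (\<lambda>y. ?G (ract x a) y)" "clinear (\<lambda>y. ?G x (lact a y))"
        by (intro clinear_compose[OF H_linear] clinear_compose[OF C(1)] cbilinear_clinear_right[OF lact_bilinear] C(1))+
      show "?G (ract x a) y = ?G x (lact a y)" if "y \<in> {lact b (L v) | b v. True}" for y
        using that by (auto simp: C(2) H_pure ract_mult simp flip: lact_mult)
    qed
    then show ?thesis by (rule fun_cong)
  qed
  obtain \<Phi> where \<Phi>: "clinear \<Phi>" "\<And>t. \<Phi> (tensor_lift bt t) = tensor_lift ?G t"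
    using factor_through_surjection[OF clinear_tensor_lift[OF bt_bilinear] _ clinear_tensor_lift[OF bil]
        balanced_kernel[OF bil bal]] span_bt span_bilinear_iff_surj[OF bt_bilinear] by metis
  have "\<Phi> (B v w) = v \<otimes>\<^sub>C w" for v w
  proof -
    have "C (L w) = 1 \<otimes>\<^sub>C w" "P (L v) = L v"
      using C(2)[of 1 w] P_lact_L[of 1 v] by (simp_all add: lact_one counit_one scaleC_one)
    then show ?thesis
      using \<Phi>(2)[of "L v \<otimes>\<^sub>C L w"] by (simp add: B_def tensor_lift_pure bt_bilinear bil H_pure ract_one G(2))
  qed
  then show thesis using that \<Phi>(1) by blast
qed

section \<open>The braiding on left-invariant elements\<close>

lemma clinear_\<sigma>: "clinear \<sigma>"
  and \<sigma>_sqL: "\<sigma> (sqL a t) = sqL a (\<sigma> t)"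
  and \<sigma>_sqR: "\<sigma> (sqR t a) = sqR (\<sigma> t) a"
  and \<sigma>_exchange: "x \<in> left_invariant \<delta>L \<Longrightarrow> y \<in> right_invariant \<delta>R \<Longrightarrow> \<sigma> (bt x y) = bt y x"
  using braiding by (simp_all add: is_braiding_def)

lemmas \<sigma>_simps = clinearD[OF clinear_\<sigma>]

text \<open>Carrying S(u) to the left through the invariant form leaves a left-invariant times a
  right-invariant form between outer coefficients. The bimodule property lets \<sigma> exchange the
  two, and the remaining u is carried back through L.\<close>

lemma \<sigma>_tensor_\<eta>:
  "\<sigma> (bt (L v) (ract (lact (S (u i m)) (\<eta> m n)) (u n j)))
    = (\<Sum>r\<in>UNIV. \<Sum>p\<in>UNIV. bt (ract (lact (S (u r m)) (\<eta> m n)) (u n p)) (L (qact (qact v (S (u i r))) (u p j))))"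
proof -
  have eq: "bt (L v) (ract (lact (S (u i m)) (\<eta> m n)) (u n j))
      = (\<Sum>r\<in>UNIV. sqR (sqL (S (u r m)) (bt (L (qact v (S (u i r)))) (\<eta> m n))) (u n j))"
    by (simp add: square_lact_bt square_ract_bt L_right_mult_antipode bt_simps
        clinearD[OF clinear_square_ract] flip: bt_balanced square_ract_bt)
  have exchange: "\<sigma> (bt (L w) (\<eta> m n)) = bt (\<eta> m n) (L w)" for w
    by (rule \<sigma>_exchange) (simp_all add: left_invariant_def left_coaction_L right_invariant_\<eta>)
  have "\<sigma> (bt (L v) (ract (lact (S (u i m)) (\<eta> m n)) (u n j)))
      = (\<Sum>r\<in>UNIV. bt (lact (S (u r m)) (\<eta> m n)) (ract (L (qact v (S (u i r)))) (u n j)))"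
    unfolding eq \<sigma>_simps \<sigma>_sqR \<sigma>_sqL exchange by (simp add: square_lact_bt square_ract_bt)
  then show ?thesis by (simp add: L_right_mult_u bt_simps bt_balanced)
qed

text \<open>The sums over m and n reassemble the right-invariant forms into \<omega>(u_rp), so only
  the module action is left in the formula.\<close>

lemma \<sigma>_B_\<chi>:
  "\<sigma> (B v (\<chi> (u i j))) = (\<Sum>r\<in>UNIV. \<Sum>p\<in>UNIV. B (\<chi> (u r p)) (qact (qact v (S (u i r))) (u p j)))"
proof -
  have "\<sigma> (B v (\<chi> (u i j))) = - (\<Sum>m\<in>UNIV. \<Sum>n\<in>UNIV. \<Sum>r\<in>UNIV. \<Sum>p\<in>UNIV.
      bt (ract (lact (S (u r m)) (\<eta> m n)) (u n p)) (L (qact (qact v (S (u i r))) (u p j))))"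
    unfolding B_def \<omega>_u_eq[symmetric] \<omega>_u_eq_\<eta>[of i j] bt_simps \<sigma>_simps \<sigma>_tensor_\<eta> ..
  also have "\<dots> = (\<Sum>r\<in>UNIV. \<Sum>p\<in>UNIV. bt (- (\<Sum>m\<in>UNIV. \<Sum>n\<in>UNIV. ract (lact (S (u r m)) (\<eta> m n)) (u n p)))
      (L (qact (qact v (S (u i r))) (u p j))))"
    by (simp add: sum_UNIV_bool bt_simps)
  also have "\<dots> = (\<Sum>r\<in>UNIV. \<Sum>p\<in>UNIV. B (\<chi> (u r p)) (qact (qact v (S (u i r))) (u p j)))"
    unfolding \<omega>_u_eq_\<eta>[symmetric] B_def \<omega>_u_eq ..
  finally show ?thesis .
qed

section \<open>The matrix of the braiding\<close>

abbreviation "v\<theta> \<equiv> Quad 1 0 0 0"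
abbreviation "ve \<equiv> Quad 0 1 0 0"
abbreviation "vf \<equiv> Quad 0 0 1 0"
abbreviation "vn \<equiv> Quad 0 0 0 1"

text \<open>Coordinates for \<open>V\<close>: the argument in each slot is the second tensor factor that accompanies
  the corresponding basis vector in the first factor.\<close>

definition M :: "quad \<Rightarrow> quad \<Rightarrow> quad \<Rightarrow> quad \<Rightarrow> 't"
  where "M a b c g = B v\<theta> a + B ve b + B vf c + B vn g"

lemma B_eq_M: "B (Quad a b c g) w = M (a *\<^sub>C w) (b *\<^sub>C w) (c *\<^sub>C w) (g *\<^sub>C w)"
proof -
  have "Quad a b c g = a *\<^sub>C v\<theta> + b *\<^sub>C ve + c *\<^sub>C vf + g *\<^sub>C vn" by (simp add: quad_simps)
  then show ?thesis by (simp only: M_def B_simps)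
qed

lemma M_simps:
  "M a b c g + M a' b' c' g' = M (a + a') (b + b') (c + c') (g + g')"
  "M a b c g - M a' b' c' g' = M (a - a') (b - b') (c - c') (g - g')"
  "- M a b c g = M (- a) (- b) (- c) (- g)"
  "x *\<^sub>C M a b c g = M (x *\<^sub>C a) (x *\<^sub>C b) (x *\<^sub>C c) (x *\<^sub>C g)"
  by (simp_all add: M_def B_simps scaleC_distribs)

lemma M_cong: "a = a' \<Longrightarrow> b = b' \<Longrightarrow> c = c' \<Longrightarrow> g = g' \<Longrightarrow> M a b c g = M a' b' c' g'"
  by simp

lemmas \<sigma>_expand = \<sigma>_B_\<chi> antipode_u sum_UNIV_bool
lemmas M_expand = u_simps \<chi>_simps \<chi>_gen qact_simps qact_gen B_eq_M M_simps quad_simps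

text \<open>The plain flip is what right-invariance of \<theta> predicts; here it falls out of the
  explicit formula.\<close>

lemma \<sigma>_B_\<theta>: "\<sigma> (B v v\<theta>) = B v\<theta> v"
proof -
  obtain a b c g where v: "v = Quad a b c g" by (meson quad.exhaust)
  have "v\<theta> = (1 / c\<^sub>0) *\<^sub>C (k\<^sup>2 *\<^sub>C \<chi> (u False False) + \<chi> (u True True))"
    by (simp only: u_simps quad_decomp(1))
  then have "\<sigma> (B v v\<theta>) = (1 / c\<^sub>0) *\<^sub>C (k\<^sup>2 *\<^sub>C \<sigma> (B v (\<chi> (u False False))) + \<sigma> (B v (\<chi> (u True True))))"
    by (simp only: B_simps \<sigma>_simps)
  also have "k\<^sup>2 *\<^sub>C \<sigma> (B v (\<chi> (u False False))) + \<sigma> (B v (\<chi> (u True True))) = c\<^sub>0 *\<^sub>C B v\<theta> v"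
    \<comment> \<open>Collecting by the first tensor factor and comparing the slots of
      \<open>M\<close> leaves rational identities in q; the case split on the sign makes
      \<open>sg\<close> numerical.\<close>
    unfolding \<sigma>_expand v
    by (simp add: M_expand q_range(3), rule M_cong)
      (use sign k_nonzero(1) in \<open>auto simp: c\<^sub>0_def \<nu>_def field_simps power2_eq_square power3_eq_cube\<close>)
  finally show ?thesis using c\<^sub>0_nonzero by (simp add: scaleC_scaleC scaleC_one)
qed

text \<open>Each image has the total weight of its argument, and the sign has dropped out: both
  calculi have the same matrix.\<close>

lemma \<sigma>_B_e:
  "\<sigma> (B v\<theta> ve) = k\<^sup>2 *\<^sub>C B ve v\<theta> + (1 - k\<^sup>2) *\<^sub>C (B v\<theta> ve + (1 + k\<^sup>2) *\<^sub>C B vn ve)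
    - ((1 + k\<^sup>2) * (1 - k\<^sup>2) / k\<^sup>2) *\<^sub>C B ve vn"
  "\<sigma> (B ve ve) = B ve ve"
  "\<sigma> (B vf ve) = B ve vf + \<nu> ^ 3 *\<^sub>C (B v\<theta> vn + (1 + k\<^sup>2) *\<^sub>C B vn vn)"
  "\<sigma> (B vn ve) = (1 / k\<^sup>2) *\<^sub>C B ve vn"
proof -
  have *: "\<sigma> (B v ve) = \<sigma> (B v (\<chi> (u True False)))" for v
    by (simp only: u_simps \<chi>_gen)
  show "\<sigma> (B v\<theta> ve) = k\<^sup>2 *\<^sub>C B ve v\<theta> + (1 - k\<^sup>2) *\<^sub>C (B v\<theta> ve + (1 + k\<^sup>2) *\<^sub>C B vn ve)
    - ((1 + k\<^sup>2) * (1 - k\<^sup>2) / k\<^sup>2) *\<^sub>C B ve vn"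
    unfolding * \<sigma>_expand
    by (simp add: M_expand q_range(3), rule M_cong)
      (use sign k_nonzero(1) in \<open>auto simp: \<nu>_def field_simps power2_eq_square power3_eq_cube\<close>)
  show "\<sigma> (B ve ve) = B ve ve"
    unfolding * \<sigma>_expand
    by (simp add: M_expand q_range(3), rule M_cong)
      (use sign k_nonzero(1) in \<open>auto simp: \<nu>_def field_simps power2_eq_square power3_eq_cube\<close>)
  show "\<sigma> (B vf ve) = B ve vf + \<nu> ^ 3 *\<^sub>C (B v\<theta> vn + (1 + k\<^sup>2) *\<^sub>C B vn vn)"
    unfolding * \<sigma>_expand
    by (simp add: M_expand q_range(3), rule M_cong)
      (use sign k_nonzero(1) in \<open>auto simp: \<nu>_def field_simps power2_eq_square power3_eq_cube\<close>)
  show "\<sigma> (B vn ve) = (1 / k\<^sup>2) *\<^sub>C B ve vn"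
    unfolding * \<sigma>_expand
    by (simp add: M_expand q_range(3), rule M_cong)
      (use sign k_nonzero(1) in \<open>auto simp: \<nu>_def field_simps power2_eq_square power3_eq_cube\<close>)
qed

lemma \<sigma>_B_f:
  "\<sigma> (B v\<theta> vf) = (1 / k\<^sup>2) *\<^sub>C B vf v\<theta> + ((1 + k\<^sup>2) * (1 - k\<^sup>2)) *\<^sub>C B vf vn
    - ((1 - k\<^sup>2) / k\<^sup>2) *\<^sub>C (B v\<theta> vf + (1 + k\<^sup>2) *\<^sub>C B vn vf)"
  "\<sigma> (B ve vf) = B vf ve - \<nu> ^ 3 *\<^sub>C (B v\<theta> vn + (1 + k\<^sup>2) *\<^sub>C B vn vn)"
  "\<sigma> (B vf vf) = B vf vf"
  "\<sigma> (B vn vf) = k\<^sup>2 *\<^sub>C B vf vn"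
proof -
  have *: "\<sigma> (B v vf) = (- 1 / k) *\<^sub>C \<sigma> (B v (\<chi> (u False True)))" for v
  proof -
    have "vf = (- 1 / k) *\<^sub>C \<chi> (u False True)"
      using k_nonzero(1) by (simp add: u_simps \<chi>_simps \<chi>_gen quad_simps)
    then show ?thesis by (simp only: B_simps \<sigma>_simps)
  qed
  show "\<sigma> (B v\<theta> vf) = (1 / k\<^sup>2) *\<^sub>C B vf v\<theta> + ((1 + k\<^sup>2) * (1 - k\<^sup>2)) *\<^sub>C B vf vn
    - ((1 - k\<^sup>2) / k\<^sup>2) *\<^sub>C (B v\<theta> vf + (1 + k\<^sup>2) *\<^sub>C B vn vf)"
    unfolding * \<sigma>_expand
    by (simp add: M_expand q_range(3), rule M_cong)
      (use sign k_nonzero(1) in \<open>auto simp: \<nu>_def field_simps power2_eq_square power3_eq_cube\<close>)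
  show "\<sigma> (B ve vf) = B vf ve - \<nu> ^ 3 *\<^sub>C (B v\<theta> vn + (1 + k\<^sup>2) *\<^sub>C B vn vn)"
    unfolding * \<sigma>_expand
    by (simp add: M_expand q_range(3), rule M_cong)
      (use sign k_nonzero(1) in \<open>auto simp: \<nu>_def field_simps power2_eq_square power3_eq_cube\<close>)
  show "\<sigma> (B vf vf) = B vf vf"
    unfolding * \<sigma>_expand
    by (simp add: M_expand q_range(3), rule M_cong)
      (use sign k_nonzero(1) in \<open>auto simp: \<nu>_def field_simps power2_eq_square power3_eq_cube\<close>)
  show "\<sigma> (B vn vf) = k\<^sup>2 *\<^sub>C B vf vn"
    unfolding * \<sigma>_expand
    by (simp add: M_expand q_range(3), rule M_cong)
      (use sign k_nonzero(1) in \<open>auto simp: \<nu>_def field_simps power2_eq_square power3_eq_cube\<close>)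
qed

lemma \<sigma>_B_n:
  "\<sigma> (B v\<theta> vn) = B vn v\<theta> - \<nu>\<^sup>2 *\<^sub>C (B v\<theta> vn + (1 + k\<^sup>2) *\<^sub>C B vn vn) + (1 / \<nu>) *\<^sub>C (B vf ve - B ve vf)"
  "\<sigma> (B ve vn) = B vn ve - (\<nu> / k) *\<^sub>C B ve vn"
  "\<sigma> (B vf vn) = B vn vf + (\<nu> * k) *\<^sub>C B vf vn"
  "\<sigma> (B vn vn) = B vn vn"
proof -
  \<comment> \<open>Since n is a combination of \<theta> and \<chi>(\<alpha>), its column follows
    from the flip for \<theta> and the general formula at \<alpha>.\<close>
  have *: "\<sigma> (B v vn) = (sg / \<nu>) *\<^sub>C ((sg * k - 1) *\<^sub>C B v\<theta> v - \<sigma> (B v (\<chi> (u False False))))" for v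
  proof -
    have "vn = (sg / \<nu>) *\<^sub>C ((sg * k - 1) *\<^sub>C v\<theta> - \<chi> (u False False))"
      by (simp only: u_simps quad_decomp(2))
    then have "\<sigma> (B v vn) = (sg / \<nu>) *\<^sub>C ((sg * k - 1) *\<^sub>C \<sigma> (B v v\<theta>) - \<sigma> (B v (\<chi> (u False False))))"
      by (simp only: B_simps \<sigma>_simps)
    then show ?thesis by (simp only: \<sigma>_B_\<theta>)
  qed
  have nu: "1 - k * k \<noteq> 0" using k_nonzero(2) by (simp add: power2_eq_square)
  show "\<sigma> (B v\<theta> vn) = B vn v\<theta> - \<nu>\<^sup>2 *\<^sub>C (B v\<theta> vn + (1 + k\<^sup>2) *\<^sub>C B vn vn) + (1 / \<nu>) *\<^sub>C (B vf ve - B ve vf)"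
    unfolding * \<sigma>_expand
    by (simp add: M_expand q_range(3) \<nu>_nonzero, rule M_cong)
      (use sign k_nonzero(1) nu in \<open>auto simp: \<nu>_def field_simps power2_eq_square power3_eq_cube\<close>)
  show "\<sigma> (B ve vn) = B vn ve - (\<nu> / k) *\<^sub>C B ve vn"
    unfolding * \<sigma>_expand
    by (simp add: M_expand q_range(3) \<nu>_nonzero, rule M_cong)
      (use sign k_nonzero(1) nu in \<open>auto simp: \<nu>_def field_simps power2_eq_square power3_eq_cube\<close>)
  show "\<sigma> (B vf vn) = B vn vf + (\<nu> * k) *\<^sub>C B vf vn"
    unfolding * \<sigma>_expand
    by (simp add: M_expand q_range(3) \<nu>_nonzero, rule M_cong)
      (use sign k_nonzero(1) nu in \<open>auto simp: \<nu>_def field_simps power2_eq_square power3_eq_cube\<close>)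
  show "\<sigma> (B vn vn) = B vn vn"
    unfolding * \<sigma>_expand
    by (simp add: M_expand q_range(3) \<nu>_nonzero, rule M_cong)
      (use sign k_nonzero(1) nu in \<open>auto simp: \<nu>_def field_simps power2_eq_square power3_eq_cube\<close>)
qed

lemma span_B_basis:
  assumes U: "cvs.subspace U"
    and basis: "\<And>v w. v \<in> {v\<theta>, ve, vf, vn} \<Longrightarrow> w \<in> {v\<theta>, ve, vf, vn} \<Longrightarrow> B v w \<in> U"
  shows "V \<subseteq> U"
proof -
  have quad: "v = coord_\<theta> v *\<^sub>C v\<theta> + coord_e v *\<^sub>C ve + coord_f v *\<^sub>C vf + coord_n v *\<^sub>C vn" for v
    by (cases v) (simp add: quad_simps)
  have "B v w \<in> U" if "v \<in> {v\<theta>, ve, vf, vn}" for v w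
    by (subst quad[of w], unfold B_simps) (intro cvs.subspace_add[OF U] cvs.subspace_scale[OF U] basis that; simp)
  then have "B v w \<in> U" for v w
    by (subst quad[of v], unfold B_simps) (intro cvs.subspace_add[OF U] cvs.subspace_scale[OF U]; simp)
  then show ?thesis
    unfolding left_invariant_square by (intro cvs.span_minimal[OF _ U]) blast
qed

lemma B_in_V: "B v w \<in> V"
  unfolding left_invariant_square by (rule cvs.span_base) blast

lemma subspace_V: "cvs.subspace V"
  unfolding left_invariant_square by (rule cvs.subspace_span)

lemma \<sigma>_V: "t \<in> V \<Longrightarrow> \<sigma> t \<in> V"
proof -
  have B: "\<sigma> (B v w) \<in> V" for v w
  proof -
    have "w \<in> cvs.span (range (\<lambda>(i, j). \<chi> (u i j)))" unfolding span_\<chi>_u by (rule UNIV_I)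
    then show ?thesis
    proof (induction rule: cvs.span_induct_alt)
      case (step c x y)
      then obtain i j where x: "x = \<chi> (u i j)" by auto
      have "\<sigma> (B v x) \<in> V"
        unfolding x \<sigma>_B_\<chi> by (intro cvs.subspace_sum[OF subspace_V] B_in_V)
      then show ?case
        unfolding B_simps \<sigma>_simps
        by (intro cvs.subspace_add[OF subspace_V] cvs.subspace_scale[OF subspace_V] step(2))
    qed (simp add: B_simps \<sigma>_simps cvs.subspace_0[OF subspace_V])
  qed
  assume "t \<in> V"
  then have "t \<in> cvs.span {B v w | v w. True}" unfolding left_invariant_square .
  then show ?thesis
  proof (induction rule: cvs.span_induct_alt)
    case (step c x y)
    then have "\<sigma> x \<in> V" using B by blast
    then show ?case
      unfolding \<sigma>_simps
      by (intro cvs.subspace_add[OF subspace_V] cvs.subspace_scale[OF subspace_V] step(2))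
  qed (simp add: \<sigma>_simps cvs.subspace_0[OF subspace_V])
qed

section \<open>Eigenspaces of the braiding\<close>

abbreviation "eigenvalues \<equiv> {1, - (k\<^sup>2), - (1 / k\<^sup>2)}"
abbreviation "eigenspan \<equiv> cvs.span {v \<in> V. \<exists>t\<in>eigenvalues. \<sigma> v = t *\<^sub>C v}"

lemma eigenvalues_distinct: "1 \<noteq> - (k\<^sup>2)" "1 \<noteq> - (1 / k\<^sup>2)" "- (k\<^sup>2) \<noteq> - (1 / k\<^sup>2)"
proof -
  show "1 \<noteq> - (k\<^sup>2)" using k_nonzero(3) by (simp add: eq_neg_iff_add_eq_0)
  show "1 \<noteq> - (1 / k\<^sup>2)" using k_nonzero(1,3) by (auto simp: field_simps add_eq_0_iff)
  have "(1 - k\<^sup>2) * (1 + k\<^sup>2) \<noteq> 0" using k_nonzero by simp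
  then show "- (k\<^sup>2) \<noteq> - (1 / k\<^sup>2)" using k_nonzero(1) by (auto simp: field_simps)
qed

text \<open>Here \<open>quad\<close> is merely a four-dimensional coordinate space, \<open>A\<close>
  the matrix of \<sigma> on the block. The cubic is left unsimplified so as to match the elementary
  symmetric functions in \<open>cubic_span_eigenvectors\<close>.\<close>

lemma block_in_eigenspan:
  assumes basis: "b1 \<in> V" "b2 \<in> V" "b3 \<in> V" "b4 \<in> V"
    and J: "\<And>v. J v = coord_\<theta> v *\<^sub>C b1 + coord_e v *\<^sub>C b2 + coord_f v *\<^sub>C b3 + coord_n v *\<^sub>C b4"
    and A: "\<And>v. \<sigma> (J v) = J (A v)"
    and cubic: "\<And>v. A (A (A v)) = (1 + - (k\<^sup>2) + - (1 / k\<^sup>2)) *\<^sub>C A (A v)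
      - (1 * - (k\<^sup>2) + 1 * - (1 / k\<^sup>2) + - (k\<^sup>2) * - (1 / k\<^sup>2)) *\<^sub>C A v + (1 * - (k\<^sup>2) * - (1 / k\<^sup>2)) *\<^sub>C v"
  shows "b1 \<in> eigenspan" "b2 \<in> eigenspan" "b3 \<in> eigenspan" "b4 \<in> eigenspan"
proof -
  have J_linear: "clinear J"
    by (rule clinearI) (simp_all add: J quad_simps scaleC_distribs algebra_simps)
  have "J v \<in> V" for v
    unfolding J by (intro cvs.subspace_add[OF subspace_V] cvs.subspace_scale[OF subspace_V] basis)
  then have "J v \<in> eigenspan" for v
    by (intro cubic_span_eigenvectors[OF clinear_\<sigma> subspace_V \<sigma>_V] eigenvalues_distinct)
      (simp_all only: A cubic clinearD[OF J_linear])
  from this[of v\<theta>] this[of ve] this[of vf] this[of vn]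
  show "b1 \<in> eigenspan" "b2 \<in> eigenspan" "b3 \<in> eigenspan" "b4 \<in> eigenspan"
    by (simp_all add: J scaleC_one)
qed

lemma fixed_in_eigenspan: "t \<in> V \<Longrightarrow> \<sigma> t = t \<Longrightarrow> t \<in> eigenspan"
  by (rule cvs.span_base) (auto simp: scaleC_one)

lemma e_block:
  "B ve v\<theta> \<in> eigenspan" "B v\<theta> ve \<in> eigenspan" "B ve vn \<in> eigenspan" "B vn ve \<in> eigenspan"
proof -
  define J where "J v = coord_\<theta> v *\<^sub>C B ve v\<theta> + coord_e v *\<^sub>C B v\<theta> ve + coord_f v *\<^sub>C B ve vn
    + coord_n v *\<^sub>C B vn ve" for v
  \<comment> \<open>With q^2 and q^(-2) as independent letters, the cubic becomes a polynomial
    identity modulo p i = 1.\<close>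
  define p i m where "p = k\<^sup>2" "i = 1 / p" "m = \<nu> / k"
  note defs = p_i_m_def
  have pi: "p * i = 1" and m: "m = i - 1"
    using k_nonzero(1) by (simp_all add: defs \<nu>_def field_simps power2_eq_square)
  define A where "A v = (case v of Quad a b c g \<Rightarrow> Quad (p * b) (a + (1 - p) * b)
    (i * g - (1 + p) * (1 - p) * i * b - m * c) ((1 - p) * (1 + p) * b + c))" for v
  have A: "\<sigma> (J v) = J (A v)" for v
    by (cases v) (simp add: J_def A_def defs \<sigma>_simps \<sigma>_B_\<theta> \<sigma>_B_e \<sigma>_B_n scaleC_distribs, simp add: algebra_simps)
  have "A (A (A v)) = (1 + - p + - i) *\<^sub>C A (A v)
      - (1 * - p + 1 * - i + - p * - i) *\<^sub>C A v + (1 * - p * - i) *\<^sub>C v" for v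
  proof -
    obtain a b c g where v: "v = Quad a b c g" by (meson quad.exhaust)
    have pi': "i * p = 1" "i * (p * x) = x" "p * (i * x) = x" for x
      using pi by (simp_all add: mult.commute mult.left_commute)
    show ?thesis
      unfolding v A_def quad_simps quad.case quad.sel quad.inject m
      by (intro conjI) (simp_all add: algebra_simps pi pi')
  qed
  from block_in_eigenspan[where J = J and A = A, OF B_in_V B_in_V B_in_V B_in_V J_def A this[unfolded defs]]
  show "B ve v\<theta> \<in> eigenspan" "B v\<theta> ve \<in> eigenspan" "B ve vn \<in> eigenspan" "B vn ve \<in> eigenspan"
    by blast+
qed

lemma f_block:
  "B vf v\<theta> \<in> eigenspan" "B v\<theta> vf \<in> eigenspan" "B vf vn \<in> eigenspan" "B vn vf \<in> eigenspan"
proof -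
  define J where "J v = coord_\<theta> v *\<^sub>C B vf v\<theta> + coord_e v *\<^sub>C B v\<theta> vf + coord_f v *\<^sub>C B vf vn
    + coord_n v *\<^sub>C B vn vf" for v
  define p i m where "p = k\<^sup>2" "i = 1 / p" "m = \<nu> * k"
  note defs = p_i_m_def
  have pi: "p * i = 1" and m: "m = 1 - p"
    using k_nonzero(1) by (simp_all add: defs \<nu>_def field_simps power2_eq_square)
  define A where "A v = (case v of Quad a b c g \<Rightarrow> Quad (i * b) (a - (1 - p) * i * b)
    ((1 + p) * (1 - p) * b + m * c + p * g) (c - (1 - p) * i * (1 + p) * b))" for v
  have A: "\<sigma> (J v) = J (A v)" for v
  proof -
    \<comment> \<open>Naming these factors keeps them opaque while scalars are distributed.\<close>
    define Q W where "Q = 1 + k\<^sup>2" "W = 1 - k\<^sup>2"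
    note QW = Q_W_def[symmetric]
    show ?thesis
      by (cases v) (simp add: J_def A_def defs \<sigma>_simps \<sigma>_B_\<theta> \<sigma>_B_f[unfolded QW] \<sigma>_B_n[unfolded QW] QW scaleC_distribs,
          simp add: algebra_simps)
  qed
  have "A (A (A v)) = (1 + - p + - i) *\<^sub>C A (A v)
      - (1 * - p + 1 * - i + - p * - i) *\<^sub>C A v + (1 * - p * - i) *\<^sub>C v" for v
  proof -
    obtain a b c g where v: "v = Quad a b c g" by (meson quad.exhaust)
    have pi': "i * p = 1" "i * (p * x) = x" "p * (i * x) = x" for x
      using pi by (simp_all add: mult.commute mult.left_commute)
    show ?thesis
      unfolding v A_def quad_simps quad.case quad.sel quad.inject m
      by (intro conjI) (simp_all add: algebra_simps pi pi')
  qed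
  from block_in_eigenspan[where J = J and A = A, OF B_in_V B_in_V B_in_V B_in_V J_def A this[unfolded defs]]
  show "B vf v\<theta> \<in> eigenspan" "B v\<theta> vf \<in> eigenspan" "B vf vn \<in> eigenspan" "B vn vf \<in> eigenspan"
    by blast+
qed

text \<open>Weight zero has dimension six. Splitting off \<theta> \<otimes> \<theta> and the
  symmetric combination of e \<otimes> f and f \<otimes> e, both fixed by \<sigma>, leaves an
  invariant block containing only their antisymmetric combination \<open>D\<close>.\<close>

lemma weight_zero_block:
  "B vn v\<theta> \<in> eigenspan" "B v\<theta> vn \<in> eigenspan" "B vf ve - B ve vf \<in> eigenspan" "B vn vn \<in> eigenspan"
proof -
  define D where "D = B vf ve - B ve vf"
  define J where "J v = coord_\<theta> v *\<^sub>C B vn v\<theta> + coord_e v *\<^sub>C B v\<theta> vn + coord_f v *\<^sub>C D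
    + coord_n v *\<^sub>C B vn vn" for v
  define p i j where "p = k\<^sup>2" "i = 1 / p" "j = 1 / \<nu>"
  note defs = p_i_j_def
  have pi: "p * i = 1" and nu: "\<nu>\<^sup>2 = i - 2 + p" and j: "j * \<nu> = 1"
    using k_nonzero(1) \<nu>_nonzero by (simp_all add: defs) (simp add: \<nu>_def field_simps power2_eq_square)
  define A where "A v = (case v of Quad a b c g \<Rightarrow> Quad b (a - \<nu>\<^sup>2 * b + 2 * \<nu> ^ 3 * c) (j * b - c)
    (g - \<nu>\<^sup>2 * (1 + p) * b + 2 * \<nu> ^ 3 * (1 + p) * c))" for v
  have \<sigma>_D: "\<sigma> D = (2 * \<nu> ^ 3) *\<^sub>C (B v\<theta> vn + (1 + k\<^sup>2) *\<^sub>C B vn vn) - D"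
  proof -
    define X where "X = \<nu> ^ 3 *\<^sub>C (B v\<theta> vn + (1 + k\<^sup>2) *\<^sub>C B vn vn)"
    have "\<sigma> D = (1 + 1) *\<^sub>C X - D"
      unfolding scaleC_add_left by (simp add: D_def \<sigma>_simps \<sigma>_B_e \<sigma>_B_f scaleC_one flip: X_def)
    then show ?thesis by (simp add: X_def scaleC_scaleC)
  qed
  have A: "\<sigma> (J v) = J (A v)" for v
    by (cases v) (simp add: J_def A_def defs \<sigma>_simps \<sigma>_D \<sigma>_B_\<theta> \<sigma>_B_n scaleC_distribs flip: D_def,
        simp add: algebra_simps)
  have cubic: "A (A (A v)) = (1 + - p + - i) *\<^sub>C A (A v)
      - (1 * - p + 1 * - i + - p * - i) *\<^sub>C A v + (1 * - p * - i) *\<^sub>C v" for v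
  proof -
    obtain a b c g where v: "v = Quad a b c g" by (meson quad.exhaust)
    \<comment> \<open>Because p i = 1 and p + i = \<nu>^2 + 2, the cubic is expressed through \<nu>
      alone.\<close>
    have coeffs: "1 + - p + - i = - 1 - \<nu>\<^sup>2" "1 * - p + 1 * - i + - p * - i = - 1 - \<nu>\<^sup>2"
      "1 * - p * - i = 1"
      using pi nu by (simp_all add: algebra_simps)
    have nuj: "\<nu> ^ 3 * j = \<nu>\<^sup>2" using j by algebra
    show ?thesis
      unfolding v A_def quad_simps quad.case quad.sel quad.inject coeffs
      by (intro conjI; use nuj in algebra)
  qed
  have D_in_V: "D \<in> V" unfolding D_def by (rule cvs.subspace_diff[OF subspace_V B_in_V B_in_V])
  from block_in_eigenspan[where J = J and A = A, OF B_in_V B_in_V D_in_V B_in_V J_def A cubic[unfolded defs]]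
  show "B vn v\<theta> \<in> eigenspan" "B v\<theta> vn \<in> eigenspan" "B vf ve - B ve vf \<in> eigenspan" "B vn vn \<in> eigenspan"
    unfolding D_def by blast+
qed

lemma eigenspan_eq_V: "V = eigenspan"
proof
  show "eigenspan \<subseteq> V" by (rule cvs.span_minimal[OF _ subspace_V]) blast
  have fixed: "B v\<theta> v\<theta> \<in> eigenspan" "B ve ve \<in> eigenspan" "B vf vf \<in> eigenspan"
    by (rule fixed_in_eigenspan; simp add: B_in_V \<sigma>_B_\<theta> \<sigma>_B_e \<sigma>_B_f)+
  \<comment> \<open>The \<nu>^3 terms in the two images are opposite and cancel.\<close>
  have sum: "B vf ve + B ve vf \<in> eigenspan"
    by (rule fixed_in_eigenspan)
      (simp_all add: cvs.subspace_add[OF subspace_V] B_in_V \<sigma>_simps \<sigma>_B_e \<sigma>_B_f)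
  have "B vf ve = (1 / 2) *\<^sub>C ((B vf ve + B ve vf) + (B vf ve - B ve vf))"
    "B ve vf = (1 / 2) *\<^sub>C ((B vf ve + B ve vf) - (B vf ve - B ve vf))"
    by (simp_all add: scaleC_distribs flip: scaleC_add_left)
  then have mixed: "B vf ve \<in> eigenspan" "B ve vf \<in> eigenspan"
    using cvs.span_scale[OF cvs.span_add[OF sum weight_zero_block(3)], of "1 / 2"]
      cvs.span_scale[OF cvs.span_diff[OF sum weight_zero_block(3)], of "1 / 2"] by (simp_all only:)
  show "V \<subseteq> eigenspan"
    by (rule span_B_basis[OF cvs.subspace_span], elim insertE emptyE)
      (simp_all only: fixed mixed e_block f_block weight_zero_block)
qed

lemma eigenvector_exists:
  assumes "t \<in> eigenvalues"
  shows "\<exists>v\<in>V. v \<noteq> 0 \<and> \<sigma> v = t *\<^sub>C v"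
proof -
  obtain \<Phi> where \<Phi>: "clinear \<Phi>" "\<And>v w. \<Phi> (B v w) = v \<otimes>\<^sub>C w" by (rule B_independent) blast
  have bil: "cbilinear (\<lambda>v w. coord_e v * coord_e w)" "cbilinear (\<lambda>v w. coord_f v * coord_n w)"
    "cbilinear (\<lambda>v w. coord_e v * coord_n w)"
    by (rule cbilinearI; simp add: quad_simps scaleC_complex_def algebra_simps)+
  note simps = \<Phi>(2) clinearD[OF \<Phi>(1)] tensor_lift_simps bil scaleC_complex_def
  \<comment> \<open>The planes spanned by f \<otimes> n, n \<otimes> f and by e \<otimes> n, n
    \<otimes> e are invariant, with eigenvalues 1, -q^2 and 1, -q^(-2); y and z are the eigenvectors
    for the nontrivial ones.\<close>
  define x y z where "x = B ve ve" "y = k\<^sup>2 *\<^sub>C B vf vn - B vn vf" "z = B ve vn - k\<^sup>2 *\<^sub>C B vn ve"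
  have "tensor_lift (\<lambda>v w. coord_e v * coord_e w) (\<Phi> x) = 1"
    "tensor_lift (\<lambda>v w. coord_f v * coord_n w) (\<Phi> y) = k\<^sup>2"
    "tensor_lift (\<lambda>v w. coord_e v * coord_n w) (\<Phi> z) = 1"
    by (simp_all add: x_y_z_def simps)
  then have nonzero: "x \<noteq> 0" "y \<noteq> 0" "z \<noteq> 0"
    using k_nonzero(1) by (auto simp: simps)
  have eig: "\<sigma> x = 1 *\<^sub>C x" "\<sigma> y = (- (k\<^sup>2)) *\<^sub>C y" "\<sigma> z = (- (1 / k\<^sup>2)) *\<^sub>C z"
  proof -
    show "\<sigma> x = 1 *\<^sub>C x" by (simp add: x_y_z_def \<sigma>_B_e scaleC_one)
    have "\<sigma> y = (k\<^sup>2 * (\<nu> * k) - k\<^sup>2) *\<^sub>C B vf vn + k\<^sup>2 *\<^sub>C B vn vf"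
      by (simp add: x_y_z_def \<sigma>_simps \<sigma>_B_f \<sigma>_B_n scaleC_distribs)
    also have "k\<^sup>2 * (\<nu> * k) - k\<^sup>2 = - (k\<^sup>2 * k\<^sup>2)"
      using k_nonzero(1) by (simp add: \<nu>_def field_simps power2_eq_square)
    finally show "\<sigma> y = (- (k\<^sup>2)) *\<^sub>C y" by (simp add: x_y_z_def scaleC_distribs)
    have "\<sigma> z = B vn ve - (\<nu> / k + k\<^sup>2 * (1 / k\<^sup>2)) *\<^sub>C B ve vn"
      by (simp add: x_y_z_def \<sigma>_simps \<sigma>_B_e \<sigma>_B_n scaleC_distribs)
    also have "\<nu> / k + k\<^sup>2 * (1 / k\<^sup>2) = 1 / k\<^sup>2"
      using k_nonzero(1) by (simp add: \<nu>_def field_simps power2_eq_square)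
    finally show "\<sigma> z = (- (1 / k\<^sup>2)) *\<^sub>C z"
      using k_nonzero(1) by (simp add: x_y_z_def scaleC_distribs scaleC_one)
  qed
  have "x \<in> V" "y \<in> V" "z \<in> V"
    unfolding x_y_z_def
    by (intro cvs.subspace_diff[OF subspace_V] cvs.subspace_scale[OF subspace_V] B_in_V)+
  then show ?thesis using assms nonzero eig by blast
qed

lemma braiding_diagonalisable:
  "diagonalisable_on V \<sigma> \<and> minimal_polynomial_on V \<sigma>
    ([:- 1, 1:] * [:complex_of_real (q\<^sup>2), 1:] * [:complex_of_real (1 / q\<^sup>2), 1:])"
proof
  show "diagonalisable_on V \<sigma>" by (rule diagonalisable_onI[OF eigenspan_eq_V])
  have set: "{- (- 1), - complex_of_real (q\<^sup>2), - complex_of_real (1 / q\<^sup>2)} = eigenvalues" by simp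
  show "minimal_polynomial_on V \<sigma>
    ([:- 1, 1:] * [:complex_of_real (q\<^sup>2), 1:] * [:complex_of_real (1 / q\<^sup>2), 1:])"
  proof (rule minimal_polynomial_on_three_eigenvalues[where a = "- 1" and b = "complex_of_real (q\<^sup>2)"
        and c = "complex_of_real (1 / q\<^sup>2)", OF clinear_\<sigma>, unfolded set])
    show "V = eigenspan" by (rule eigenspan_eq_V)
    show "- 1 \<noteq> complex_of_real (q\<^sup>2)" "- 1 \<noteq> complex_of_real (1 / q\<^sup>2)"
      "complex_of_real (q\<^sup>2) \<noteq> complex_of_real (1 / q\<^sup>2)"
      using eigenvalues_distinct by (auto simp: minus_equation_iff)
  qed (rule eigenvector_exists)
qed

end

theorem proposition3p2:
  fixes q s :: real
    and \<Delta> :: "'a::complex_algebra_1 \<Rightarrow> ('a, 'a) tensor"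
    and \<epsilon> :: "'a \<Rightarrow> complex"
    and S star :: "'a \<Rightarrow> 'a"
    and \<alpha> \<gamma> :: 'a
    and lact :: "'a \<Rightarrow> 'e::complex_vector \<Rightarrow> 'e"
    and ract :: "'e \<Rightarrow> 'a \<Rightarrow> 'e"
    and d :: "'a \<Rightarrow> 'e"
    and bt :: "'e \<Rightarrow> 'e \<Rightarrow> 't::complex_vector"
    and \<sigma> :: "'t \<Rightarrow> 't"
  assumes "- 1 < q" "q < 1" "q \<noteq> 0"
    and "suq2 \<Delta> \<epsilon> S star q \<alpha> \<gamma>"
    and "bicovariant_calculus lact ract d \<Delta>"
    and "s = 1 \<or> s = - 1"
    and "calculus_ideal \<Delta> \<epsilon> S lact d = right_ideal_generated (four_d_generators q s star \<alpha> \<gamma>)"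
    and "tensor_over_algebra lact ract bt"
    and "is_braiding lact ract (left_coaction \<Delta> lact d) (right_coaction \<Delta> lact d) bt \<sigma>"
  shows "let V = left_invariant (square_left_coaction (left_coaction \<Delta> lact d) bt) in
    diagonalisable_on V \<sigma> \<and>
    minimal_polynomial_on V \<sigma>
      ([:- 1, 1:] * [:complex_of_real (q\<^sup>2), 1:] * [:complex_of_real (1 / q\<^sup>2), 1:])"
proof -
  interpret suq2 \<Delta> \<epsilon> S star q \<alpha> \<gamma> by fact
  interpret bicovariant_calculus lact ract d \<Delta> by fact
  interpret four_d_braided \<Delta> \<epsilon> S star q \<alpha> \<gamma> lact ract d s bt \<sigma>
    by unfold_locales (fact assms)+
  show ?thesis unfolding Let_def by (rule braiding_diagonalisable)
qed

end
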